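(* Let $k$ be a commutative ring with $2\in k^\times$, $A$ a commutative Hopf $k$-algebra with an involution $\theta$, and $G=\mathrm{Spec}\,A$. Let $\mathbf{A}$ be the contraction algebra of $(A,\theta)$, assume that $\mathbf{A}$ is flat over $k[t]$, and let $\mathbf{G}=\mathrm{Spec}\,\mathbf{A}$ be the contraction group scheme over $k[t]$. Suppose that $A$ is finitely presented over $k$. Then the Lie algebra of $\mathbf{G}$ is isomorphic, as a Lie algebra over $k[t]$, to $\boldsymbol{\mathfrak g}$.
   Context: An involution of a Hopf algebra is a Hopf algebra automorphism whose square is the identity. Put $A^{\pm\theta}=\{a\in A:\theta(a)=\pm a\}$. $\mathbf{A}$ is the $k[t]$-subalgebra of the Laurent polynomial ring $A[\sqrt t^{\pm1}]$ (variable $\sqrt t$, $t=(\sqrt t)^2$) generated by $A^\theta$ and $\frac1{\sqrt t}A^{-\theta}$. When $\mathbf{A}$ is flat over $k[t]$, it is a Hopf algebra over $k[t]$, with structure maps restricted from the Hopf $k[\sqrt t^{\pm1}]$-algebra $A[\sqrt t^{\pm1}]$. Let $\mathfrak g$ be the Lie algebra of $G$ (identified with the $k$-derivations $A\to k$ with respect to the counit), with the involution induced by $\theta$, and $\mathfrak k=\{x\in\mathfrak g:\theta(x)=x\}$, $\mathfrak p=\{x\in\mathfrak g:\theta(x)=-x\}$. The contraction Lie algebra is the $k[t]$-module $\boldsymbol{\mathfrak g}=\mathfrak g\otimes_kk[t]$ with the $k[t]$-bilinear (antisymmetric) bracket determined by $[x,y]_{\boldsymbol{\mathfrak g}}=[x,y]_{\mathfrak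 g}$ if $x\in\mathfrak k,y\in\mathfrak g$, and $[x,y]_{\boldsymbol{\mathfrak g}}=t[x,y]_{\mathfrak g}$ if $x,y\in\mathfrak p$. *)

theory Defs
  imports "HOL-Algebra.Free_Abelian_Groups" "HOL-Algebra.UnivPoly"
begin

section \<open>Tensor products of modules\<close>

text \<open>
  The tensor product is the free abelian group on \<open>M \<times> N\<close> modulo the bilinearity and
  balancing relations.  Its elements are cosets, so that all constructions can be iterated.
  The fields \<open>mult\<close> and \<open>one\<close> are only meaningful when both factors are algebras.
\<close>

type_synonym ('m, 'n) tensor = "('m \<times> 'n \<Rightarrow>\<^sub>0 int) set"

definition tensor_free ::
  "('r, 'm, 'x) module_scheme \<Rightarrow> ('r, 'n, 'y) module_scheme \<Rightarrow> ('m \<times> 'n \<Rightarrow>\<^sub>0 int) monoid" where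
  "tensor_free M N = free_Abelian_group (carrier M \<times> carrier N)"

definition tensor_relations ::
  "('r, 'z) ring_scheme \<Rightarrow> ('r, 'm, 'x) module_scheme \<Rightarrow> ('r, 'n, 'y) module_scheme \<Rightarrow>
     ('m \<times> 'n \<Rightarrow>\<^sub>0 int) set" where
  "tensor_relations R M N =
     {frag_of (m \<oplus>\<^bsub>M\<^esub> m', n) - frag_of (m, n) - frag_of (m', n) | m m' n.
        m \<in> carrier M \<and> m' \<in> carrier M \<and> n \<in> carrier N} \<union>
     {frag_of (m, n \<oplus>\<^bsub>N\<^esub> n') - frag_of (m, n) - frag_of (m, n') | m n n'.
        m \<in> carrier M \<and> n \<in> carrier N \<and> n' \<in> carrier N} \<union>
     {frag_of (r \<odot>\<^bsub>M\<^esub> m, n) - frag_of (m, r \<odot>\<^bsub>N\<^esub> n) | r m n.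
        r \<in> carrier R \<and> m \<in> carrier M \<and> n \<in> carrier N}"

definition tensor_null ::
  "('r, 'z) ring_scheme \<Rightarrow> ('r, 'm, 'x) module_scheme \<Rightarrow> ('r, 'n, 'y) module_scheme \<Rightarrow>
     ('m, 'n) tensor" where
  "tensor_null R M N = generate (tensor_free M N) (tensor_relations R M N)"

definition tensor_class ::
  "('r, 'z) ring_scheme \<Rightarrow> ('r, 'm, 'x) module_scheme \<Rightarrow> ('r, 'n, 'y) module_scheme \<Rightarrow>
     ('m \<times> 'n \<Rightarrow>\<^sub>0 int) \<Rightarrow> ('m, 'n) tensor" where
  "tensor_class R M N c = tensor_null R M N #>\<^bsub>tensor_free M N\<^esub> c"

definition pure_tensor ::
  "('r, 'z) ring_scheme \<Rightarrow> ('r, 'm, 'x) module_scheme \<Rightarrow> ('r, 'n, 'y) module_scheme \<Rightarrow>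
     'm \<Rightarrow> 'n \<Rightarrow> ('m, 'n) tensor" where
  "pure_tensor R M N m n = tensor_class R M N (frag_of (m, n))"

definition tensor_rep :: "('m, 'n) tensor \<Rightarrow> ('m \<times> 'n \<Rightarrow>\<^sub>0 int)" where
  "tensor_rep X = (SOME c. c \<in> X)"

definition tensor_product ::
  "('r, 'z) ring_scheme \<Rightarrow> ('r, 'm, 'x) module_scheme \<Rightarrow> ('r, 'n, 'y) module_scheme \<Rightarrow>
     ('r, ('m, 'n) tensor) module" where
  "tensor_product R M N =
     \<lparr>carrier = carrier (tensor_free M N Mod tensor_null R M N),
      monoid.mult = (\<lambda>X Y. tensor_class R M N
        (frag_extend (\<lambda>(m, n). frag_extend (\<lambda>(m', n'). frag_of (m \<otimes>\<^bsub>M\<^esub> m', n \<otimes>\<^bsub>N\<^esub> n')) (tensor_rep Y))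
          (tensor_rep X))),
      one = pure_tensor R M N \<one>\<^bsub>M\<^esub> \<one>\<^bsub>N\<^esub>,
      ring.zero = \<one>\<^bsub>tensor_free M N Mod tensor_null R M N\<^esub>,
      ring.add = (\<lambda>X Y. X \<otimes>\<^bsub>tensor_free M N Mod tensor_null R M N\<^esub> Y),
      smult = (\<lambda>r X. tensor_class R M N
        (frag_extend (\<lambda>(m, n). frag_of (r \<odot>\<^bsub>M\<^esub> m, n)) (tensor_rep X)))\<rparr>"

text \<open>
  \<open>tensor_lift P f\<close> is the additive map out of a tensor product with \<open>m \<otimes> n \<mapsto> f m n\<close>;
  it is independent of the chosen representative when \<open>f\<close> is biadditive and balanced.
\<close>

definition tensor_lift ::
  "('p, 'x) ring_scheme \<Rightarrow> ('m \<Rightarrow> 'n \<Rightarrow> 'p) \<Rightarrow> ('m, 'n) tensor \<Rightarrow> 'p" where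
  "tensor_lift P f X =
     (let c = tensor_rep X in
       \<Oplus>\<^bsub>P\<^esub>q \<in> Poly_Mapping.keys c. [Poly_Mapping.lookup c q] \<cdot>\<^bsub>P\<^esub> f (fst q) (snd q))"

text \<open>\<open>f \<otimes> g\<close>, with values in the tensor product of \<open>M'\<close> and \<open>N'\<close> over \<open>R'\<close>.\<close>

definition tensor_map ::
  "('r, 'z) ring_scheme \<Rightarrow> ('r, 'm1, 'x) module_scheme \<Rightarrow> ('r, 'n1, 'y) module_scheme \<Rightarrow>
     ('m \<Rightarrow> 'm1) \<Rightarrow> ('n \<Rightarrow> 'n1) \<Rightarrow> ('m, 'n) tensor \<Rightarrow> ('m1, 'n1) tensor" where
  "tensor_map R' M' N' f g =
     tensor_lift (tensor_product R' M' N') (\<lambda>m n. pure_tensor R' M' N' (f m) (g n))"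

text \<open>The associativity isomorphism from \<open>(M \<otimes> N) \<otimes> P\<close> to \<open>M \<otimes> (N \<otimes> P)\<close>.\<close>

definition tensor_assoc ::
  "('r, 'z) ring_scheme \<Rightarrow> ('r, 'm, 'x) module_scheme \<Rightarrow> ('r, 'n, 'y) module_scheme \<Rightarrow>
     ('r, 'p, 'w) module_scheme \<Rightarrow> (('m, 'n) tensor, 'p) tensor \<Rightarrow> ('m, ('n, 'p) tensor) tensor" where
  "tensor_assoc R M N P =
     (let NP = tensor_product R N P; T = tensor_product R M NP in
       tensor_lift T (\<lambda>X p. tensor_lift T
         (\<lambda>m n. pure_tensor R M NP m (pure_tensor R N P n p)) X))"

text \<open>The \<open>B\<close>-module \<open>M \<otimes>\<^sub>R B\<close> of an \<open>R\<close>-module \<open>M\<close> and an \<open>R\<close>-algebra \<open>B\<close>.\<close>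

definition base_change ::
  "('r, 'z) ring_scheme \<Rightarrow> ('r, 'm, 'x) module_scheme \<Rightarrow> ('r, 'b, 'y) module_scheme \<Rightarrow>
     ('b, ('m, 'b) tensor) module" where
  "base_change R M B =
     (let T = tensor_product R M B in
     \<lparr>carrier = carrier T, monoid.mult = monoid.mult T, one = monoid.one T,
      ring.zero = ring.zero T, ring.add = ring.add T,
      smult = (\<lambda>b. tensor_lift T (\<lambda>m b'. pure_tensor R M B m (b \<otimes>\<^bsub>B\<^esub> b')))\<rparr>)"

section \<open>Flatness\<close>

definition module_homs ::
  "('r, 'z) ring_scheme \<Rightarrow> ('r, 'm, 'x) module_scheme \<Rightarrow> ('r, 'n, 'y) module_scheme \<Rightarrow>
     ('m \<Rightarrow> 'n) set" where
  "module_homs R M N =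
     {f. f \<in> carrier M \<rightarrow> carrier N \<and>
         (\<forall>x\<in>carrier M. \<forall>y\<in>carrier M. f (x \<oplus>\<^bsub>M\<^esub> y) = f x \<oplus>\<^bsub>N\<^esub> f y) \<and>
         (\<forall>r\<in>carrier R. \<forall>x\<in>carrier M. f (r \<odot>\<^bsub>M\<^esub> x) = r \<odot>\<^bsub>N\<^esub> f x)}"

text \<open>
  \<open>M\<close> is flat if \<open>_ \<otimes> M\<close> preserves injectivity.  A definition cannot quantify over
  modules on all types.  Here the modules \<open>N\<close>, \<open>N'\<close> are those whose elements are sets of sequences
  in \<open>R\<close>; up to isomorphism this includes every finitely generated \<open>R\<close>-module (as a quotient of
  \<open>R\<^sup>n\<close>, whose elements are cosets) and every ideal, and flatness is detected on those.
\<close>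

definition flat_module :: "('r, 'z) ring_scheme \<Rightarrow> ('r, 'm, 'x) module_scheme \<Rightarrow> bool" where
  "flat_module R M \<longleftrightarrow>
     module R M \<and>
     (\<forall>(N :: ('r, (nat \<Rightarrow> 'r) set) module) (N' :: ('r, (nat \<Rightarrow> 'r) set) module) f.
        module R N \<and> module R N' \<and> f \<in> module_homs R N N' \<and> inj_on f (carrier N) \<longrightarrow>
        inj_on (tensor_map R N' M f (\<lambda>m. m)) (carrier (tensor_product R N M)))"

section \<open>Monoid rings, Laurent polynomials, finite presentation\<close>

text \<open>
  The ring of finitely supported functions on a commutative monoid with convolution product.
  With index type \<open>int\<close> this is the ring of Laurent polynomials, with index type
  \<open>nat \<Rightarrow>\<^sub>0 nat\<close> (exponents) that of polynomials in variables indexed by \<open>nat\<close>.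
\<close>

definition monoid_ring :: "('a, 'x) ring_scheme \<Rightarrow> ('i::comm_monoid_add \<Rightarrow> 'a) ring" where
  "monoid_ring R =
     \<lparr>carrier = {p. (\<forall>i. p i \<in> carrier R) \<and> finite {i. p i \<noteq> \<zero>\<^bsub>R\<^esub>}},
      monoid.mult = (\<lambda>p q n.
        \<Oplus>\<^bsub>R\<^esub>x \<in> {(i, j). p i \<noteq> \<zero>\<^bsub>R\<^esub> \<and> q j \<noteq> \<zero>\<^bsub>R\<^esub> \<and> i + j = n}. p (fst x) \<otimes>\<^bsub>R\<^esub> q (snd x)),
      one = (\<lambda>i. if i = 0 then \<one>\<^bsub>R\<^esub> else \<zero>\<^bsub>R\<^esub>),
      ring.zero = (\<lambda>i. \<zero>\<^bsub>R\<^esub>),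
      ring.add = (\<lambda>p q i. p i \<oplus>\<^bsub>R\<^esub> q i)\<rparr>"

definition monomial :: "('a, 'x) ring_scheme \<Rightarrow> 'a \<Rightarrow> 'i \<Rightarrow> 'i \<Rightarrow> 'a" where
  "monomial R a n = (\<lambda>i. if i = n then a else \<zero>\<^bsub>R\<^esub>)"

definition mpoly_ring :: "('a, 'x) ring_scheme \<Rightarrow> nat \<Rightarrow> ((nat \<Rightarrow>\<^sub>0 nat) \<Rightarrow> 'a) ring" where
  "mpoly_ring R n = (monoid_ring R)
     \<lparr>carrier := {p \<in> carrier (monoid_ring R). \<forall>m. p m \<noteq> \<zero>\<^bsub>R\<^esub> \<longrightarrow> Poly_Mapping.keys m \<subseteq> {..<n}}\<rparr>"

definition finitely_presented_algebra ::
  "('r, 'z) ring_scheme \<Rightarrow> ('r, 'a, 'x) module_scheme \<Rightarrow> bool" where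
  "finitely_presented_algebra R A \<longleftrightarrow>
     (\<exists>n f F. f \<in> ring_hom (mpoly_ring R n) A \<and>
        (\<forall>c\<in>carrier R. f (monomial R c 0) = c \<odot>\<^bsub>A\<^esub> \<one>\<^bsub>A\<^esub>) \<and>
        f ` carrier (mpoly_ring R n) = carrier A \<and>
        finite F \<and> F \<subseteq> carrier (mpoly_ring R n) \<and>
        a_kernel (mpoly_ring R n) A f = Idl\<^bsub>mpoly_ring R n\<^esub> F)"

text \<open>\<open>A[s\<^sup>\<plusminus>\<^sup>1]\<close> as an algebra over \<open>k[s\<^sup>\<plusminus>\<^sup>1]\<close>, for a \<open>k\<close>-algebra \<open>A\<close>; here \<open>s = \<surd>t\<close>.\<close>

abbreviation laurent_ring :: "('r, 'z) ring_scheme \<Rightarrow> (int \<Rightarrow> 'r) ring" where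
  "laurent_ring k \<equiv> monoid_ring k"

definition laurent_algebra :: "('r, 'a, 'x) module_scheme \<Rightarrow> (int \<Rightarrow> 'r, int \<Rightarrow> 'a) module" where
  "laurent_algebra A =
     \<lparr>carrier = carrier (monoid_ring A),
      monoid.mult = monoid.mult (monoid_ring A), one = monoid.one (monoid_ring A),
      ring.zero = ring.zero (monoid_ring A), ring.add = ring.add (monoid_ring A),
      smult = (\<lambda>f p. (\<lambda>i. f i \<odot>\<^bsub>A\<^esub> \<one>\<^bsub>A\<^esub>) \<otimes>\<^bsub>monoid_ring A\<^esub> p)\<rparr>"

text \<open>The inclusion of \<open>k[t]\<close> into \<open>k[s\<^sup>\<plusminus>\<^sup>1]\<close> with \<open>t = s\<^sup>2\<close>.\<close>

definition poly_to_laurent :: "('r, 'z) ring_scheme \<Rightarrow> (nat \<Rightarrow> 'r) \<Rightarrow> (int \<Rightarrow> 'r)" where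
  "poly_to_laurent k p = (\<lambda>i. if 0 \<le> i \<and> even i then p (nat i div 2) else \<zero>\<^bsub>k\<^esub>)"

definition restrict_scalars :: "('r \<Rightarrow> 's) \<Rightarrow> ('s, 'a, 'x) module_scheme \<Rightarrow> ('r, 'a) module" where
  "restrict_scalars h B =
     \<lparr>carrier = carrier B, monoid.mult = monoid.mult B, one = monoid.one B,
      ring.zero = ring.zero B, ring.add = ring.add B,
      smult = (\<lambda>r. smult B (h r))\<rparr>"

inductive_set generated_subalgebra ::
  "('r, 'z) ring_scheme \<Rightarrow> ('r, 'a, 'x) module_scheme \<Rightarrow> 'a set \<Rightarrow> 'a set"
  for R B X where
  incl: "x \<in> X \<Longrightarrow> x \<in> generated_subalgebra R B X"
| one: "\<one>\<^bsub>B\<^esub> \<in> generated_subalgebra R B X"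
| add: "x \<in> generated_subalgebra R B X \<Longrightarrow> y \<in> generated_subalgebra R B X \<Longrightarrow>
    x \<oplus>\<^bsub>B\<^esub> y \<in> generated_subalgebra R B X"
| mult: "x \<in> generated_subalgebra R B X \<Longrightarrow> y \<in> generated_subalgebra R B X \<Longrightarrow>
    x \<otimes>\<^bsub>B\<^esub> y \<in> generated_subalgebra R B X"
| smult: "r \<in> carrier R \<Longrightarrow> x \<in> generated_subalgebra R B X \<Longrightarrow>
    r \<odot>\<^bsub>B\<^esub> x \<in> generated_subalgebra R B X"

section \<open>Commutative Hopf algebras with involution\<close>

locale hopf_algebra = algebra R A for R (structure) and A (structure) +
  fixes \<Delta> :: "'c \<Rightarrow> ('c, 'c) tensor" and \<epsilon> :: "'c \<Rightarrow> 'a" and S :: "'c \<Rightarrow> 'c"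
  assumes comult_hom: "\<Delta> \<in> ring_hom A (tensor_product R A A)"
    and comult_linear: "\<Delta> \<in> module_homs R A (tensor_product R A A)"
    and counit_hom: "\<epsilon> \<in> ring_hom A R"
    and counit_linear: "\<lbrakk>r \<in> carrier R; a \<in> carrier A\<rbrakk> \<Longrightarrow> \<epsilon> (r \<odot>\<^bsub>A\<^esub> a) = r \<otimes>\<^bsub>R\<^esub> \<epsilon> a"
    and antipode_linear: "S \<in> module_homs R A A"
    and coassoc: "a \<in> carrier A \<Longrightarrow>
      tensor_assoc R A A A (tensor_map R (tensor_product R A A) A \<Delta> (\<lambda>x. x) (\<Delta> a)) =
      tensor_map R A (tensor_product R A A) (\<lambda>x. x) \<Delta> (\<Delta> a)"
    and counit_left: "a \<in> carrier A \<Longrightarrow> tensor_lift A (\<lambda>x y. \<epsilon> x \<odot>\<^bsub>A\<^esub> y) (\<Delta> a) = a"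
    and counit_right: "a \<in> carrier A \<Longrightarrow> tensor_lift A (\<lambda>x y. \<epsilon> y \<odot>\<^bsub>A\<^esub> x) (\<Delta> a) = a"
    and antipode_left:
      "a \<in> carrier A \<Longrightarrow> tensor_lift A (\<lambda>x y. S x \<otimes>\<^bsub>A\<^esub> y) (\<Delta> a) = \<epsilon> a \<odot>\<^bsub>A\<^esub> \<one>\<^bsub>A\<^esub>"
    and antipode_right:
      "a \<in> carrier A \<Longrightarrow> tensor_lift A (\<lambda>x y. x \<otimes>\<^bsub>A\<^esub> S y) (\<Delta> a) = \<epsilon> a \<odot>\<^bsub>A\<^esub> \<one>\<^bsub>A\<^esub>"

locale hopf_involution = hopf_algebra +
  fixes \<theta> :: "'c \<Rightarrow> 'c"
  assumes involution_bij: "bij_betw \<theta> (carrier A) (carrier A)"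
    and involution_hom: "\<theta> \<in> ring_hom A A"
    and involution_linear: "\<theta> \<in> module_homs R A A"
    and involution_comult: "a \<in> carrier A \<Longrightarrow> \<Delta> (\<theta> a) = tensor_map R A A \<theta> \<theta> (\<Delta> a)"
    and involution_counit: "a \<in> carrier A \<Longrightarrow> \<epsilon> (\<theta> a) = \<epsilon> a"
    and involution_antipode: "a \<in> carrier A \<Longrightarrow> S (\<theta> a) = \<theta> (S a)"
    and involution_square: "a \<in> carrier A \<Longrightarrow> \<theta> (\<theta> a) = a"

text \<open>The eigenspaces of an involution, for algebras as well as for Lie algebras.\<close>

definition plus_part :: "('a, 'x) ring_scheme \<Rightarrow> ('a \<Rightarrow> 'a) \<Rightarrow> 'a set" where
  "plus_part A \<theta> = {a \<in> carrier A. \<theta> a = a}"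

definition minus_part :: "('a, 'x) ring_scheme \<Rightarrow> ('a \<Rightarrow> 'a) \<Rightarrow> 'a set" where
  "minus_part A \<theta> = {a \<in> carrier A. \<theta> a = \<ominus>\<^bsub>A\<^esub> a}"

section \<open>The contraction algebra\<close>

definition contraction_algebra ::
  "('r, 'z) ring_scheme \<Rightarrow> ('r, 'a, 'x) module_scheme \<Rightarrow> ('a \<Rightarrow> 'a) \<Rightarrow>
     (nat \<Rightarrow> 'r, int \<Rightarrow> 'a) module" where
  "contraction_algebra k A \<theta> =
     (let B = restrict_scalars (poly_to_laurent k) (laurent_algebra A) in
      B\<lparr>carrier := generated_subalgebra (UP k) B
          ((\<lambda>a. monomial A a 0) ` plus_part A \<theta> \<union> (\<lambda>a. monomial A a (- 1)) ` minus_part A \<theta>)\<rparr>)"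

text \<open>
  The comultiplication of \<open>A[s\<^sup>\<plusminus>\<^sup>1]\<close> over \<open>k[s\<^sup>\<plusminus>\<^sup>1]\<close> obtained from that of \<open>A\<close> by base change:
  \<open>\<Sum> a\<^sub>i s\<^sup>i \<mapsto> \<Sum> s\<^sup>i (j \<otimes> j) (\<Delta> a\<^sub>i)\<close>, where \<open>j\<close> is the inclusion of \<open>A\<close>.
\<close>

definition laurent_comult ::
  "('r, 'z) ring_scheme \<Rightarrow> ('r, 'a, 'x) module_scheme \<Rightarrow> ('a \<Rightarrow> ('a, 'a) tensor) \<Rightarrow>
     (int \<Rightarrow> 'a) \<Rightarrow> (int \<Rightarrow> 'a, int \<Rightarrow> 'a) tensor" where
  "laurent_comult k A \<Delta> u =
     (let L = laurent_algebra A; K = laurent_ring k; T = tensor_product K L L;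
          j = (\<lambda>a. monomial A a 0)
      in \<Oplus>\<^bsub>T\<^esub>i \<in> {i. u i \<noteq> \<zero>\<^bsub>A\<^esub>}. monomial k \<one>\<^bsub>k\<^esub> i \<odot>\<^bsub>T\<^esub> tensor_map K L L j j (\<Delta> (u i)))"

text \<open>
  The structure maps of the contraction algebra are restrictions: the following are the elements
  that the inclusions of the contraction algebra into \<open>A[s\<^sup>\<plusminus>\<^sup>1]\<close>, its tensor square over \<open>k[t]\<close>
  into that of \<open>A[s\<^sup>\<plusminus>\<^sup>1]\<close> over \<open>k[s\<^sup>\<plusminus>\<^sup>1]\<close>, and \<open>k[t]\<close> into \<open>k[s\<^sup>\<plusminus>\<^sup>1]\<close> send to the value of the
  structure map of \<open>A[s\<^sup>\<plusminus>\<^sup>1]\<close>.  For the comultiplication, such an element is unique if the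
  contraction algebra is flat, since the map of tensor squares is then injective.
\<close>

definition contraction_comult ::
  "('r, 'z) ring_scheme \<Rightarrow> ('r, 'a, 'x) module_scheme \<Rightarrow> ('a \<Rightarrow> ('a, 'a) tensor) \<Rightarrow> ('a \<Rightarrow> 'a) \<Rightarrow>
     (int \<Rightarrow> 'a) \<Rightarrow> (int \<Rightarrow> 'a, int \<Rightarrow> 'a) tensor" where
  "contraction_comult k A \<Delta> \<theta> u =
     (let C = contraction_algebra k A \<theta>; L = laurent_algebra A
      in SOME X. X \<in> carrier (tensor_product (UP k) C C) \<and>
           tensor_map (laurent_ring k) L L (\<lambda>x. x) (\<lambda>x. x) X = laurent_comult k A \<Delta> u)"

definition contraction_counit ::
  "('r, 'z) ring_scheme \<Rightarrow> ('a \<Rightarrow> 'r) \<Rightarrow> (int \<Rightarrow> 'a) \<Rightarrow> (nat \<Rightarrow> 'r)" where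
  "contraction_counit k \<epsilon> u =
     (THE p. p \<in> carrier (UP k) \<and> poly_to_laurent k p = (\<lambda>i. \<epsilon> (u i)))"

section \<open>Lie algebras\<close>

text \<open>The inherited fields \<open>mult\<close> and \<open>one\<close> carry no information.\<close>

record ('r, 'm) lie_algebra = "('r, 'm) module" +
  bracket :: "'m \<Rightarrow> 'm \<Rightarrow> 'm"

definition lie_algebra_iso ::
  "('r, 'z) ring_scheme \<Rightarrow> ('r, 'm) lie_algebra \<Rightarrow> ('r, 'n) lie_algebra \<Rightarrow> ('m \<Rightarrow> 'n) set" where
  "lie_algebra_iso R L L' =
     {f \<in> module_homs R L L'. bij_betw f (carrier L) (carrier L') \<and>
        (\<forall>x\<in>carrier L. \<forall>y\<in>carrier L.
           bracket L x y \<in> carrier L \<and> f (bracket L x y) = bracket L' (f x) (f y))}"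

definition lie_algebra_isomorphic ::
  "('r, 'z) ring_scheme \<Rightarrow> ('r, 'm) lie_algebra \<Rightarrow> ('r, 'n) lie_algebra \<Rightarrow> bool" where
  "lie_algebra_isomorphic R L L' \<longleftrightarrow> lie_algebra_iso R L L' \<noteq> {}"

definition counit_derivations ::
  "('r, 'z) ring_scheme \<Rightarrow> ('r, 'a, 'x) module_scheme \<Rightarrow> ('a \<Rightarrow> 'r) \<Rightarrow> ('a \<Rightarrow> 'r) set" where
  "counit_derivations R A \<epsilon> =
     {D \<in> carrier A \<rightarrow>\<^sub>E carrier R.
        (\<forall>a\<in>carrier A. \<forall>b\<in>carrier A. D (a \<oplus>\<^bsub>A\<^esub> b) = D a \<oplus>\<^bsub>R\<^esub> D b) \<and>
        (\<forall>r\<in>carrier R. \<forall>a\<in>carrier A. D (r \<odot>\<^bsub>A\<^esub> a) = r \<otimes>\<^bsub>R\<^esub> D a) \<and>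
        (\<forall>a\<in>carrier A. \<forall>b\<in>carrier A.
           D (a \<otimes>\<^bsub>A\<^esub> b) = \<epsilon> a \<otimes>\<^bsub>R\<^esub> D b \<oplus>\<^bsub>R\<^esub> D a \<otimes>\<^bsub>R\<^esub> \<epsilon> b)}"

text \<open>
  The Lie algebra of the affine group scheme with Hopf algebra \<open>A\<close> over \<open>R\<close>: derivations
  with respect to the counit, with the bracket \<open>[D, E] = (D \<otimes> E - E \<otimes> D) \<circ> \<Delta>\<close>.
\<close>

definition lie_algebra_of ::
  "('r, 'z) ring_scheme \<Rightarrow> ('r, 'a, 'x) module_scheme \<Rightarrow> ('a \<Rightarrow> ('a, 'a) tensor) \<Rightarrow> ('a \<Rightarrow> 'r) \<Rightarrow>
     ('r, 'a \<Rightarrow> 'r) lie_algebra" where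
  "lie_algebra_of R A \<Delta> \<epsilon> =
     \<lparr>carrier = counit_derivations R A \<epsilon>, monoid.mult = undefined, one = undefined,
      ring.zero = (\<lambda>a\<in>carrier A. \<zero>\<^bsub>R\<^esub>),
      ring.add = (\<lambda>D E. \<lambda>a\<in>carrier A. D a \<oplus>\<^bsub>R\<^esub> E a),
      smult = (\<lambda>r D. \<lambda>a\<in>carrier A. r \<otimes>\<^bsub>R\<^esub> D a),
      bracket = (\<lambda>D E. \<lambda>a\<in>carrier A.
        tensor_lift R (\<lambda>x y. D x \<otimes>\<^bsub>R\<^esub> E y) (\<Delta> a) \<ominus>\<^bsub>R\<^esub> tensor_lift R (\<lambda>x y. E x \<otimes>\<^bsub>R\<^esub> D y) (\<Delta> a))\<rparr>"

definition lie_involution ::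
  "('r, 'a, 'x) module_scheme \<Rightarrow> ('a \<Rightarrow> 'a) \<Rightarrow> ('a \<Rightarrow> 'r) \<Rightarrow> ('a \<Rightarrow> 'r)" where
  "lie_involution A \<theta> D = (\<lambda>a\<in>carrier A. D (\<theta> a))"

text \<open>
  The contraction of a Lie algebra \<open>g\<close> over \<open>k\<close> with involution \<open>\<sigma>\<close>: the bracket on
  \<open>g \<otimes> k[t]\<close> is determined by its values on elements \<open>x \<otimes> 1\<close>.  It exists and is unique on
  \<open>g \<otimes> k[t]\<close>, because \<open>2\<close> is invertible and thus \<open>g\<close> is the sum of the two eigenspaces.
\<close>

definition contraction_bracket ::
  "('r, 'z) ring_scheme \<Rightarrow> ('r, 'm) lie_algebra \<Rightarrow> ('m \<Rightarrow> 'm) \<Rightarrow>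
     (('m, nat \<Rightarrow> 'r) tensor \<Rightarrow> ('m, nat \<Rightarrow> 'r) tensor \<Rightarrow> ('m, nat \<Rightarrow> 'r) tensor) \<Rightarrow> bool" where
  "contraction_bracket k g \<sigma> br \<longleftrightarrow>
     (let G = base_change k g (UP k); T = (\<lambda>x. pure_tensor k g (UP k) x \<one>\<^bsub>UP k\<^esub>);
          t = monom (UP k) \<one>\<^bsub>k\<^esub> 1
      in (\<forall>X\<in>carrier G. br X \<in> module_homs (UP k) G G) \<and>
         (\<forall>Y\<in>carrier G. (\<lambda>X. br X Y) \<in> module_homs (UP k) G G) \<and>
         (\<forall>X\<in>carrier G. \<forall>Y\<in>carrier G. br X Y = \<ominus>\<^bsub>G\<^esub> br Y X) \<and>
         (\<forall>x\<in>plus_part g \<sigma>. \<forall>y\<in>carrier g. br (T x) (T y) = T (bracket g x y)) \<and>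
         (\<forall>x\<in>minus_part g \<sigma>. \<forall>y\<in>minus_part g \<sigma>. br (T x) (T y) = t \<odot>\<^bsub>G\<^esub> T (bracket g x y)))"

definition contraction_lie_algebra ::
  "('r, 'z) ring_scheme \<Rightarrow> ('r, 'm) lie_algebra \<Rightarrow> ('m \<Rightarrow> 'm) \<Rightarrow>
     (nat \<Rightarrow> 'r, ('m, nat \<Rightarrow> 'r) tensor) lie_algebra" where
  "contraction_lie_algebra k g \<sigma> =
     module.extend (base_change k g (UP k))
       (lie_algebra.fields (SOME br. contraction_bracket k g \<sigma> br))"

end

theory Submission
  imports Defs
begin

text \<open>
  Write \<open>s = \<surd>t\<close>.  A derivation \<open>x\<close> in \<open>\<kk>\<close> kills the odd part of \<open>A\<close>, one in \<open>\<pp>\<close> the even part.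
  Extended linearly to \<open>A[s\<^sup>\<plusminus>\<^sup>1]\<close>, and multiplied by \<open>s\<close> in the second case, it restricts to a
  derivation of the contraction algebra with values in \<open>k[t]\<close>: coefficients in degrees below
  \<open>-1\<close> are products of two elements of the augmentation ideal, which \<open>x\<close> kills.  This gives a
  \<open>k[t]\<close>-linear map from \<open>\<gg> \<otimes> k[t]\<close> to the derivations.  Its inverse reads off the coefficients
  of the values on \<open>A\<^sup>\<theta>\<close> and \<open>s\<^sup>-\<^sup>1 A\<^sup>-\<^sup>\<theta>\<close>; only finitely many are nonzero because \<open>A\<close> is finitely
  generated.  Since \<open>s \<sqdot> s = t\<close>, the bracket of two elements of \<open>\<pp>\<close> acquires a factor \<open>t\<close>.
\<close>

section \<open>Tensor products\<close>

text \<open>Two objects of the statement are given by choice: the comultiplication of the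
  contraction algebra and the bracket on \<open>\<g> \<otimes> k[t]\<close>. For the first, a value
  exists because \<open>\<Delta>\<close> commutes with \<open>\<theta>\<close>: splitting
  \<open>A \<otimes> A\<close> under \<open>\<theta> \<otimes> \<theta>\<close> shows that
  \<open>s^i \<Delta> a\<close> comes from the tensor square of the contraction algebra whenever
  \<open>graded i a\<close>. For the second, no formula on \<open>\<g> \<otimes> k[t]\<close> is
  written down. The bracket of derivations is pulled back along the isomorphism, checked against the
  defining clauses, and identified with the chosen bracket because those clauses determine it on
  generators. The derivations of the contraction algebra must also be closed under the bracket. The
  Hopf axioms are not transferred to the contraction algebra, so the usual argument is not at hand
  there. Instead every derivation is a \<open>k[t]\<close>-combination of extended ones, whose
  brackets are known explicitly.\<close>

definition lift_sum :: "('p, 'x) ring_scheme \<Rightarrow> ('m \<Rightarrow> 'n \<Rightarrow> 'p) \<Rightarrow> ('m \<times> 'n \<Rightarrow>\<^sub>0 int) \<Rightarrow> 'p" where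
  "lift_sum P f c =
     (\<Oplus>\<^bsub>P\<^esub>q \<in> Poly_Mapping.keys c. [Poly_Mapping.lookup c q] \<cdot>\<^bsub>P\<^esub> f (fst q) (snd q))"

lemma tensor_lift_eq_lift_sum: "tensor_lift P f X = lift_sum P f (tensor_rep X)"
  by (simp add: tensor_lift_def lift_sum_def Let_def)

section \<open>Evaluating formal sums in an abelian group\<close>

context abelian_group
begin

text \<open>The shape that the two additivity relations of the tensor product take after
  evaluation.\<close>

lemma add_minus_minus:
  assumes "a \<in> carrier G" "b \<in> carrier G"
  shows "a \<oplus> b \<ominus> a \<ominus> b = \<zero>"
proof -
  have "a \<oplus> b \<ominus> a = b"
    using assms by (simp add: a_minus_def add.m_comm[of a b] add.m_assoc r_neg)
  then show ?thesis using assms by (simp add: a_minus_def r_neg)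
qed

text \<open>Cancellation can make the keys of a sum smaller than the union of the keys of its terms.
  Over a common index set the sums become comparable, and the surplus terms carry multiplicity
  0.\<close>

lemma lift_sum_superset:
  assumes "finite B" "Poly_Mapping.keys c \<subseteq> B" "\<And>q. q \<in> B \<Longrightarrow> f (fst q) (snd q) \<in> carrier G"
  shows "lift_sum G f c = (\<Oplus>q \<in> B. [Poly_Mapping.lookup c q] \<cdot> f (fst q) (snd q))"
proof -
  have "add_pow G (0::int) x = \<zero>" for x
    by (simp add: add_pow_def)
  then show ?thesis
    unfolding lift_sum_def using assms
    by (intro add.finprod_mono_neutral_cong_left) (auto simp: in_keys_iff add.int_pow_closed)
qed

lemma lift_sum_closed:
  assumes "\<And>q. q \<in> Poly_Mapping.keys c \<Longrightarrow> f (fst q) (snd q) \<in> carrier G"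
  shows "lift_sum G f c \<in> carrier G"
  unfolding lift_sum_def using assms by (intro finsum_closed) auto

lemma lift_sum_add:
  assumes "\<And>q. q \<in> Poly_Mapping.keys c \<union> Poly_Mapping.keys d \<Longrightarrow> f (fst q) (snd q) \<in> carrier G"
  shows "lift_sum G f (c + d) = lift_sum G f c \<oplus> lift_sum G f d"
proof -
  let ?B = "Poly_Mapping.keys c \<union> Poly_Mapping.keys d"
  have sub: "Poly_Mapping.keys (c + d) \<subseteq> ?B"
    by (rule Poly_Mapping.keys_add)
  have "lift_sum G f (c + d) =
    (\<Oplus>q \<in> ?B. [Poly_Mapping.lookup c q] \<cdot> f (fst q) (snd q) \<oplus> [Poly_Mapping.lookup d q] \<cdot> f (fst q) (snd q))"
    using assms lift_sum_superset[OF _ sub, of f]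
    by (simp del: add.finprod_multf)
      (rule finsum_cong', auto simp: lookup_add add.int_pow_mult add.int_pow_closed)
  also have "\<dots> = lift_sum G f c \<oplus> lift_sum G f d"
  proof -
    have "lift_sum G f c = (\<Oplus>q \<in> ?B. [Poly_Mapping.lookup c q] \<cdot> f (fst q) (snd q))"
      "lift_sum G f d = (\<Oplus>q \<in> ?B. [Poly_Mapping.lookup d q] \<cdot> f (fst q) (snd q))"
      using assms by (intro lift_sum_superset; simp)+
    then show ?thesis
      using assms by (simp only:) (intro finsum_addf; simp add: Pi_def del: split_paired_All)
  qed
  finally show ?thesis .
qed

lemma lift_sum_0 [simp]: "lift_sum G f 0 = \<zero>"
  by (simp add: lift_sum_def)

lemma lift_sum_frag_of [simp]: "f (fst q) (snd q) \<in> carrier G \<Longrightarrow> lift_sum G f (frag_of q) = f (fst q) (snd q)"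
  by (simp add: lift_sum_def)

lemma lift_sum_diff:
  assumes "\<And>q. q \<in> Poly_Mapping.keys c \<union> Poly_Mapping.keys d \<Longrightarrow> f (fst q) (snd q) \<in> carrier G"
  shows "lift_sum G f (c - d) = lift_sum G f c \<ominus> lift_sum G f d"
proof -
  have k: "Poly_Mapping.keys (c - d) \<subseteq> Poly_Mapping.keys c \<union> Poly_Mapping.keys d"
    by (rule keys_diff)
  have cl: "lift_sum G f (c - d) \<in> carrier G" "lift_sum G f d \<in> carrier G"
    using assms k by (auto intro!: lift_sum_closed)
  have "lift_sum G f (c - d) \<oplus> lift_sum G f d = lift_sum G f (c - d + d)"
    using assms k by (intro lift_sum_add[symmetric]) auto
  moreover have "lift_sum G f c \<in> carrier G" using assms by (auto intro!: lift_sum_closed)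
  ultimately show ?thesis using cl
    by (simp add: a_minus_def add.inv_solve_right)
qed

end

lemma keys_addI: "Poly_Mapping.keys c \<subseteq> S \<Longrightarrow> Poly_Mapping.keys d \<subseteq> S \<Longrightarrow> Poly_Mapping.keys (c + d) \<subseteq> S"
  using Poly_Mapping.keys_add[of c d] by blast

lemma keys_diffI: "Poly_Mapping.keys c \<subseteq> S \<Longrightarrow> Poly_Mapping.keys d \<subseteq> S \<Longrightarrow> Poly_Mapping.keys (c - d) \<subseteq> S"
  using keys_diff[of c d] by blast

lemma abelian_group_comm_group:
  assumes "comm_group H" "carrier G = carrier H" "\<And>x y. add G x y = mult H x y" "zero G = one H"
  shows "abelian_group G"
proof -
  interpret H: comm_group H by fact
  show ?thesis
    by (rule abelian_groupI) (auto simp: assms(2-4) H.m_assoc H.m_comm H.m_lcomm intro: H.l_inv_ex)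
qed

text \<open>The target is only an additive group, without an action of \<open>R\<close>. This lets
  the same lift serve targets over another base ring, such as the tensor square of the Laurent
  algebra.\<close>

definition balanced_map ::
  "('r, 'z) ring_scheme \<Rightarrow> ('r, 'm, 'x) module_scheme \<Rightarrow> ('r, 'n, 'y) module_scheme \<Rightarrow>
     ('p, 'w) ring_scheme \<Rightarrow> ('m \<Rightarrow> 'n \<Rightarrow> 'p) \<Rightarrow> bool" where
  "balanced_map R M N P f \<longleftrightarrow>
     (\<forall>m\<in>carrier M. \<forall>n\<in>carrier N. f m n \<in> carrier P) \<and>
     (\<forall>m\<in>carrier M. \<forall>m'\<in>carrier M. \<forall>n\<in>carrier N. f (m \<oplus>\<^bsub>M\<^esub> m') n = f m n \<oplus>\<^bsub>P\<^esub> f m' n) \<and>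
     (\<forall>m\<in>carrier M. \<forall>n\<in>carrier N. \<forall>n'\<in>carrier N. f m (n \<oplus>\<^bsub>N\<^esub> n') = f m n \<oplus>\<^bsub>P\<^esub> f m n') \<and>
     (\<forall>r\<in>carrier R. \<forall>m\<in>carrier M. \<forall>n\<in>carrier N. f (r \<odot>\<^bsub>M\<^esub> m) n = f m (r \<odot>\<^bsub>N\<^esub> n))"

section \<open>The tensor product as a module, and additive maps out of it\<close>

locale tensor_pair = M: module R M + N: module R N
  for R (structure) and M and N
begin

abbreviation T where "T \<equiv> tensor_product R M N"
abbreviation "FG \<equiv> tensor_free M N"
abbreviation "Nul \<equiv> tensor_null R M N"

lemma FG_comm_group: "comm_group FG"
  by (simp add: tensor_free_def abelian_free_Abelian_group)

lemma FG_group: "group FG"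
  by (simp add: tensor_free_def)

lemma FG_simps [simp]:
  "c \<in> carrier FG \<longleftrightarrow> Poly_Mapping.keys c \<subseteq> carrier M \<times> carrier N"
  "x \<otimes>\<^bsub>FG\<^esub> y = x + y" "\<one>\<^bsub>FG\<^esub> = 0"
  by (simp_all add: tensor_free_def)

lemma relations_subset: "tensor_relations R M N \<subseteq> carrier FG"
proof
  fix x assume "x \<in> tensor_relations R M N"
  then have "Poly_Mapping.keys x \<subseteq> carrier M \<times> carrier N"
    unfolding tensor_relations_def
    by (elim UnE CollectE exE conjE) (simp_all add: keys_diffI)
  then show "x \<in> carrier FG" by simp
qed

lemma Nul_subgroup: "subgroup Nul FG"
  unfolding tensor_null_def
  by (rule group.generate_is_subgroup[OF FG_group relations_subset])

lemma Nul_normal: "Nul \<lhd> FG"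
  by (rule comm_group.subgroup_imp_normal[OF FG_comm_group Nul_subgroup])

lemma T_abelian_group: "abelian_group T"
  by (rule abelian_group_comm_group
      [OF comm_group.abelian_FactGroup[OF FG_comm_group Nul_subgroup]])
    (simp_all add: tensor_product_def)

sublocale T: abelian_group T by (rule T_abelian_group)

lemma carrier_T: "carrier T = (\<lambda>c. tensor_class R M N c) ` carrier FG"
  by (auto simp: tensor_product_def FactGroup_def RCOSETS_def tensor_class_def)

lemma tensor_class_closed: "c \<in> carrier FG \<Longrightarrow> tensor_class R M N c \<in> carrier T"
  by (simp only: carrier_T imageI)

lemma tensor_class_add:
  assumes "c \<in> carrier FG" "d \<in> carrier FG"
  shows "tensor_class R M N (c + d) = tensor_class R M N c \<oplus>\<^bsub>T\<^esub> tensor_class R M N d"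
  using normal.rcos_sum[OF Nul_normal assms]
  by (simp add: tensor_product_def tensor_class_def FactGroup_def)

lemma tensor_class_0: "tensor_class R M N 0 = \<zero>\<^bsub>T\<^esub>"
proof -
  have "tensor_class R M N 0 \<in> carrier T" by (intro tensor_class_closed) simp
  then show ?thesis using tensor_class_add[of 0 0] by (simp add: T.add.l_cancel_one')
qed

lemma tensor_class_eq:
  assumes "c \<in> carrier FG" "d \<in> carrier FG" "c - d \<in> Nul"
  shows "tensor_class R M N c = tensor_class R M N d"
proof -
  have "c \<in> Nul #>\<^bsub>FG\<^esub> d"
    using assms(3) by (auto simp: r_coset_def intro!: bexI[of _ "c - d"])
  then show ?thesis unfolding tensor_class_def
    using assms group.repr_independence[OF FG_group _ _ Nul_subgroup, of c d] by simp
qed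

lemma tensor_rep_class:
  assumes "c \<in> carrier FG"
  shows "tensor_rep (tensor_class R M N c) - c \<in> Nul"
proof -
  have "c \<in> tensor_class R M N c" unfolding tensor_class_def
    by (rule group.rcos_self[OF FG_group assms Nul_subgroup])
  then have "tensor_rep (tensor_class R M N c) \<in> tensor_class R M N c"
    unfolding tensor_rep_def by (rule someI)
  then show ?thesis by (auto simp: tensor_class_def r_coset_def)
qed

lemma tensor_rep_closed: "X \<in> carrier T \<Longrightarrow> tensor_rep X \<in> carrier FG"
proof -
  assume "X \<in> carrier T"
  then obtain c where c: "c \<in> carrier FG" "X = tensor_class R M N c" by (auto simp: carrier_T)
  have "tensor_rep X - c \<in> carrier FG"
    using tensor_rep_class[OF c(1)] subgroup.subset[OF Nul_subgroup] c(2) by blast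
  then have "Poly_Mapping.keys (tensor_rep X - c + c) \<subseteq> carrier M \<times> carrier N"
    using c(1) by (intro keys_addI) simp_all
  then show ?thesis by simp
qed

lemma pure_closed [simp]:
  assumes "m \<in> carrier M" "n \<in> carrier N" shows "pure_tensor R M N m n \<in> carrier T"
  unfolding pure_tensor_def using assms by (intro tensor_class_closed) simp

lemma relation_null: "x \<in> tensor_relations R M N \<Longrightarrow> x \<in> Nul"
  unfolding tensor_null_def by (rule generate.incl)

lemma pure_add_left:
  assumes "m \<in> carrier M" "m' \<in> carrier M" "n \<in> carrier N"
  shows "pure_tensor R M N (m \<oplus>\<^bsub>M\<^esub> m') n = pure_tensor R M N m n \<oplus>\<^bsub>T\<^esub> pure_tensor R M N m' n"
proof -
  have "frag_of (m \<oplus>\<^bsub>M\<^esub> m', n) - (frag_of (m, n) + frag_of (m', n)) \<in> Nul"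
    using assms by (intro relation_null) (auto simp: tensor_relations_def algebra_simps)
  then show ?thesis unfolding pure_tensor_def using assms
    by (subst tensor_class_add[symmetric]) (simp_all add: tensor_class_eq keys_addI)
qed

lemma pure_add_right:
  assumes "m \<in> carrier M" "n \<in> carrier N" "n' \<in> carrier N"
  shows "pure_tensor R M N m (n \<oplus>\<^bsub>N\<^esub> n') = pure_tensor R M N m n \<oplus>\<^bsub>T\<^esub> pure_tensor R M N m n'"
proof -
  have "frag_of (m, n \<oplus>\<^bsub>N\<^esub> n') - (frag_of (m, n) + frag_of (m, n')) \<in> Nul"
    using assms by (intro relation_null) (auto simp: tensor_relations_def algebra_simps)
  then show ?thesis unfolding pure_tensor_def using assms
    by (subst tensor_class_add[symmetric]) (simp_all add: tensor_class_eq keys_addI)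
qed

lemma pure_balanced:
  assumes "r \<in> carrier R" "m \<in> carrier M" "n \<in> carrier N"
  shows "pure_tensor R M N (r \<odot>\<^bsub>M\<^esub> m) n = pure_tensor R M N m (r \<odot>\<^bsub>N\<^esub> n)"
  unfolding pure_tensor_def using assms
  by (intro tensor_class_eq relation_null) (auto simp: tensor_relations_def)

lemma pure_zero_left: "n \<in> carrier N \<Longrightarrow> pure_tensor R M N \<zero>\<^bsub>M\<^esub> n = \<zero>\<^bsub>T\<^esub>"
  using pure_add_left[of "\<zero>\<^bsub>M\<^esub>" "\<zero>\<^bsub>M\<^esub>" n] by (simp add: T.add.l_cancel_one')

lemma pure_minus_left:
  assumes "m \<in> carrier M" "n \<in> carrier N"
  shows "pure_tensor R M N (\<ominus>\<^bsub>M\<^esub> m) n = \<ominus>\<^bsub>T\<^esub> pure_tensor R M N m n"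
  using assms pure_add_left[of "\<ominus>\<^bsub>M\<^esub> m" m n]
  by (intro T.minus_equality[symmetric]) (auto simp: M.l_neg pure_zero_left)

text \<open>The negative of a pure tensor is pure, so integer combinations of pure tensors are sums
  of pure tensors and no case for negatives is needed.\<close>

lemma tensor_induct [consumes 1, case_names pure add]:
  assumes X: "X \<in> carrier T"
    and pure: "\<And>m n. m \<in> carrier M \<Longrightarrow> n \<in> carrier N \<Longrightarrow> Q (pure_tensor R M N m n)"
    and add: "\<And>X Y. X \<in> carrier T \<Longrightarrow> Y \<in> carrier T \<Longrightarrow> Q X \<Longrightarrow> Q Y \<Longrightarrow> Q (X \<oplus>\<^bsub>T\<^esub> Y)"
  shows "Q X"
proof -
  let ?cl = "tensor_class R M N"
  obtain c where c: "c \<in> carrier FG" "X = ?cl c" using X by (auto simp: carrier_T)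
  have neg: "?cl (- frag_of x) = pure_tensor R M N (\<ominus>\<^bsub>M\<^esub> fst x) (snd x)"
    if "x \<in> carrier M \<times> carrier N" for x
  proof -
    have "?cl (- frag_of x) \<oplus>\<^bsub>T\<^esub> ?cl (frag_of x) = ?cl 0"
      using that by (subst tensor_class_add[symmetric]) auto
    moreover have "?cl 0 = \<zero>\<^bsub>T\<^esub>"
      by (rule tensor_class_0)
    ultimately have "?cl (- frag_of x) = \<ominus>\<^bsub>T\<^esub> ?cl (frag_of x)"
      using that by (intro T.minus_equality[symmetric]) (auto intro!: tensor_class_closed)
    then show ?thesis using that pure_minus_left[of "fst x" "snd x"]
      by (simp add: pure_tensor_def mem_Times_iff)
  qed
  have "Poly_Mapping.keys c \<subseteq> carrier M \<times> carrier N" using c by simp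
  \<comment> \<open>\<open>frag_induction\<close> builds formal sums by differences, so the claim
    for \<open>- c\<close> has to be carried along.\<close>
  then have "Poly_Mapping.keys c \<subseteq> carrier M \<times> carrier N \<and> Q (?cl c) \<and> Q (?cl (- c))"
  proof (induction c rule: frag_induction)
    case zero
    have "?cl 0 = \<zero>\<^bsub>T\<^esub>"
      by (rule tensor_class_0)
    then show ?case using pure[of "\<zero>\<^bsub>M\<^esub>" "\<zero>\<^bsub>N\<^esub>"] by (simp add: pure_zero_left)
  next
    case (one x)
    then show ?case using neg[OF one] pure[of "fst x" "snd x"] pure[of "\<ominus>\<^bsub>M\<^esub> fst x" "snd x"]
      by (simp add: pure_tensor_def mem_Times_iff)
  next
    case (diff a b)
    then show ?case
      using add[of "?cl a" "?cl (- b)"] add[of "?cl b" "?cl (- a)"]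
        tensor_class_add[of a "- b"] tensor_class_add[of b "- a"]
      by (simp add: tensor_class_closed keys_diffI)
  qed
  then show ?thesis using c by simp
qed

text \<open>Balancedness makes the evaluation vanish on each relation, and additivity extends this
  to the subgroup that they generate.\<close>

lemma lift_sum_null:
  assumes P: "abelian_group P" and f: "balanced_map R M N P f" and x: "x \<in> Nul"
  shows "lift_sum P f x = \<zero>\<^bsub>P\<^esub>"
proof -
  interpret P: abelian_group P by fact
  have fc: "f m n \<in> carrier P" if "m \<in> carrier M" "n \<in> carrier N" for m n
    using f that by (simp add: balanced_map_def)
  have fc': "f (fst q) (snd q) \<in> carrier P" if "q \<in> carrier M \<times> carrier N" for q
    using fc that by auto
  have rel: "lift_sum P f h = \<zero>\<^bsub>P\<^esub> \<and> Poly_Mapping.keys h \<subseteq> carrier M \<times> carrier N"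
    if h: "h \<in> tensor_relations R M N" for h
  proof
    show k: "Poly_Mapping.keys h \<subseteq> carrier M \<times> carrier N" using subsetD[OF relations_subset h] by simp
    have d: "lift_sum P f (a - b) = lift_sum P f a \<ominus>\<^bsub>P\<^esub> lift_sum P f b"
      if "Poly_Mapping.keys a \<subseteq> carrier M \<times> carrier N" "Poly_Mapping.keys b \<subseteq> carrier M \<times> carrier N" for a b
      using that by (intro P.lift_sum_diff) (auto intro!: fc)
    consider (1) m m' n where "m \<in> carrier M" "m' \<in> carrier M" "n \<in> carrier N"
        "h = frag_of (m \<oplus>\<^bsub>M\<^esub> m', n) - frag_of (m, n) - frag_of (m', n)"
      | (2) m n n' where "m \<in> carrier M" "n \<in> carrier N" "n' \<in> carrier N"
        "h = frag_of (m, n \<oplus>\<^bsub>N\<^esub> n') - frag_of (m, n) - frag_of (m, n')"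
      | (3) r m n where "r \<in> carrier R" "m \<in> carrier M" "n \<in> carrier N"
        "h = frag_of (r \<odot>\<^bsub>M\<^esub> m, n) - frag_of (m, r \<odot>\<^bsub>N\<^esub> n)"
      using h unfolding tensor_relations_def by (elim UnE CollectE exE conjE) metis+
    then show "lift_sum P f h = \<zero>\<^bsub>P\<^esub>"
    proof cases
      case 1
      have "f (m \<oplus>\<^bsub>M\<^esub> m') n = f m n \<oplus>\<^bsub>P\<^esub> f m' n" using f 1(1-3) unfolding balanced_map_def by blast
      then show ?thesis using 1(1-3) fc unfolding 1(4)
        by (simp add: d keys_diffI P.add_minus_minus)
    next
      case 2
      have "f m (n \<oplus>\<^bsub>N\<^esub> n') = f m n \<oplus>\<^bsub>P\<^esub> f m n'" using f 2(1-3) unfolding balanced_map_def by blast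
      then show ?thesis using 2(1-3) fc unfolding 2(4)
        by (simp add: d keys_diffI P.add_minus_minus)
    next
      case 3
      have "f (r \<odot>\<^bsub>M\<^esub> m) n = f m (r \<odot>\<^bsub>N\<^esub> n)" using f 3(1-3) unfolding balanced_map_def by blast
      then show ?thesis using 3(1-3) fc unfolding 3(4)
        by (simp add: d a_minus_def P.r_neg)
    qed
  qed
  \<comment> \<open>The bound on the keys belongs to the induction: \<open>lift_sum\<close> is
    additive only where \<open>f\<close> takes values in the carrier of \<open>P\<close>.\<close>
  have "lift_sum P f x = \<zero>\<^bsub>P\<^esub> \<and> Poly_Mapping.keys x \<subseteq> carrier M \<times> carrier N"
    using x unfolding tensor_null_def
  proof (induction rule: generate.induct)
    case one
    then show ?case by simp
  next
    case (incl h)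
    then show ?case by (rule rel)
  next
    case (inv h)
    have "lift_sum P f (0 - h) = lift_sum P f 0 \<ominus>\<^bsub>P\<^esub> lift_sum P f h"
      using rel[OF inv] by (intro P.lift_sum_diff) (auto intro!: fc)
    then show ?case using rel[OF inv] by (simp add: tensor_free_def a_minus_def)
  next
    case (eng h1 h2)
    then have "lift_sum P f (h1 + h2) = lift_sum P f h1 \<oplus>\<^bsub>P\<^esub> lift_sum P f h2"
      by (intro P.lift_sum_add) (auto intro!: fc)
    then show ?case using eng by (simp add: keys_addI)
  qed
  then show ?thesis ..
qed

context
  fixes P f
  assumes P: "abelian_group P" and f: "balanced_map R M N P f"
begin

interpretation P: abelian_group P by (rule P)

lemma balanced_closed: "m \<in> carrier M \<Longrightarrow> n \<in> carrier N \<Longrightarrow> f m n \<in> carrier P"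
  using f by (simp add: balanced_map_def)

text \<open>The representative picked by \<open>tensor_rep\<close> differs from \<open>c\<close> by
  a null element, on which \<open>lift_sum\<close> vanishes.\<close>

lemma tensor_lift_class:
  assumes c: "c \<in> carrier FG"
  shows "tensor_lift P f (tensor_class R M N c) = lift_sum P f c"
proof -
  let ?d = "tensor_rep (tensor_class R M N c)"
  have k: "Poly_Mapping.keys ?d \<subseteq> carrier M \<times> carrier N" "Poly_Mapping.keys c \<subseteq> carrier M \<times> carrier N"
    using tensor_rep_closed[OF tensor_class_closed[OF c]] c by simp_all
  have "lift_sum P f (?d - c) = lift_sum P f ?d \<ominus>\<^bsub>P\<^esub> lift_sum P f c"
    using k by (intro P.lift_sum_diff) (auto intro!: balanced_closed)
  moreover have "lift_sum P f (?d - c) = \<zero>\<^bsub>P\<^esub>"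
    by (rule lift_sum_null[OF P f tensor_rep_class[OF c]])
  moreover have "lift_sum P f ?d \<in> carrier P" "lift_sum P f c \<in> carrier P"
    using k by (auto intro!: P.lift_sum_closed balanced_closed)
  ultimately show ?thesis unfolding tensor_lift_eq_lift_sum
    by (metis P.minus_equality P.minus_minus a_minus_def P.a_inv_closed)
qed

lemma lift_pure:
  assumes "m \<in> carrier M" "n \<in> carrier N"
  shows "tensor_lift P f (pure_tensor R M N m n) = f m n"
  using assms unfolding pure_tensor_def by (subst tensor_lift_class) (simp_all add: balanced_closed)

lemma lift_closed: "X \<in> carrier T \<Longrightarrow> tensor_lift P f X \<in> carrier P"
  unfolding tensor_lift_eq_lift_sum using tensor_rep_closed[of X]
  by (auto intro!: P.lift_sum_closed balanced_closed)

lemma lift_add: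
  assumes "X \<in> carrier T" "Y \<in> carrier T"
  shows "tensor_lift P f (X \<oplus>\<^bsub>T\<^esub> Y) = tensor_lift P f X \<oplus>\<^bsub>P\<^esub> tensor_lift P f Y"
proof -
  obtain c d where c: "c \<in> carrier FG" "X = tensor_class R M N c"
    and d: "d \<in> carrier FG" "Y = tensor_class R M N d"
    using assms by (auto simp: carrier_T)
  have "X \<oplus>\<^bsub>T\<^esub> Y = tensor_class R M N (c + d)"
    using c d by (simp add: tensor_class_add)
  then show ?thesis using c d
    by (auto simp: tensor_lift_class keys_addI intro!: P.lift_sum_add balanced_closed)
qed

lemma lift_zero: "tensor_lift P f \<zero>\<^bsub>T\<^esub> = \<zero>\<^bsub>P\<^esub>"
  using lift_add[of "\<zero>\<^bsub>T\<^esub>" "\<zero>\<^bsub>T\<^esub>"] lift_closed[of "\<zero>\<^bsub>T\<^esub>"]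
  by (simp add: P.add.l_cancel_one')

lemma lift_minus:
  assumes "X \<in> carrier T"
  shows "tensor_lift P f (\<ominus>\<^bsub>T\<^esub> X) = \<ominus>\<^bsub>P\<^esub> tensor_lift P f X"
  using assms lift_add[of "\<ominus>\<^bsub>T\<^esub> X" X] lift_closed
  by (intro P.minus_equality[symmetric]) (auto simp: T.l_neg lift_zero)

lemma lift_finsum:
  assumes "finite I" "\<And>i. i \<in> I \<Longrightarrow> X i \<in> carrier T"
  shows "tensor_lift P f (finsum T X I) = (\<Oplus>\<^bsub>P\<^esub>i\<in>I. tensor_lift P f (X i))"
  using assms
proof (induction I rule: finite_induct)
  case empty
  then show ?case by (simp add: lift_zero)
next
  case (insert i I)
  then show ?case
    by (subst T.finsum_insert) (auto simp: lift_add lift_closed P.finsum_insert Pi_def)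
qed

end

text \<open>Scalar action and product of \<open>tensor_product\<close> are defined on
  representatives by \<open>frag_extend\<close>. This rewrites them as lifts, to which balancedness
  and \<open>tensor_induct\<close> apply.\<close>

lemma tensor_class_frag_extend:
  assumes c: "c \<in> carrier FG'" and FG': "FG' = tensor_free M' N'"
    and F: "\<And>q. q \<in> carrier M' \<times> carrier N' \<Longrightarrow> F q \<in> carrier FG"
  shows "frag_extend F c \<in> carrier FG \<and>
    tensor_class R M N (frag_extend F c) = lift_sum T (\<lambda>m n. tensor_class R M N (F (m, n))) c"
proof -
  let ?S = "carrier M' \<times> carrier N'"
  let ?h = "\<lambda>m n. tensor_class R M N (F (m, n))"
  have cl: "?h (fst q) (snd q) \<in> carrier T" if "q \<in> ?S" for q
    using F[of q] that by (simp add: tensor_class_closed)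
  have "Poly_Mapping.keys c \<subseteq> ?S" using c FG' by (simp add: tensor_free_def)
  then have "Poly_Mapping.keys c \<subseteq> ?S \<and> frag_extend F c \<in> carrier FG \<and>
    tensor_class R M N (frag_extend F c) = lift_sum T ?h c"
  proof (induction rule: frag_induction)
    case zero
    then show ?case by (simp add: tensor_class_0)
  next
    case (one x)
    then show ?case using F[of x] cl[of x] by (auto simp: T.lift_sum_frag_of)
  next
    case (diff a b)
    then have k: "Poly_Mapping.keys (frag_extend F a) \<subseteq> carrier M \<times> carrier N"
      "Poly_Mapping.keys (frag_extend F b) \<subseteq> carrier M \<times> carrier N" by simp_all
    from diff have "lift_sum T ?h (a - b) = lift_sum T ?h a \<ominus>\<^bsub>T\<^esub> lift_sum T ?h b"
      by (intro T.lift_sum_diff cl) auto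
    also have "\<dots> = tensor_class R M N (frag_extend F a) \<ominus>\<^bsub>T\<^esub> tensor_class R M N (frag_extend F b)"
      using diff by simp
    also have "\<dots> = tensor_class R M N (frag_extend F a - frag_extend F b)"
    proof -
      have "tensor_class R M N (frag_extend F a - frag_extend F b) \<oplus>\<^bsub>T\<^esub> tensor_class R M N (frag_extend F b)
         = tensor_class R M N (frag_extend F a)"
        using diff by (subst tensor_class_add[symmetric]) (simp_all add: keys_diffI)
      moreover have "tensor_class R M N (frag_extend F a - frag_extend F b) \<in> carrier T"
        "tensor_class R M N (frag_extend F a) \<in> carrier T"
        "tensor_class R M N (frag_extend F b) \<in> carrier T"
        by (intro tensor_class_closed; simp add: k keys_diffI)+
      ultimately show ?thesis
        by (simp add: a_minus_def T.add.inv_solve_right')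
    qed
    finally show ?case using diff
      by (simp add: frag_extend_diff keys_diffI)
  qed
  then show ?thesis by blast
qed

lemma smult_T:
  assumes X: "X \<in> carrier T" and r: "r \<in> carrier R"
  shows "r \<odot>\<^bsub>T\<^esub> X = tensor_lift T (\<lambda>m n. pure_tensor R M N (r \<odot>\<^bsub>M\<^esub> m) n) X"
proof -
  have "r \<odot>\<^bsub>T\<^esub> X = tensor_class R M N (frag_extend (\<lambda>(m, n). frag_of (r \<odot>\<^bsub>M\<^esub> m, n)) (tensor_rep X))"
    by (simp add: tensor_product_def)
  also have "\<dots> = lift_sum T (\<lambda>m n. tensor_class R M N (case (m, n) of (m, n) \<Rightarrow> frag_of (r \<odot>\<^bsub>M\<^esub> m, n))) (tensor_rep X)"
    by (rule conjunct2[OF tensor_class_frag_extend[OF tensor_rep_closed[OF X] refl]]) (use r in auto)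
  finally show ?thesis
    by (simp add: tensor_lift_eq_lift_sum pure_tensor_def)
qed

lemma balanced_smult:
  assumes r: "r \<in> carrier R"
  shows "balanced_map R M N T (\<lambda>m n. pure_tensor R M N (r \<odot>\<^bsub>M\<^esub> m) n)"
  using r by (simp add: balanced_map_def pure_add_right pure_add_left M.smult_r_distr pure_balanced[symmetric])
    (simp add: M.smult_assoc1[symmetric] M.R.m_comm)

lemma smult_pure:
  assumes "r \<in> carrier R" "m \<in> carrier M" "n \<in> carrier N"
  shows "r \<odot>\<^bsub>T\<^esub> pure_tensor R M N m n = pure_tensor R M N (r \<odot>\<^bsub>M\<^esub> m) n"
  using assms by (simp add: smult_T lift_pure[OF T_abelian_group balanced_smult])

lemma T_module: "module R T"
proof (rule moduleI)
  show "cring R" by unfold_locales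
  show "abelian_group T" by unfold_locales
  show cl: "r \<odot>\<^bsub>T\<^esub> X \<in> carrier T" if "r \<in> carrier R" "X \<in> carrier T" for r X
    using that by (simp add: smult_T lift_closed[OF T_abelian_group balanced_smult])
  show sadd: "r \<odot>\<^bsub>T\<^esub> (X \<oplus>\<^bsub>T\<^esub> Y) = r \<odot>\<^bsub>T\<^esub> X \<oplus>\<^bsub>T\<^esub> r \<odot>\<^bsub>T\<^esub> Y"
    if "r \<in> carrier R" "X \<in> carrier T" "Y \<in> carrier T" for r X Y
    using that by (simp add: smult_T lift_add[OF T_abelian_group balanced_smult])
  show "(a \<oplus>\<^bsub>R\<^esub> b) \<odot>\<^bsub>T\<^esub> X = a \<odot>\<^bsub>T\<^esub> X \<oplus>\<^bsub>T\<^esub> b \<odot>\<^bsub>T\<^esub> X"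
    if "a \<in> carrier R" "b \<in> carrier R" "X \<in> carrier T" for a b X
    using that(3)
  proof (induction rule: tensor_induct)
    case (pure m n)
    then show ?case using that by (simp add: smult_pure M.smult_l_distr pure_add_left)
  next
    case (add X Y)
    then show ?case using that by (simp add: cl sadd T.add.m_ac)
  qed
  show "(a \<otimes>\<^bsub>R\<^esub> b) \<odot>\<^bsub>T\<^esub> X = a \<odot>\<^bsub>T\<^esub> (b \<odot>\<^bsub>T\<^esub> X)"
    if "a \<in> carrier R" "b \<in> carrier R" "X \<in> carrier T" for a b X
    using that(3)
  proof (induction rule: tensor_induct)
    case (pure m n)
    then show ?case using that by (simp add: smult_pure M.smult_assoc1)
  next
    case (add X Y)
    then show ?case using that by (simp add: cl sadd)
  qed
  show "\<one>\<^bsub>R\<^esub> \<odot>\<^bsub>T\<^esub> X = X" if "X \<in> carrier T" for X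
    using that
  proof (induction rule: tensor_induct)
    case (pure m n)
    then show ?case using that by (simp add: smult_pure)
  next
    case (add X Y)
    then show ?case using that by (simp add: cl sadd)
  qed
qed

sublocale T: module R T by (rule T_module)

end

section \<open>Products in the tensor product of two algebras\<close>

locale tensor_algebras = M: algebra R M + N: algebra R N for R (structure) and M and N
begin

sublocale tensor_pair R M N by unfold_locales

lemma mult_T:
  assumes X: "X \<in> carrier T" and Y: "Y \<in> carrier T"
  shows "X \<otimes>\<^bsub>T\<^esub> Y = tensor_lift T (\<lambda>m n. tensor_lift T
    (\<lambda>m' n'. pure_tensor R M N (m \<otimes>\<^bsub>M\<^esub> m') (n \<otimes>\<^bsub>N\<^esub> n')) Y) X"
proof -
  let ?F = "\<lambda>(m, n). frag_extend (\<lambda>(m', n'). frag_of (m \<otimes>\<^bsub>M\<^esub> m', n \<otimes>\<^bsub>N\<^esub> n')) (tensor_rep Y)"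
  have inner: "?F q \<in> carrier FG \<and> tensor_class R M N (?F q) = tensor_lift T
      (\<lambda>m' n'. pure_tensor R M N (fst q \<otimes>\<^bsub>M\<^esub> m') (snd q \<otimes>\<^bsub>N\<^esub> n')) Y"
    if "q \<in> carrier M \<times> carrier N" for q
    using tensor_class_frag_extend[OF tensor_rep_closed[OF Y] refl,
        of "\<lambda>(m', n'). frag_of (fst q \<otimes>\<^bsub>M\<^esub> m', snd q \<otimes>\<^bsub>N\<^esub> n')"] that
    by (auto simp: tensor_lift_eq_lift_sum pure_tensor_def split_beta)
  have "X \<otimes>\<^bsub>T\<^esub> Y = tensor_class R M N (frag_extend ?F (tensor_rep X))"
    by (simp add: tensor_product_def)
  also have "\<dots> = lift_sum T (\<lambda>m n. tensor_class R M N (?F (m, n))) (tensor_rep X)"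
    using tensor_class_frag_extend[OF tensor_rep_closed[OF X] refl, of ?F] inner by blast
  also have "\<dots> = lift_sum T (\<lambda>m n. tensor_lift T
    (\<lambda>m' n'. pure_tensor R M N (m \<otimes>\<^bsub>M\<^esub> m') (n \<otimes>\<^bsub>N\<^esub> n')) Y) (tensor_rep X)"
    unfolding lift_sum_def
  proof (rule T.finsum_cong'[OF refl])
    have k: "Poly_Mapping.keys (tensor_rep X) \<subseteq> carrier M \<times> carrier N"
      using tensor_rep_closed[OF X] by simp
    show "(\<lambda>q. add_pow T (Poly_Mapping.lookup (tensor_rep X) q) (tensor_lift T
       (\<lambda>m' n'. pure_tensor R M N (fst q \<otimes>\<^bsub>M\<^esub> m') (snd q \<otimes>\<^bsub>N\<^esub> n')) Y))
       \<in> Poly_Mapping.keys (tensor_rep X) \<rightarrow> carrier T"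
    proof
      fix q assume q: "q \<in> Poly_Mapping.keys (tensor_rep X)"
      then have "tensor_lift T (\<lambda>m' n'. pure_tensor R M N (fst q \<otimes>\<^bsub>M\<^esub> m') (snd q \<otimes>\<^bsub>N\<^esub> n')) Y \<in> carrier T"
        using tensor_class_closed[OF conjunct1[OF inner[OF subsetD[OF k q]]]]
          conjunct2[OF inner[OF subsetD[OF k q]]] by (simp only:)
      then show "add_pow T (Poly_Mapping.lookup (tensor_rep X) q) (tensor_lift T
        (\<lambda>m' n'. pure_tensor R M N (fst q \<otimes>\<^bsub>M\<^esub> m') (snd q \<otimes>\<^bsub>N\<^esub> n')) Y) \<in> carrier T"
        by (rule T.add.int_pow_closed)
    qed
    show "add_pow T (Poly_Mapping.lookup (tensor_rep X) q) (tensor_class R M N (?F (fst q, snd q)))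
       = add_pow T (Poly_Mapping.lookup (tensor_rep X) q) (tensor_lift T
       (\<lambda>m' n'. pure_tensor R M N (fst q \<otimes>\<^bsub>M\<^esub> m') (snd q \<otimes>\<^bsub>N\<^esub> n')) Y)"
      if "q \<in> Poly_Mapping.keys (tensor_rep X)" for q
    proof -
      have "q \<in> carrier M \<times> carrier N" using k that by (rule subsetD)
      then show ?thesis using inner[of q] by (simp only: prod.collapse)
    qed
  qed
  finally show ?thesis by (simp add: tensor_lift_eq_lift_sum)
qed

lemma balanced_mult_pure:
  assumes "m \<in> carrier M" "n \<in> carrier N"
  shows "balanced_map R M N T (\<lambda>m' n'. pure_tensor R M N (m \<otimes>\<^bsub>M\<^esub> m') (n \<otimes>\<^bsub>N\<^esub> n'))"
proof -
  have "m \<otimes>\<^bsub>M\<^esub> (r \<odot>\<^bsub>M\<^esub> m') = r \<odot>\<^bsub>M\<^esub> (m \<otimes>\<^bsub>M\<^esub> m')" if "r \<in> carrier R" "m' \<in> carrier M" for r m'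
    using that assms M.smult_assoc2[of r m' m] by (simp add: M.m_comm)
  moreover have "n \<otimes>\<^bsub>N\<^esub> (r \<odot>\<^bsub>N\<^esub> n') = r \<odot>\<^bsub>N\<^esub> (n \<otimes>\<^bsub>N\<^esub> n')" if "r \<in> carrier R" "n' \<in> carrier N" for r n'
    using that assms N.smult_assoc2[of r n' n] by (simp add: N.m_comm)
  ultimately show ?thesis using assms
    by (simp add: balanced_map_def pure_add_left pure_add_right M.r_distr N.r_distr pure_balanced)
qed

lemma lift_mult_pure_closed:
  assumes "m \<in> carrier M" "n \<in> carrier N" "Y \<in> carrier T"
  shows "tensor_lift T (\<lambda>m' n'. pure_tensor R M N (m \<otimes>\<^bsub>M\<^esub> m') (n \<otimes>\<^bsub>N\<^esub> n')) Y \<in> carrier T"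
  using assms by (intro lift_closed[OF T_abelian_group balanced_mult_pure])

text \<open>Each identity compares inner lifts as functions of \<open>Y\<close>, and these are
  additive by \<open>balanced_mult_pure\<close>. Hence induction on \<open>Y\<close> reduces it to a
  product of pure tensors.\<close>

lemma balanced_mult:
  assumes Y: "Y \<in> carrier T"
  shows "balanced_map R M N T (\<lambda>m n. tensor_lift T
    (\<lambda>m' n'. pure_tensor R M N (m \<otimes>\<^bsub>M\<^esub> m') (n \<otimes>\<^bsub>N\<^esub> n')) Y)"
  unfolding balanced_map_def
proof (intro conjI ballI)
  fix m n assume *: "m \<in> carrier M" "n \<in> carrier N"
  show "tensor_lift T (\<lambda>m' n'. pure_tensor R M N (m \<otimes>\<^bsub>M\<^esub> m') (n \<otimes>\<^bsub>N\<^esub> n')) Y \<in> carrier T"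
    by (rule lift_mult_pure_closed[OF * Y])
next
  fix m m2 n assume *: "m \<in> carrier M" "m2 \<in> carrier M" "n \<in> carrier N"
  show "tensor_lift T (\<lambda>m' n'. pure_tensor R M N ((m \<oplus>\<^bsub>M\<^esub> m2) \<otimes>\<^bsub>M\<^esub> m') (n \<otimes>\<^bsub>N\<^esub> n')) Y =
    tensor_lift T (\<lambda>m' n'. pure_tensor R M N (m \<otimes>\<^bsub>M\<^esub> m') (n \<otimes>\<^bsub>N\<^esub> n')) Y \<oplus>\<^bsub>T\<^esub>
    tensor_lift T (\<lambda>m' n'. pure_tensor R M N (m2 \<otimes>\<^bsub>M\<^esub> m') (n \<otimes>\<^bsub>N\<^esub> n')) Y"
    using Y
  proof (induction rule: tensor_induct)
    case (pure a b)
    then show ?case using *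
      by (simp add: lift_pure[OF T_abelian_group balanced_mult_pure] M.l_distr pure_add_left)
  next
    case (add X Y)
    then show ?case using *
      by (simp add: lift_add[OF T_abelian_group balanced_mult_pure] lift_mult_pure_closed T.add.m_ac)
  qed
next
  fix m n n2 assume *: "m \<in> carrier M" "n \<in> carrier N" "n2 \<in> carrier N"
  show "tensor_lift T (\<lambda>m' n'. pure_tensor R M N (m \<otimes>\<^bsub>M\<^esub> m') ((n \<oplus>\<^bsub>N\<^esub> n2) \<otimes>\<^bsub>N\<^esub> n')) Y =
    tensor_lift T (\<lambda>m' n'. pure_tensor R M N (m \<otimes>\<^bsub>M\<^esub> m') (n \<otimes>\<^bsub>N\<^esub> n')) Y \<oplus>\<^bsub>T\<^esub>
    tensor_lift T (\<lambda>m' n'. pure_tensor R M N (m \<otimes>\<^bsub>M\<^esub> m') (n2 \<otimes>\<^bsub>N\<^esub> n')) Y"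
    using Y
  proof (induction rule: tensor_induct)
    case (pure a b)
    then show ?case using *
      by (simp add: lift_pure[OF T_abelian_group balanced_mult_pure] N.l_distr pure_add_right)
  next
    case (add X Y)
    then show ?case using *
      by (simp add: lift_add[OF T_abelian_group balanced_mult_pure] lift_mult_pure_closed T.add.m_ac)
  qed
next
  fix r m n assume *: "r \<in> carrier R" "m \<in> carrier M" "n \<in> carrier N"
  show "tensor_lift T (\<lambda>m' n'. pure_tensor R M N ((r \<odot>\<^bsub>M\<^esub> m) \<otimes>\<^bsub>M\<^esub> m') (n \<otimes>\<^bsub>N\<^esub> n')) Y =
    tensor_lift T (\<lambda>m' n'. pure_tensor R M N (m \<otimes>\<^bsub>M\<^esub> m') ((r \<odot>\<^bsub>N\<^esub> n) \<otimes>\<^bsub>N\<^esub> n')) Y"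
    using Y
  proof (induction rule: tensor_induct)
    case (pure a b)
    then show ?case using *
      by (simp add: lift_pure[OF T_abelian_group balanced_mult_pure] M.smult_assoc2 N.smult_assoc2 pure_balanced)
  next
    case (add X Y)
    then show ?case using *
      by (simp add: lift_add[OF T_abelian_group balanced_mult_pure] lift_mult_pure_closed)
  qed
qed

lemma mult_closed: "X \<in> carrier T \<Longrightarrow> Y \<in> carrier T \<Longrightarrow> X \<otimes>\<^bsub>T\<^esub> Y \<in> carrier T"
  by (simp add: mult_T lift_closed[OF T_abelian_group balanced_mult])

lemma mult_pure:
  assumes "m \<in> carrier M" "n \<in> carrier N" "m' \<in> carrier M" "n' \<in> carrier N"
  shows "pure_tensor R M N m n \<otimes>\<^bsub>T\<^esub> pure_tensor R M N m' n' =
    pure_tensor R M N (m \<otimes>\<^bsub>M\<^esub> m') (n \<otimes>\<^bsub>N\<^esub> n')"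
  using assms by (simp add: mult_T lift_pure[OF T_abelian_group balanced_mult]
    lift_pure[OF T_abelian_group balanced_mult_pure])

lemma mult_add_left:
  assumes "X \<in> carrier T" "X' \<in> carrier T" "Y \<in> carrier T"
  shows "(X \<oplus>\<^bsub>T\<^esub> X') \<otimes>\<^bsub>T\<^esub> Y = X \<otimes>\<^bsub>T\<^esub> Y \<oplus>\<^bsub>T\<^esub> X' \<otimes>\<^bsub>T\<^esub> Y"
  using assms by (simp add: mult_T lift_add[OF T_abelian_group balanced_mult])

lemma mult_add_right:
  assumes X: "X \<in> carrier T" and Y: "Y \<in> carrier T" "Y' \<in> carrier T"
  shows "X \<otimes>\<^bsub>T\<^esub> (Y \<oplus>\<^bsub>T\<^esub> Y') = X \<otimes>\<^bsub>T\<^esub> Y \<oplus>\<^bsub>T\<^esub> X \<otimes>\<^bsub>T\<^esub> Y'"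
  using X
proof (induction rule: tensor_induct)
  case (pure m n)
  then show ?case using Y
    by (simp add: mult_T lift_pure[OF T_abelian_group balanced_mult]
        lift_add[OF T_abelian_group balanced_mult_pure])
next
  case (add X X')
  then show ?case using Y by (simp add: mult_add_left mult_closed T.add.m_ac)
qed

text \<open>Meant for powers of \<open>s\<close> as scalars: degrees add when elements of the
  Laurent tensor square are multiplied.\<close>

lemma smult_mult_smult:
  assumes "r \<in> carrier R" "r' \<in> carrier R" and X: "X \<in> carrier T" and Y: "Y \<in> carrier T"
  shows "(r \<odot>\<^bsub>T\<^esub> X) \<otimes>\<^bsub>T\<^esub> (r' \<odot>\<^bsub>T\<^esub> Y) = (r \<otimes>\<^bsub>R\<^esub> r') \<odot>\<^bsub>T\<^esub> (X \<otimes>\<^bsub>T\<^esub> Y)"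
  using X
proof (induction rule: tensor_induct)
  case (pure m n)
  show ?case using Y
  proof (induction rule: tensor_induct)
    case (pure m' n')
    have "(r \<odot>\<^bsub>M\<^esub> m) \<otimes>\<^bsub>M\<^esub> (r' \<odot>\<^bsub>M\<^esub> m') = (r \<otimes>\<^bsub>R\<^esub> r') \<odot>\<^bsub>M\<^esub> (m \<otimes>\<^bsub>M\<^esub> m')"
      using assms pure \<open>m \<in> carrier M\<close>
      by (simp add: M.smult_assoc2 M.smult_assoc1 M.m_comm[of m "r' \<odot>\<^bsub>M\<^esub> m'"] M.m_comm[of m' m])
    then show ?case using assms pure \<open>m \<in> carrier M\<close> \<open>n \<in> carrier N\<close>
      by (simp add: smult_pure mult_pure)
  next
    case (add Y Y')
    then show ?case using assms pure
      by (simp add: T.smult_r_distr mult_add_right mult_closed)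
  qed
next
  case (add X X')
  then show ?case using assms
    by (simp add: T.smult_r_distr mult_add_left mult_closed)
qed

end

section \<open>Monoid rings and polynomials\<close>

text \<open>\<open>act\<close> is left open so that one notion covers maps along a change of base
  ring and forms with values in a ring, where \<open>act\<close> is multiplication.
  \<open>module_homs\<close> would force the target to be a module over \<open>R\<close>.\<close>

definition semilinear ::
  "('r, 'z) ring_scheme \<Rightarrow> ('r, 'm, 'x) module_scheme \<Rightarrow> ('n, 'y) ring_scheme \<Rightarrow>
     ('r \<Rightarrow> 'n \<Rightarrow> 'n) \<Rightarrow> ('m \<Rightarrow> 'n) \<Rightarrow> bool" where
  "semilinear R M N act f \<longleftrightarrow> f \<in> carrier M \<rightarrow> carrier N \<and>
     (\<forall>x\<in>carrier M. \<forall>y\<in>carrier M. f (x \<oplus>\<^bsub>M\<^esub> y) = f x \<oplus>\<^bsub>N\<^esub> f y) \<and>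
     (\<forall>r\<in>carrier R. \<forall>x\<in>carrier M. f (r \<odot>\<^bsub>M\<^esub> x) = act r (f x))"

lemma semilinearI:
  assumes "\<And>x. x \<in> carrier M \<Longrightarrow> f x \<in> carrier N"
    and "\<And>x y. x \<in> carrier M \<Longrightarrow> y \<in> carrier M \<Longrightarrow> f (x \<oplus>\<^bsub>M\<^esub> y) = f x \<oplus>\<^bsub>N\<^esub> f y"
    and "\<And>r x. r \<in> carrier R \<Longrightarrow> x \<in> carrier M \<Longrightarrow> f (r \<odot>\<^bsub>M\<^esub> x) = act r (f x)"
  shows "semilinear R M N act f"
  using assms by (simp add: semilinear_def)

lemma semilinearD:
  assumes "semilinear R M N act f"
  shows "x \<in> carrier M \<Longrightarrow> f x \<in> carrier N"
    and "x \<in> carrier M \<Longrightarrow> y \<in> carrier M \<Longrightarrow> f (x \<oplus>\<^bsub>M\<^esub> y) = f x \<oplus>\<^bsub>N\<^esub> f y"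
    and "r \<in> carrier R \<Longrightarrow> x \<in> carrier M \<Longrightarrow> f (r \<odot>\<^bsub>M\<^esub> x) = act r (f x)"
  using assms by (auto simp: semilinear_def)

context tensor_pair
begin

text \<open>The instances of \<open>h\<close> are the inclusions of \<open>k[t]\<close> and of
  \<open>k\<close> into \<open>k[s^{+-1}]\<close>, and the identity of \<open>k\<close>.\<close>

lemma balanced_tensor_map:
  assumes T': "tensor_pair R' M' N'" and h: "h \<in> carrier R \<rightarrow> carrier R'"
    and f: "semilinear R M M' (\<lambda>r. smult M' (h r)) f"
    and g: "semilinear R N N' (\<lambda>r. smult N' (h r)) g"
  shows "balanced_map R M N (tensor_product R' M' N') (\<lambda>m n. pure_tensor R' M' N' (f m) (g n))"
proof -
  interpret T': tensor_pair R' M' N' by fact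
  show ?thesis using h unfolding balanced_map_def
    by (auto simp: semilinearD[OF f] semilinearD[OF g] T'.pure_add_left T'.pure_add_right
        T'.pure_balanced Pi_def)
qed

lemma balanced_mult_semilinear:
  assumes P: "cring P" and h: "h \<in> carrier R \<rightarrow> carrier P"
    and f: "semilinear R M P (\<lambda>r. monoid.mult P (h r)) f"
    and g: "semilinear R N P (\<lambda>r. monoid.mult P (h r)) g"
  shows "balanced_map R M N P (\<lambda>m n. f m \<otimes>\<^bsub>P\<^esub> g n)"
proof -
  interpret P: cring P by fact
  show ?thesis using h unfolding balanced_map_def
    by (auto simp: semilinearD[OF f] semilinearD[OF g] P.l_distr P.r_distr P.m_ac Pi_def)
qed

lemma semilinear_tensor_lift:
  assumes P: "abelian_group P" and f: "balanced_map R M N P f"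
    and s: "\<And>r m n. r \<in> carrier R \<Longrightarrow> m \<in> carrier M \<Longrightarrow> n \<in> carrier N \<Longrightarrow> f (r \<odot>\<^bsub>M\<^esub> m) n = act r (f m n)"
    and act: "\<And>r x y. r \<in> carrier R \<Longrightarrow> x \<in> carrier P \<Longrightarrow> y \<in> carrier P \<Longrightarrow> act r (x \<oplus>\<^bsub>P\<^esub> y) = act r x \<oplus>\<^bsub>P\<^esub> act r y"
  shows "semilinear R T P act (tensor_lift P f)"
proof (rule semilinearI)
  fix r X assume r: "r \<in> carrier R" and "X \<in> carrier T"
  from this(2) show "tensor_lift P f (r \<odot>\<^bsub>T\<^esub> X) = act r (tensor_lift P f X)"
  proof (induction rule: tensor_induct)
    case (pure m n)
    then show ?case using r by (simp add: smult_pure lift_pure[OF P f] s)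
  next
    case (add X Y)
    then show ?case using r by (simp add: T.smult_r_distr lift_add[OF P f] act lift_closed[OF P f])
  qed
qed (simp_all add: lift_closed[OF P f] lift_add[OF P f])

end

section \<open>Monoid rings under convolution\<close>

context cring
begin

abbreviation MR :: "('i::comm_monoid_add \<Rightarrow> 'a) ring" where "MR \<equiv> monoid_ring R"

lemma MR_carrier: "p \<in> carrier MR \<longleftrightarrow> (\<forall>i. p i \<in> carrier R) \<and> finite {i. p i \<noteq> \<zero>}"
  by (simp add: monoid_ring_def)

lemma MR_closed: "p \<in> carrier MR \<Longrightarrow> p i \<in> carrier R"
  by (simp add: monoid_ring_def)

lemma MR_finite: "p \<in> carrier MR \<Longrightarrow> finite {i. p i \<noteq> \<zero>}"
  by (simp add: monoid_ring_def)

lemma MR_add: "(p \<oplus>\<^bsub>MR\<^esub> q) i = p i \<oplus> q i"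
  by (simp add: monoid_ring_def)

lemma MR_zero: "\<zero>\<^bsub>MR\<^esub> = (\<lambda>i. \<zero>)"
  by (simp add: monoid_ring_def)

lemma MR_one: "\<one>\<^bsub>MR\<^esub> = monomial R \<one> 0"
  by (simp add: monoid_ring_def monomial_def fun_eq_iff)

lemma MR_zero_closed: "\<zero>\<^bsub>MR\<^esub> \<in> carrier MR"
  by (simp add: MR_zero MR_carrier)

lemma monomial_closed: "a \<in> carrier R \<Longrightarrow> monomial R a i \<in> carrier MR"
  by (simp add: MR_carrier monomial_def)

lemma monomial_add:
  "a \<in> carrier R \<Longrightarrow> b \<in> carrier R \<Longrightarrow> monomial R (a \<oplus> b) i = monomial R a i \<oplus>\<^bsub>MR\<^esub> monomial R b i"
  by (auto simp: monomial_def MR_add fun_eq_iff)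

lemma monomial_zero: "monomial R \<zero> i = \<zero>\<^bsub>MR\<^esub>"
  by (auto simp: monomial_def MR_zero)

text \<open>The defining sum runs over the supports, which change when polynomials are added. A
  fixed rectangle with a degree test in the summand makes distributivity a termwise matter.\<close>

lemma MR_mult:
  assumes p: "p \<in> carrier MR" and q: "q \<in> carrier MR"
    and S: "finite S" "{i. p i \<noteq> \<zero>} \<subseteq> S" and S': "finite S'" "{i. q i \<noteq> \<zero>} \<subseteq> S'"
  shows "(p \<otimes>\<^bsub>MR\<^esub> q) n =
    (\<Oplus>x\<in>S \<times> S'. if fst x + snd x = n then p (fst x) \<otimes> q (snd x) else \<zero>)"
proof -
  have "(p \<otimes>\<^bsub>MR\<^esub> q) n =
    (\<Oplus>x \<in> {(i, j). p i \<noteq> \<zero> \<and> q j \<noteq> \<zero> \<and> i + j = n}. p (fst x) \<otimes> q (snd x))"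
    by (simp add: monoid_ring_def)
  also have "\<dots> = (\<Oplus>x\<in>S \<times> S'. if fst x + snd x = n then p (fst x) \<otimes> q (snd x) else \<zero>)"
  proof (rule add.finprod_mono_neutral_cong_left)
    show "{(i, j). p i \<noteq> \<zero> \<and> q j \<noteq> \<zero> \<and> i + j = n} \<subseteq> S \<times> S'" using S S' by auto
    show "(if fst x + snd x = n then p (fst x) \<otimes> q (snd x) else \<zero>) = \<zero>"
      if "x \<in> S \<times> S' - {(i, j). p i \<noteq> \<zero> \<and> q j \<noteq> \<zero> \<and> i + j = n}" for x
      using that p q by (auto simp: MR_closed)
  qed (use S S' p q in \<open>auto simp: MR_closed\<close>)
  finally show ?thesis .
qed

lemma MR_mult_closed:
  assumes p: "p \<in> carrier MR" and q: "q \<in> carrier MR"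
  shows "p \<otimes>\<^bsub>MR\<^esub> q \<in> carrier MR"
proof -
  let ?S = "{i. p i \<noteq> \<zero>}" and ?S' = "{i. q i \<noteq> \<zero>}"
  note m = MR_mult[OF p q MR_finite[OF p] order_refl MR_finite[OF q] order_refl]
  have "(p \<otimes>\<^bsub>MR\<^esub> q) n \<in> carrier R" for n
    unfolding m using p q by (auto intro!: finsum_closed simp: MR_closed)
  moreover have "{n. (p \<otimes>\<^bsub>MR\<^esub> q) n \<noteq> \<zero>} \<subseteq> (\<lambda>x. fst x + snd x) ` (?S \<times> ?S')"
  proof (rule subsetI, rule ccontr)
    fix n assume n: "n \<in> {n. (p \<otimes>\<^bsub>MR\<^esub> q) n \<noteq> \<zero>}" "n \<notin> (\<lambda>x. fst x + snd x) ` (?S \<times> ?S')"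
    have "(p \<otimes>\<^bsub>MR\<^esub> q) n = (\<Oplus>x\<in>?S \<times> ?S'. \<zero>)"
      unfolding m using n(2) by (intro finsum_cong') auto
    then show False using n(1) by simp
  qed
  then have "finite {n. (p \<otimes>\<^bsub>MR\<^esub> q) n \<noteq> \<zero>}"
    by (rule finite_subset) (simp add: MR_finite p q)
  ultimately show ?thesis by (simp add: MR_carrier)
qed

lemma MR_add_closed:
  assumes "p \<in> carrier MR" "q \<in> carrier MR"
  shows "p \<oplus>\<^bsub>MR\<^esub> q \<in> carrier MR"
proof -
  have "{i. p i \<oplus> q i \<noteq> \<zero>} \<subseteq> {i. p i \<noteq> \<zero>} \<union> {i. q i \<noteq> \<zero>}" by auto
  then have "finite {i. p i \<oplus> q i \<noteq> \<zero>}"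
    by (rule finite_subset) (simp add: assms MR_finite)
  then show ?thesis using assms by (simp add: MR_carrier MR_add)
qed

lemma MR_abelian_group: "abelian_group (MR :: ('i::comm_monoid_add \<Rightarrow> 'a) ring)"
proof (rule abelian_groupI)
  fix p :: "'i \<Rightarrow> 'a" assume p: "p \<in> carrier MR"
  show "\<exists>q\<in>carrier MR. q \<oplus>\<^bsub>MR\<^esub> p = \<zero>\<^bsub>MR\<^esub>"
  proof
    have "{i. \<ominus> p i \<noteq> \<zero>} \<subseteq> {i. p i \<noteq> \<zero>}" by auto
    then have "finite {i. \<ominus> p i \<noteq> \<zero>}" by (rule finite_subset) (simp add: p MR_finite)
    then show "(\<lambda>i. \<ominus> p i) \<in> carrier MR" using p by (simp add: MR_carrier)
    show "(\<lambda>i. \<ominus> p i) \<oplus>\<^bsub>MR\<^esub> p = \<zero>\<^bsub>MR\<^esub>"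
      using p by (simp add: fun_eq_iff MR_add MR_zero MR_closed l_neg)
  qed
qed (use MR_zero_closed in \<open>auto simp: fun_eq_iff MR_add MR_zero MR_closed MR_add_closed a_ac\<close>)

lemma MR_mult_add_left:
  assumes p: "p \<in> carrier MR" "p' \<in> carrier MR" and q: "q \<in> carrier MR"
  shows "(p \<oplus>\<^bsub>MR\<^esub> p') \<otimes>\<^bsub>MR\<^esub> q = p \<otimes>\<^bsub>MR\<^esub> q \<oplus>\<^bsub>MR\<^esub> p' \<otimes>\<^bsub>MR\<^esub> q"
proof
  fix n
  let ?S = "{i. p i \<noteq> \<zero>} \<union> {i. p' i \<noteq> \<zero>}" and ?S' = "{i. q i \<noteq> \<zero>}"
  have fin: "finite ?S" "finite ?S'" using p q by (simp_all add: MR_finite)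
  have "((p \<oplus>\<^bsub>MR\<^esub> p') \<otimes>\<^bsub>MR\<^esub> q) n =
    (\<Oplus>x\<in>?S \<times> ?S'. if fst x + snd x = n then (p \<oplus>\<^bsub>MR\<^esub> p') (fst x) \<otimes> q (snd x) else \<zero>)"
    using p q fin by (intro MR_mult MR_add_closed) (auto simp: MR_add)
  also have "\<dots> = (\<Oplus>x\<in>?S \<times> ?S'. (if fst x + snd x = n then p (fst x) \<otimes> q (snd x) else \<zero>) \<oplus>
      (if fst x + snd x = n then p' (fst x) \<otimes> q (snd x) else \<zero>))"
    using p q by (intro finsum_cong') (auto simp: MR_add l_distr MR_closed simp del: add.finprod_multf)
  also have "\<dots> = (\<Oplus>x\<in>?S \<times> ?S'. if fst x + snd x = n then p (fst x) \<otimes> q (snd x) else \<zero>) \<oplus>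
      (\<Oplus>x\<in>?S \<times> ?S'. if fst x + snd x = n then p' (fst x) \<otimes> q (snd x) else \<zero>)"
    using p q by (intro finsum_addf) (auto simp: MR_closed)
  also have "\<dots> = (p \<otimes>\<^bsub>MR\<^esub> q) n \<oplus> (p' \<otimes>\<^bsub>MR\<^esub> q) n"
    using p q fin by (subst (1 2) MR_mult[of _ _ ?S ?S']) auto
  finally show "((p \<oplus>\<^bsub>MR\<^esub> p') \<otimes>\<^bsub>MR\<^esub> q) n = (p \<otimes>\<^bsub>MR\<^esub> q \<oplus>\<^bsub>MR\<^esub> p' \<otimes>\<^bsub>MR\<^esub> q) n"
    by (simp add: MR_add)
qed

lemma MR_mult_add_right:
  assumes p: "p \<in> carrier MR" "p' \<in> carrier MR" and q: "q \<in> carrier MR"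
  shows "q \<otimes>\<^bsub>MR\<^esub> (p \<oplus>\<^bsub>MR\<^esub> p') = q \<otimes>\<^bsub>MR\<^esub> p \<oplus>\<^bsub>MR\<^esub> q \<otimes>\<^bsub>MR\<^esub> p'"
proof
  fix n
  let ?S = "{i. p i \<noteq> \<zero>} \<union> {i. p' i \<noteq> \<zero>}" and ?S' = "{i. q i \<noteq> \<zero>}"
  have fin: "finite ?S" "finite ?S'" using p q by (simp_all add: MR_finite)
  have "(q \<otimes>\<^bsub>MR\<^esub> (p \<oplus>\<^bsub>MR\<^esub> p')) n =
    (\<Oplus>x\<in>?S' \<times> ?S. if fst x + snd x = n then q (fst x) \<otimes> (p \<oplus>\<^bsub>MR\<^esub> p') (snd x) else \<zero>)"
    using p q fin by (intro MR_mult MR_add_closed) (auto simp: MR_add)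
  also have "\<dots> = (\<Oplus>x\<in>?S' \<times> ?S. (if fst x + snd x = n then q (fst x) \<otimes> p (snd x) else \<zero>) \<oplus>
      (if fst x + snd x = n then q (fst x) \<otimes> p' (snd x) else \<zero>))"
    using p q by (intro finsum_cong') (auto simp: MR_add r_distr MR_closed simp del: add.finprod_multf)
  also have "\<dots> = (\<Oplus>x\<in>?S' \<times> ?S. if fst x + snd x = n then q (fst x) \<otimes> p (snd x) else \<zero>) \<oplus>
      (\<Oplus>x\<in>?S' \<times> ?S. if fst x + snd x = n then q (fst x) \<otimes> p' (snd x) else \<zero>)"
    using p q by (intro finsum_addf) (auto simp: MR_closed)
  also have "\<dots> = (q \<otimes>\<^bsub>MR\<^esub> p) n \<oplus> (q \<otimes>\<^bsub>MR\<^esub> p') n"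
    using p q fin by (subst (1 2) MR_mult[of _ _ ?S' ?S]) auto
  finally show "(q \<otimes>\<^bsub>MR\<^esub> (p \<oplus>\<^bsub>MR\<^esub> p')) n = (q \<otimes>\<^bsub>MR\<^esub> p \<oplus>\<^bsub>MR\<^esub> q \<otimes>\<^bsub>MR\<^esub> p') n"
    by (simp add: MR_add)
qed

lemma monomial_mult:
  assumes "a \<in> carrier R" "b \<in> carrier R"
  shows "monomial R a i \<otimes>\<^bsub>MR\<^esub> monomial R b j = monomial R (a \<otimes> b) (i + j)"
proof
  fix n
  show "(monomial R a i \<otimes>\<^bsub>MR\<^esub> monomial R b j) n = monomial R (a \<otimes> b) (i + j) n"
    using assms
    by (subst MR_mult[of _ _ "{i}" "{j}"])
      (auto simp: monomial_closed monomial_def MR_carrier)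
qed

text \<open>Keeping all exponents inside \<open>S\<close> is what permits induction over polynomials
  in finitely many variables, a subset of the full monoid ring.\<close>

lemma MR_induct_support [consumes 2, case_names monomial zero add]:
  assumes p: "p \<in> carrier MR" and S: "{i. p i \<noteq> \<zero>} \<subseteq> S"
    and monomial: "\<And>a i. a \<in> carrier R \<Longrightarrow> i \<in> S \<Longrightarrow> Q (monomial R a i)"
    and zero: "Q \<zero>\<^bsub>MR\<^esub>"
    and add: "\<And>u v. u \<in> carrier MR \<Longrightarrow> v \<in> carrier MR \<Longrightarrow> {i. u i \<noteq> \<zero>} \<subseteq> S \<Longrightarrow>
      {i. v i \<noteq> \<zero>} \<subseteq> S \<Longrightarrow> Q u \<Longrightarrow> Q v \<Longrightarrow> Q (u \<oplus>\<^bsub>MR\<^esub> v)"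
  shows "Q p"
proof -
  have "\<forall>p\<in>carrier MR. {i. p i \<noteq> \<zero>} \<subseteq> F \<longrightarrow> Q p" if "finite F" "F \<subseteq> S" for F
    using that
  proof (induction F rule: finite_induct)
    case empty
    then show ?case using zero by (auto simp: MR_zero fun_eq_iff)
  next
    case (insert i F)
    show ?case
    proof (intro ballI impI)
      fix p assume p: "p \<in> carrier MR" "{j. p j \<noteq> \<zero>} \<subseteq> insert i F"
      \<comment> \<open>The coefficient at \<open>i\<close> is split off as a monomial; the
        remainder vanishes at \<open>i\<close>, so its support lies in \<open>F\<close>.\<close>
      let ?u = "monomial R (p i) i" and ?v = "p(i := \<zero>)"
      have v: "?v \<in> carrier MR"
      proof -
        have "{j. ?v j \<noteq> \<zero>} \<subseteq> {j. p j \<noteq> \<zero>}" by auto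
        then have "finite {j. ?v j \<noteq> \<zero>}" by (rule finite_subset) (simp add: p MR_finite)
        then show ?thesis using p by (simp add: MR_carrier)
      qed
      have sv: "{j. ?v j \<noteq> \<zero>} \<subseteq> F" using p by auto
      have pi: "p i \<in> carrier R" using p by (simp add: MR_closed)
      have "p = ?u \<oplus>\<^bsub>MR\<^esub> ?v"
        using p by (auto simp: fun_eq_iff MR_add monomial_def MR_closed)
      moreover have "Q (?u \<oplus>\<^bsub>MR\<^esub> ?v)"
      proof (rule add)
        show "Q ?v" using insert v sv by simp
        show "{j. ?v j \<noteq> \<zero>} \<subseteq> S" by (rule order_trans[OF sv]) (use insert in simp)
        show "{j. ?u j \<noteq> \<zero>} \<subseteq> S" using insert by (auto simp: monomial_def)
      qed (use pi v insert in \<open>auto simp: monomial_closed monomial\<close>)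
      ultimately show "Q p" by simp
    qed
  qed
  from this[OF MR_finite[OF p] S] p show ?thesis by blast
qed

lemma MR_induct [consumes 1, case_names monomial add]:
  assumes p: "p \<in> carrier MR"
    and monomial: "\<And>a i. a \<in> carrier R \<Longrightarrow> Q (monomial R a i)"
    and add: "\<And>u v. u \<in> carrier MR \<Longrightarrow> v \<in> carrier MR \<Longrightarrow> Q u \<Longrightarrow> Q v \<Longrightarrow> Q (u \<oplus>\<^bsub>MR\<^esub> v)"
  shows "Q p"
  using p subset_UNIV[of "{i. p i \<noteq> \<zero>}"]
proof (induction rule: MR_induct_support)
  case zero
  then show ?case using monomial[of \<zero> undefined] by (simp add: monomial_zero)
qed (auto intro: assms)

text \<open>Commutativity, associativity and the unit law are additive in each argument, so they
  only have to be checked on monomials, where they come from \<open>R\<close> and from addition of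
  exponents.\<close>

lemma MR_cring: "cring (MR :: ('i::comm_monoid_add \<Rightarrow> 'a) ring)"
proof -
  interpret A: abelian_group "MR :: ('i \<Rightarrow> 'a) ring" by (rule MR_abelian_group)
  have comm: "p \<otimes>\<^bsub>MR\<^esub> q = q \<otimes>\<^bsub>MR\<^esub> p" if p: "p \<in> carrier MR" and q: "q \<in> carrier MR" for p q :: "'i \<Rightarrow> 'a"
    using p
  proof (induction rule: MR_induct)
    case (monomial a i)
    show ?case using q
      by (induction rule: MR_induct)
        (use monomial in \<open>auto simp: monomial_mult m_comm add.commute MR_mult_add_left MR_mult_add_right monomial_closed\<close>)
  next
    case (add u v)
    then show ?case using q by (simp add: MR_mult_add_left MR_mult_add_right)
  qed
  have assoc: "(p \<otimes>\<^bsub>MR\<^esub> q) \<otimes>\<^bsub>MR\<^esub> r = p \<otimes>\<^bsub>MR\<^esub> (q \<otimes>\<^bsub>MR\<^esub> r)"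
    if p: "p \<in> carrier MR" and q: "q \<in> carrier MR" and r: "r \<in> carrier MR" for p q r :: "'i \<Rightarrow> 'a"
    using p
  proof (induction rule: MR_induct)
    case (monomial a i)
    note a = monomial
    show ?case using q
    proof (induction rule: MR_induct)
      case (monomial b j)
      note b = monomial
      show ?case using r
      proof (induction rule: MR_induct)
        case (monomial c l)
        then show ?case using a b by (simp add: monomial_mult m_assoc add.assoc)
      next
        case (add u v)
        then show ?case using a b by (simp add: MR_mult_add_right monomial_closed MR_mult_closed)
      qed
    next
      case (add u v)
      then show ?case using a r by (simp add: MR_mult_add_left MR_mult_add_right monomial_closed MR_mult_closed)
    qed
  next
    case (add u v)
    then show ?case using q r by (simp add: MR_mult_add_left MR_mult_closed)
  qed
  have one: "\<one>\<^bsub>MR\<^esub> \<otimes>\<^bsub>MR\<^esub> p = p" if "p \<in> carrier MR" for p :: "'i \<Rightarrow> 'a"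
    using that
  proof (induction rule: MR_induct)
    case (monomial a i)
    then show ?case by (simp add: MR_one monomial_mult)
  next
    case (add u v)
    then show ?case by (simp add: MR_one MR_mult_add_right monomial_closed)
  qed
  have cm: "comm_monoid (MR :: ('i \<Rightarrow> 'a) ring)"
    by (rule comm_monoidI) (use comm assoc one in \<open>auto simp: MR_mult_closed MR_one monomial_closed\<close>)
  show ?thesis
    by (rule cringI[OF MR_abelian_group cm MR_mult_add_left])
qed

lemma MR_finsum:
  fixes X :: "'j \<Rightarrow> 'i::comm_monoid_add \<Rightarrow> 'a"
  assumes "finite I" "\<And>i. i \<in> I \<Longrightarrow> X i \<in> carrier MR"
  shows "(finsum MR X I) n = (\<Oplus>i\<in>I. X i n)"
  using assms
proof (induction I rule: finite_induct)
  case empty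
  interpret A: abelian_group "MR :: ('i \<Rightarrow> 'a) ring" by (rule MR_abelian_group)
  show ?case by (simp add: MR_zero A.finsum_empty)
next
  case (insert i I)
  interpret A: abelian_group "MR :: ('i \<Rightarrow> 'a) ring" by (rule MR_abelian_group)
  show ?case using insert
    by (subst A.finsum_insert) (auto simp: MR_add MR_closed finsum_insert Pi_def)
qed

end

section \<open>The Laurent algebra over the Laurent ring\<close>

context algebra
begin

abbreviation K where "K \<equiv> laurent_ring R"
abbreviation L where "L \<equiv> laurent_algebra M"

lemma L_simps [simp]:
  "carrier L = carrier (monoid_ring M)" "monoid.mult L = monoid.mult (monoid_ring M)"
  "monoid.one L = monoid.one (monoid_ring M)" "ring.zero L = ring.zero (monoid_ring M)"
  "ring.add L = ring.add (monoid_ring M)"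
  by (simp_all add: laurent_algebra_def)

lemma L_smult: "f \<odot>\<^bsub>L\<^esub> p = (\<lambda>i. f i \<odot>\<^bsub>M\<^esub> \<one>\<^bsub>M\<^esub>) \<otimes>\<^bsub>monoid_ring M\<^esub> p"
  by (simp add: laurent_algebra_def)

lemma scalar_closed:
  assumes f: "f \<in> carrier (monoid_ring R)"
  shows "(\<lambda>i. f i \<odot>\<^bsub>M\<^esub> \<one>\<^bsub>M\<^esub>) \<in> carrier (monoid_ring M)"
proof -
  have "{i. f i \<odot>\<^bsub>M\<^esub> \<one>\<^bsub>M\<^esub> \<noteq> \<zero>\<^bsub>M\<^esub>} \<subseteq> {i. f i \<noteq> \<zero>}" by auto
  then have "finite {i. f i \<odot>\<^bsub>M\<^esub> \<one>\<^bsub>M\<^esub> \<noteq> \<zero>\<^bsub>M\<^esub>}"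
    by (rule finite_subset) (simp add: R.MR_finite[OF f])
  then show ?thesis using f by (simp add: MR_carrier R.MR_closed)
qed

lemma scalar_monomial:
  "c \<in> carrier R \<Longrightarrow> (\<lambda>i. monomial R c n i \<odot>\<^bsub>M\<^esub> \<one>\<^bsub>M\<^esub>) = monomial M (c \<odot>\<^bsub>M\<^esub> \<one>\<^bsub>M\<^esub>) n"
  by (auto simp: monomial_def fun_eq_iff)

lemma scalar_add:
  assumes "f \<in> carrier (monoid_ring R)" "g \<in> carrier (monoid_ring R)"
  shows "(\<lambda>i. (f \<oplus>\<^bsub>monoid_ring R\<^esub> g) i \<odot>\<^bsub>M\<^esub> \<one>\<^bsub>M\<^esub>) =
    (\<lambda>i. f i \<odot>\<^bsub>M\<^esub> \<one>\<^bsub>M\<^esub>) \<oplus>\<^bsub>monoid_ring M\<^esub> (\<lambda>i. g i \<odot>\<^bsub>M\<^esub> \<one>\<^bsub>M\<^esub>)"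
  using assms by (auto simp: fun_eq_iff R.MR_add MR_add R.MR_closed smult_l_distr)

lemma smult_one_mult:
  "c \<in> carrier R \<Longrightarrow> a \<in> carrier M \<Longrightarrow> (c \<odot>\<^bsub>M\<^esub> \<one>\<^bsub>M\<^esub>) \<otimes>\<^bsub>M\<^esub> a = c \<odot>\<^bsub>M\<^esub> a"
  by (simp add: smult_assoc2)

lemma scalar_mult:
  assumes f: "f \<in> carrier (monoid_ring R)" and g: "g \<in> carrier (monoid_ring R)"
  shows "(\<lambda>i. (f \<otimes>\<^bsub>monoid_ring R\<^esub> g) i \<odot>\<^bsub>M\<^esub> \<one>\<^bsub>M\<^esub>) =
    (\<lambda>i. f i \<odot>\<^bsub>M\<^esub> \<one>\<^bsub>M\<^esub>) \<otimes>\<^bsub>monoid_ring M\<^esub> (\<lambda>i. g i \<odot>\<^bsub>M\<^esub> \<one>\<^bsub>M\<^esub>)"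
  using f
proof (induction rule: R.MR_induct)
  case (monomial a i)
  show ?case using g
  proof (induction rule: R.MR_induct)
    case (monomial b j)
    then show ?case using \<open>a \<in> carrier R\<close>
      by (simp add: R.monomial_mult scalar_monomial monomial_mult smult_one_mult smult_assoc1)
  next
    case (add u v)
    then show ?case using monomial
      by (simp add: R.MR_mult_add_right scalar_add R.monomial_closed R.MR_mult_closed MR_mult_add_right scalar_closed)
  qed
next
  case (add u v)
  then show ?case using g
    by (simp add: R.MR_mult_add_left scalar_add R.MR_mult_closed MR_mult_add_left scalar_closed)
qed

lemma L_algebra: "algebra K L"
proof -
  interpret A: cring "monoid_ring M :: (int \<Rightarrow> 'c) ring" by (rule MR_cring)
  have Lc: "cring L"
  proof (rule cringI)
    show "abelian_group L"
      by (rule abelian_groupI) (auto simp: A.a_ac intro: A.add.l_inv_ex)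
    show "comm_monoid L"
      by (rule comm_monoidI) (auto simp: A.m_ac)
  qed (auto simp: A.l_distr)
  show ?thesis
  proof (rule algebraI)
    show "\<one>\<^bsub>K\<^esub> \<odot>\<^bsub>L\<^esub> x = x" if "x \<in> carrier L" for x
      using that by (simp add: L_smult R.MR_one scalar_monomial A.l_one[unfolded MR_one] MR_one[symmetric])
  qed (use Lc in \<open>auto simp: R.MR_cring L_smult scalar_closed scalar_add scalar_mult A.l_distr A.r_distr A.m_assoc\<close>)
qed

lemma L_smult_monomial:
  "c \<in> carrier R \<Longrightarrow> a \<in> carrier M \<Longrightarrow>
    monomial R c i \<odot>\<^bsub>L\<^esub> monomial M a j = monomial M (c \<odot>\<^bsub>M\<^esub> a) (i + j)"
  by (simp add: L_smult scalar_monomial monomial_mult smult_one_mult)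

end

lemma (in abelian_group) finsum_closed_under:
  assumes "finite I" "\<And>i. i \<in> I \<Longrightarrow> f i \<in> carrier G \<and> Q (f i)" "Q \<zero>"
    and "\<And>x y. x \<in> carrier G \<Longrightarrow> y \<in> carrier G \<Longrightarrow> Q x \<Longrightarrow> Q y \<Longrightarrow> Q (x \<oplus> y)"
  shows "Q (finsum G f I)"
  using assms(1,2)
proof (induction I rule: finite_induct)
  case empty
  then show ?case using assms(3) by simp
next
  case (insert i I)
  then show ?case
    by (subst finsum_insert) (auto intro!: assms(4) finsum_closed)
qed

section \<open>Polynomials in \<open>t\<close> inside Laurent polynomials in
  \<open>s\<close>\<close>

context cring
begin

interpretation UP: UP_cring R "UP R"
  by (simp add: UP_cring_def is_cring)

lemma UP_carrier:
  "p \<in> carrier (UP R) \<longleftrightarrow> (\<forall>n. p n \<in> carrier R) \<and> (\<exists>N. \<forall>n>N. p n = \<zero>)"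
  by (auto simp: UP_def up_def bound_def)

lemma UP_closed: "p \<in> carrier (UP R) \<Longrightarrow> p n \<in> carrier R"
  by (simp add: UP_carrier)

lemma UP_add: "p \<in> carrier (UP R) \<Longrightarrow> q \<in> carrier (UP R) \<Longrightarrow> (p \<oplus>\<^bsub>UP R\<^esub> q) n = p n \<oplus> q n"
  by (simp add: UP_def)

lemma UP_zero: "\<zero>\<^bsub>UP R\<^esub> = (\<lambda>n. \<zero>)"
  by (simp add: UP_def)

lemma UP_smult: "c \<in> carrier R \<Longrightarrow> p \<in> carrier (UP R) \<Longrightarrow> (c \<odot>\<^bsub>UP R\<^esub> p) n = c \<otimes> p n"
  by (simp add: UP_def)

lemma UP_monom: "c \<in> carrier R \<Longrightarrow> monom (UP R) c n = (\<lambda>i. if i = n then c else \<zero>)"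
  by (simp add: UP_def)

lemma UP_induct [consumes 1, case_names monom add]:
  assumes p: "p \<in> carrier (UP R)"
    and monom: "\<And>c n. c \<in> carrier R \<Longrightarrow> Q (monom (UP R) c n)"
    and add: "\<And>p q. p \<in> carrier (UP R) \<Longrightarrow> q \<in> carrier (UP R) \<Longrightarrow> Q p \<Longrightarrow> Q q \<Longrightarrow> Q (p \<oplus>\<^bsub>UP R\<^esub> q)"
  shows "Q p"
proof -
  have "Q (\<Oplus>\<^bsub>UP R\<^esub>i\<in>{..deg R p}. monom (UP R) (coeff (UP R) p i) i)"
    by (rule UP.P.finsum_closed_under) (use p monom[of "\<zero>" 0] in \<open>auto intro: add monom\<close>)
  then show ?thesis using UP.up_repr[OF p] by simp
qed

lemma poly_to_laurent_closed:
  assumes p: "p \<in> carrier (UP R)" shows "poly_to_laurent R p \<in> carrier (laurent_ring R)"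
proof -
  obtain N where N: "\<forall>n>N. p n = \<zero>" using p by (auto simp: UP_carrier)
  have "{i. poly_to_laurent R p i \<noteq> \<zero>} \<subseteq> {0..2 * int N}"
  proof
    fix i assume i: "i \<in> {i. poly_to_laurent R p i \<noteq> \<zero>}"
    then have "0 \<le> i" "even i" "p (nat i div 2) \<noteq> \<zero>"
      by (auto simp: poly_to_laurent_def split: if_splits)
    moreover have "nat i div 2 \<le> N" using N calculation(3) by (meson not_le)
    ultimately show "i \<in> {0..2 * int N}" by auto
  qed
  then have "finite {i. poly_to_laurent R p i \<noteq> \<zero>}" by (rule finite_subset) simp
  then show ?thesis using p by (auto simp: MR_carrier poly_to_laurent_def UP_closed)
qed

lemma poly_to_laurent_add:
  "p \<in> carrier (UP R) \<Longrightarrow> q \<in> carrier (UP R) \<Longrightarrow>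
    poly_to_laurent R (p \<oplus>\<^bsub>UP R\<^esub> q) = poly_to_laurent R p \<oplus>\<^bsub>laurent_ring R\<^esub> poly_to_laurent R q"
  by (auto simp: fun_eq_iff MR_add UP_add poly_to_laurent_def)

lemma poly_to_laurent_monom:
  assumes "c \<in> carrier R"
  shows "poly_to_laurent R (monom (UP R) c n) = monomial R c (2 * int n)"
proof
  fix i :: int
  have "(0 \<le> i \<and> even i \<and> nat i div 2 = n) \<longleftrightarrow> i = 2 * int n" by auto
  then show "poly_to_laurent R (monom (UP R) c n) i = monomial R c (2 * int n) i"
    using assms by (auto simp: poly_to_laurent_def UP_monom monomial_def)
qed

lemma UP_monom_mult_monom:
  "c \<in> carrier R \<Longrightarrow> d \<in> carrier R \<Longrightarrow>
    monom (UP R) c n \<otimes>\<^bsub>UP R\<^esub> monom (UP R) d m = monom (UP R) (c \<otimes> d) (n + m)"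
  by simp

lemma poly_to_laurent_mult:
  assumes p: "p \<in> carrier (UP R)" and q: "q \<in> carrier (UP R)"
  shows "poly_to_laurent R (p \<otimes>\<^bsub>UP R\<^esub> q) = poly_to_laurent R p \<otimes>\<^bsub>laurent_ring R\<^esub> poly_to_laurent R q"
  using p
proof (induction rule: UP_induct)
  case (monom c n)
  show ?case using q
  proof (induction rule: UP_induct)
    case (monom d m)
    then show ?case using \<open>c \<in> carrier R\<close>
      by (simp add: poly_to_laurent_monom monomial_mult UP_monom_mult_monom distrib_left del: UP.monom_mult)
  next
    case (add u v)
    then show ?case using monom
      by (simp add: UP.P.r_distr poly_to_laurent_add MR_mult_add_right poly_to_laurent_closed)
  qed
next
  case (add u v)
  then show ?case using q
    by (simp add: UP.P.l_distr poly_to_laurent_add MR_mult_add_left poly_to_laurent_closed)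
qed

lemma poly_to_laurent_even: "poly_to_laurent R p (2 * int n) = p n"
  by (simp add: poly_to_laurent_def nat_mult_distrib)

text \<open>Identities with values in \<open>k[t]\<close> can be checked in
  \<open>k[s^{+-1}]\<close>, where the shift by an odd power of \<open>s\<close> makes
  sense.\<close>

lemma poly_to_laurent_inj: "poly_to_laurent R p = poly_to_laurent R q \<Longrightarrow> p = q"
  by (metis ext poly_to_laurent_even)

lemma UP_cring: "cring (UP R)"
  by (rule UP.P.is_cring)

lemma UP_algebra: "algebra R (UP R)"
  by (rule UP.UP_algebra)

lemma monom_in_UP: "c \<in> carrier R \<Longrightarrow> monom (UP R) c n \<in> carrier (UP R)"
  by simp

lemma UP_smult_monom:
  "c \<in> carrier R \<Longrightarrow> d \<in> carrier R \<Longrightarrow> c \<odot>\<^bsub>UP R\<^esub> monom (UP R) d n = monom (UP R) (c \<otimes> d) n"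
  by (simp add: UP.monom_mult_smult)

lemma UP_mult_const:
  assumes "c \<in> carrier R" "p \<in> carrier (UP R)"
  shows "(monom (UP R) c 0 \<otimes>\<^bsub>UP R\<^esub> p) n = c \<otimes> p n"
  using assms by (simp add: UP.monom_mult_is_smult UP_smult)

end

section \<open>Lie algebras of derivations\<close>

text \<open>Much less than a Hopf algebra: no coalgebra law, and the comultiplication is an
  arbitrary map into the tensor square. The module of derivations and the bilinearity of the bracket
  already live here, and this is all that is established for the contraction algebra.\<close>

locale comult_algebra = algebra R A for R (structure) and A (structure) +
  fixes \<Delta> :: "'c \<Rightarrow> ('c, 'c) tensor" and \<epsilon> :: "'c \<Rightarrow> 'a"
  assumes comult_closed: "a \<in> carrier A \<Longrightarrow> \<Delta> a \<in> carrier (tensor_product R A A)"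
    and counit_closed: "a \<in> carrier A \<Longrightarrow> \<epsilon> a \<in> carrier R"
begin

abbreviation "\<g> \<equiv> lie_algebra_of R A \<Delta> \<epsilon>"
abbreviation "AA \<equiv> tensor_product R A A"
abbreviation "bilift D E \<equiv> tensor_lift R (\<lambda>x y. D x \<otimes> E y)"
abbreviation "linear_form D \<equiv> semilinear R A R (\<lambda>r. monoid.mult R r) D"

sublocale AA: tensor_algebras R A A by unfold_locales

lemma carrier_lie: "carrier \<g> = counit_derivations R A \<epsilon>"
  by (simp add: lie_algebra_of_def)

lemma lie_simps:
  "\<zero>\<^bsub>\<g>\<^esub> = (\<lambda>a\<in>carrier A. \<zero>)"
  "D \<oplus>\<^bsub>\<g>\<^esub> E = (\<lambda>a\<in>carrier A. D a \<oplus> E a)"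
  "r \<odot>\<^bsub>\<g>\<^esub> D = (\<lambda>a\<in>carrier A. r \<otimes> D a)"
  "bracket \<g> D E = (\<lambda>a\<in>carrier A. bilift D E (\<Delta> a) \<ominus> bilift E D (\<Delta> a))"
  by (simp_all add: lie_algebra_of_def)

lemma derivationI:
  assumes "\<And>a. a \<in> carrier A \<Longrightarrow> D a \<in> carrier R"
    and "\<And>a. a \<notin> carrier A \<Longrightarrow> D a = undefined"
    and "\<And>a b. a \<in> carrier A \<Longrightarrow> b \<in> carrier A \<Longrightarrow> D (a \<oplus>\<^bsub>A\<^esub> b) = D a \<oplus> D b"
    and "\<And>r a. r \<in> carrier R \<Longrightarrow> a \<in> carrier A \<Longrightarrow> D (r \<odot>\<^bsub>A\<^esub> a) = r \<otimes> D a"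
    and "\<And>a b. a \<in> carrier A \<Longrightarrow> b \<in> carrier A \<Longrightarrow>
      D (a \<otimes>\<^bsub>A\<^esub> b) = \<epsilon> a \<otimes> D b \<oplus> D a \<otimes> \<epsilon> b"
  shows "D \<in> carrier \<g>"
  using assms by (auto simp: carrier_lie counit_derivations_def PiE_def extensional_def)

context
  fixes D assumes D: "D \<in> carrier \<g>"
begin

lemma der_closed: "a \<in> carrier A \<Longrightarrow> D a \<in> carrier R"
  using D by (auto simp: carrier_lie counit_derivations_def)

lemma der_undefined: "a \<notin> carrier A \<Longrightarrow> D a = undefined"
  using D by (auto simp: carrier_lie counit_derivations_def PiE_def extensional_def)

lemma der_add: "a \<in> carrier A \<Longrightarrow> b \<in> carrier A \<Longrightarrow> D (a \<oplus>\<^bsub>A\<^esub> b) = D a \<oplus> D b"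
  using D by (auto simp: carrier_lie counit_derivations_def)

lemma der_smult: "r \<in> carrier R \<Longrightarrow> a \<in> carrier A \<Longrightarrow> D (r \<odot>\<^bsub>A\<^esub> a) = r \<otimes> D a"
  using D by (auto simp: carrier_lie counit_derivations_def)

lemma der_mult: "a \<in> carrier A \<Longrightarrow> b \<in> carrier A \<Longrightarrow>
    D (a \<otimes>\<^bsub>A\<^esub> b) = \<epsilon> a \<otimes> D b \<oplus> D a \<otimes> \<epsilon> b"
  using D by (auto simp: carrier_lie counit_derivations_def)

lemma der_linear_form: "linear_form D"
  by (rule semilinearI) (simp_all add: der_closed der_add der_smult)

lemma der_zero: "D \<zero>\<^bsub>A\<^esub> = \<zero>"
  using der_smult[of "\<zero>" "\<zero>\<^bsub>A\<^esub>"] by (simp add: der_closed)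

lemma der_minus: "a \<in> carrier A \<Longrightarrow> D (\<ominus>\<^bsub>A\<^esub> a) = \<ominus> D a"
  using der_add[of "\<ominus>\<^bsub>A\<^esub> a" a]
  by (intro R.minus_equality[symmetric]) (simp_all add: der_closed der_zero M.l_neg)

end

lemma der_eqI:
  assumes "D \<in> carrier \<g>" "E \<in> carrier \<g>" "\<And>a. a \<in> carrier A \<Longrightarrow> D a = E a"
  shows "D = E"
  using assms der_undefined by (metis ext)

lemma lie_module: "module R \<g>"
proof (rule moduleI)
  show "cring R" by (rule R_cring)
  have add: "D \<oplus>\<^bsub>\<g>\<^esub> E \<in> carrier \<g>" if "D \<in> carrier \<g>" "E \<in> carrier \<g>" for D E
    by (rule derivationI)
      (use that in \<open>simp_all add: lie_simps der_closed der_add der_smult der_mult R.r_distr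
        R.l_distr counit_closed R.add.m_ac\<close>)
  show smult: "r \<odot>\<^bsub>\<g>\<^esub> D \<in> carrier \<g>" if "r \<in> carrier R" "D \<in> carrier \<g>" for r D
    by (rule derivationI)
      (use that in \<open>simp_all add: lie_simps der_closed der_add der_smult der_mult R.r_distr
        counit_closed R.m_ac\<close>)
  have zero: "\<zero>\<^bsub>\<g>\<^esub> \<in> carrier \<g>"
    by (rule derivationI) (simp_all add: lie_simps counit_closed)
  show "abelian_group \<g>"
  proof (rule abelian_groupI)
    fix D assume D: "D \<in> carrier \<g>"
    show "\<exists>E\<in>carrier \<g>. E \<oplus>\<^bsub>\<g>\<^esub> D = \<zero>\<^bsub>\<g>\<^esub>"
    proof
      \<comment> \<open>The inverse is given as a scalar multiple, because the group structure of
        \<open>\<g>\<close> is still being established.\<close>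
      show "\<ominus> \<one> \<odot>\<^bsub>\<g>\<^esub> D \<in> carrier \<g>" by (rule smult) (simp_all add: D)
      show "\<ominus> \<one> \<odot>\<^bsub>\<g>\<^esub> D \<oplus>\<^bsub>\<g>\<^esub> D = \<zero>\<^bsub>\<g>\<^esub>"
        using D by (auto simp: lie_simps fun_eq_iff der_closed R.l_minus R.l_neg)
    qed
    show "\<zero>\<^bsub>\<g>\<^esub> \<oplus>\<^bsub>\<g>\<^esub> D = D"
      using D by (auto simp: lie_simps fun_eq_iff der_closed der_undefined)
  qed (use add zero in \<open>auto simp: lie_simps fun_eq_iff der_closed R.add.m_ac\<close>)
  show "\<one> \<odot>\<^bsub>\<g>\<^esub> D = D" if "D \<in> carrier \<g>" for D
    using that by (auto simp: lie_simps fun_eq_iff der_closed der_undefined)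
qed (auto simp: lie_simps fun_eq_iff der_closed R.l_distr R.r_distr R.m_assoc)

sublocale G: module R \<g> by (rule lie_module)

text \<open>The group inverse in \<open>\<g>\<close> is an abstract one; uniqueness of inverses in
  \<open>R\<close> makes it pointwise.\<close>

lemma lie_minus_apply:
  assumes D: "D \<in> carrier \<g>" and a: "a \<in> carrier A"
  shows "(\<ominus>\<^bsub>\<g>\<^esub> D) a = \<ominus> D a"
proof -
  have "(\<ominus>\<^bsub>\<g>\<^esub> D) a \<oplus> D a = (\<ominus>\<^bsub>\<g>\<^esub> D \<oplus>\<^bsub>\<g>\<^esub> D) a"
    using a by (simp add: lie_simps)
  also have "\<dots> = \<zero>" using D a by (simp add: G.l_neg) (simp add: lie_simps)
  finally show ?thesis
    using D a by (intro R.minus_equality[symmetric]) (simp_all add: der_closed)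
qed

section \<open>The forms \<open>D \<otimes> E\<close> on the tensor square, and bilinearity of the
  bracket\<close>

context
  fixes D E assumes D: "linear_form D" and E: "linear_form E"
begin

lemma bilift_balanced: "balanced_map R A A R (\<lambda>x y. D x \<otimes> E y)"
  by (rule AA.balanced_mult_semilinear[of R "\<lambda>x. x", OF R_cring _ D E]) simp

lemmas bilift_pure = AA.lift_pure[OF R.is_abelian_group bilift_balanced]
lemmas bilift_add = AA.lift_add[OF R.is_abelian_group bilift_balanced]
lemmas bilift_closed = AA.lift_closed[OF R.is_abelian_group bilift_balanced]
lemma bilift_smult:
  assumes "r \<in> carrier R" "X \<in> carrier AA"
  shows "bilift D E (r \<odot>\<^bsub>AA\<^esub> X) = r \<otimes> bilift D E X"
proof -
  have "semilinear R AA R (\<lambda>r. monoid.mult R r) (bilift D E)"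
    by (rule AA.semilinear_tensor_lift[OF R.is_abelian_group bilift_balanced])
      (simp_all add: semilinearD[OF D] semilinearD[OF E] R.m_assoc R.r_distr)
  then show ?thesis using assms by (simp add: semilinearD)
qed

end

lemma bilift_add_left:
  assumes D: "D \<in> carrier \<g>" "D' \<in> carrier \<g>" and E: "linear_form E" and X: "X \<in> carrier AA"
  shows "bilift (D \<oplus>\<^bsub>\<g>\<^esub> D') E X = bilift D E X \<oplus> bilift D' E X"
proof -
  note l = der_linear_form[OF D(1)] der_linear_form[OF D(2)] der_linear_form[OF G.add.m_closed[OF D]]
  show ?thesis using X
  proof (induction rule: AA.tensor_induct)
    case (pure m n)
    then show ?case using D semilinearD(1)[OF E]
      by (simp add: bilift_pure l E) (simp add: lie_simps der_closed R.l_distr)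
  next
    case (add X Y)
    then show ?case by (simp add: bilift_add bilift_closed l E R.add.m_ac)
  qed
qed

lemma bilift_smult_left:
  assumes r: "r \<in> carrier R" and D: "D \<in> carrier \<g>" and E: "linear_form E" and X: "X \<in> carrier AA"
  shows "bilift (r \<odot>\<^bsub>\<g>\<^esub> D) E X = r \<otimes> bilift D E X"
proof -
  note l = der_linear_form[OF D] der_linear_form[OF G.smult_closed[OF r D]]
  show ?thesis using X
  proof (induction rule: AA.tensor_induct)
    case (pure m n)
    then show ?case using D r semilinearD(1)[OF E]
      by (simp add: bilift_pure l E) (simp add: lie_simps der_closed R.m_assoc)
  next
    case (add X Y)
    then show ?case using r by (simp add: bilift_add bilift_closed l E R.r_distr)
  qed
qed

lemma bilift_add_right:
  assumes D: "D \<in> carrier \<g>" "D' \<in> carrier \<g>" and E: "linear_form E" and X: "X \<in> carrier AA"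
  shows "bilift E (D \<oplus>\<^bsub>\<g>\<^esub> D') X = bilift E D X \<oplus> bilift E D' X"
proof -
  note l = der_linear_form[OF D(1)] der_linear_form[OF D(2)] der_linear_form[OF G.add.m_closed[OF D]]
  show ?thesis using X
  proof (induction rule: AA.tensor_induct)
    case (pure m n)
    then show ?case using D semilinearD(1)[OF E]
      by (simp add: bilift_pure l E) (simp add: lie_simps der_closed R.r_distr)
  next
    case (add X Y)
    then show ?case by (simp add: bilift_add bilift_closed l E R.add.m_ac)
  qed
qed

lemma bilift_smult_right:
  assumes r: "r \<in> carrier R" and D: "D \<in> carrier \<g>" and E: "linear_form E" and X: "X \<in> carrier AA"
  shows "bilift E (r \<odot>\<^bsub>\<g>\<^esub> D) X = r \<otimes> bilift E D X"
proof -
  note l = der_linear_form[OF D] der_linear_form[OF G.smult_closed[OF r D]]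
  show ?thesis using X
  proof (induction rule: AA.tensor_induct)
    case (pure m n)
    then show ?case using D r semilinearD(1)[OF E]
      by (simp add: bilift_pure l E) (simp add: lie_simps der_closed R.m_lcomm)
  next
    case (add X Y)
    then show ?case using r by (simp add: bilift_add bilift_closed l E R.r_distr)
  qed
qed

lemma bracket_add_left:
  assumes "D \<in> carrier \<g>" "D' \<in> carrier \<g>" "E \<in> carrier \<g>"
  shows "bracket \<g> (D \<oplus>\<^bsub>\<g>\<^esub> D') E = bracket \<g> D E \<oplus>\<^bsub>\<g>\<^esub> bracket \<g> D' E"
proof
  fix a
  show "bracket \<g> (D \<oplus>\<^bsub>\<g>\<^esub> D') E a = (bracket \<g> D E \<oplus>\<^bsub>\<g>\<^esub> bracket \<g> D' E) a"
  proof (cases "a \<in> carrier A")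
    case True
    note c = comult_closed[OF True]
    have "bracket \<g> (D \<oplus>\<^bsub>\<g>\<^esub> D') E a =
      bilift D E (\<Delta> a) \<oplus> bilift D' E (\<Delta> a) \<ominus> (bilift E D (\<Delta> a) \<oplus> bilift E D' (\<Delta> a))"
      using assms c True
      by (simp add: lie_simps(4) bilift_add_left bilift_add_right der_linear_form)
    also have "\<dots> = (bracket \<g> D E \<oplus>\<^bsub>\<g>\<^esub> bracket \<g> D' E) a"
      using assms c True
      by (simp add: lie_simps(2,4) bilift_closed der_linear_form a_minus_def R.minus_add R.add.m_ac)
    finally show ?thesis .
  qed (simp add: lie_simps(2,4))
qed

lemma bracket_smult_left:
  assumes "r \<in> carrier R" "D \<in> carrier \<g>" "E \<in> carrier \<g>"
  shows "bracket \<g> (r \<odot>\<^bsub>\<g>\<^esub> D) E = r \<odot>\<^bsub>\<g>\<^esub> bracket \<g> D E"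
proof
  fix a
  show "bracket \<g> (r \<odot>\<^bsub>\<g>\<^esub> D) E a = (r \<odot>\<^bsub>\<g>\<^esub> bracket \<g> D E) a"
  proof (cases "a \<in> carrier A")
    case True
    note c = comult_closed[OF True]
    have "bracket \<g> (r \<odot>\<^bsub>\<g>\<^esub> D) E a = r \<otimes> bilift D E (\<Delta> a) \<ominus> r \<otimes> bilift E D (\<Delta> a)"
      using assms c True
      by (simp add: lie_simps(4) bilift_smult_left bilift_smult_right der_linear_form)
    also have "\<dots> = (r \<odot>\<^bsub>\<g>\<^esub> bracket \<g> D E) a"
      using assms c True
      by (simp add: lie_simps(3,4) bilift_closed der_linear_form a_minus_def R.r_distr R.r_minus)
    finally show ?thesis .
  qed (simp add: lie_simps(3,4))
qed

lemma bracket_add_right: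
  assumes "D \<in> carrier \<g>" "D' \<in> carrier \<g>" "E \<in> carrier \<g>"
  shows "bracket \<g> E (D \<oplus>\<^bsub>\<g>\<^esub> D') = bracket \<g> E D \<oplus>\<^bsub>\<g>\<^esub> bracket \<g> E D'"
proof
  fix a
  show "bracket \<g> E (D \<oplus>\<^bsub>\<g>\<^esub> D') a = (bracket \<g> E D \<oplus>\<^bsub>\<g>\<^esub> bracket \<g> E D') a"
  proof (cases "a \<in> carrier A")
    case True
    note c = comult_closed[OF True]
    have "bracket \<g> E (D \<oplus>\<^bsub>\<g>\<^esub> D') a =
      bilift E D (\<Delta> a) \<oplus> bilift E D' (\<Delta> a) \<ominus> (bilift D E (\<Delta> a) \<oplus> bilift D' E (\<Delta> a))"
      using assms c True
      by (simp add: lie_simps(4) bilift_add_left bilift_add_right der_linear_form)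
    also have "\<dots> = (bracket \<g> E D \<oplus>\<^bsub>\<g>\<^esub> bracket \<g> E D') a"
      using assms c True
      by (simp add: lie_simps(2,4) bilift_closed der_linear_form a_minus_def R.minus_add R.add.m_ac)
    finally show ?thesis .
  qed (simp add: lie_simps(2,4))
qed

lemma bracket_smult_right:
  assumes "r \<in> carrier R" "D \<in> carrier \<g>" "E \<in> carrier \<g>"
  shows "bracket \<g> E (r \<odot>\<^bsub>\<g>\<^esub> D) = r \<odot>\<^bsub>\<g>\<^esub> bracket \<g> E D"
proof
  fix a
  show "bracket \<g> E (r \<odot>\<^bsub>\<g>\<^esub> D) a = (r \<odot>\<^bsub>\<g>\<^esub> bracket \<g> E D) a"
  proof (cases "a \<in> carrier A")
    case True
    note c = comult_closed[OF True]
    have "bracket \<g> E (r \<odot>\<^bsub>\<g>\<^esub> D) a = r \<otimes> bilift E D (\<Delta> a) \<ominus> r \<otimes> bilift D E (\<Delta> a)"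
      using assms c True
      by (simp add: lie_simps(4) bilift_smult_left bilift_smult_right der_linear_form)
    also have "\<dots> = (r \<odot>\<^bsub>\<g>\<^esub> bracket \<g> E D) a"
      using assms c True
      by (simp add: lie_simps(3,4) bilift_closed der_linear_form a_minus_def R.r_distr R.r_minus)
    finally show ?thesis .
  qed (simp add: lie_simps(3,4))
qed

text \<open>Over a bare \<open>comult_algebra\<close> nothing makes the bracket of two derivations a
  derivation. The last premise ensures that the inverse on the right is taken inside the
  group.\<close>

lemma bracket_swap:
  assumes "D \<in> carrier \<g>" "E \<in> carrier \<g>" "bracket \<g> E D \<in> carrier \<g>"
  shows "bracket \<g> D E = \<ominus>\<^bsub>\<g>\<^esub> bracket \<g> E D"
proof
  fix a
  show "bracket \<g> D E a = (\<ominus>\<^bsub>\<g>\<^esub> bracket \<g> E D) a"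
  proof (cases "a \<in> carrier A")
    case True
    then show ?thesis using assms comult_closed[OF True]
      by (simp add: lie_minus_apply)
        (simp add: lie_simps(4) bilift_closed der_linear_form a_minus_def R.minus_add R.add.m_ac)
  next
    case False
    then show ?thesis using assms by (simp add: der_undefined) (simp add: lie_simps(4))
  qed
qed

end

sublocale hopf_algebra \<subseteq> comult_algebra R A \<Delta> \<epsilon>
  using comult_hom counit_hom by unfold_locales (auto simp: ring_hom_def)

section \<open>Closure of the Lie algebra of a Hopf algebra under the bracket\<close>

context hopf_algebra
begin

lemma comult_mult: "a \<in> carrier A \<Longrightarrow> b \<in> carrier A \<Longrightarrow> \<Delta> (a \<otimes>\<^bsub>A\<^esub> b) = \<Delta> a \<otimes>\<^bsub>AA\<^esub> \<Delta> b"
  using comult_hom by (auto simp: ring_hom_def)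

lemma comult_add: "a \<in> carrier A \<Longrightarrow> b \<in> carrier A \<Longrightarrow> \<Delta> (a \<oplus>\<^bsub>A\<^esub> b) = \<Delta> a \<oplus>\<^bsub>AA\<^esub> \<Delta> b"
  using comult_hom by (auto simp: ring_hom_def)

lemma comult_smult: "r \<in> carrier R \<Longrightarrow> a \<in> carrier A \<Longrightarrow> \<Delta> (r \<odot>\<^bsub>A\<^esub> a) = r \<odot>\<^bsub>AA\<^esub> \<Delta> a"
  using comult_linear by (auto simp: module_homs_def)

lemma counit_linear_form: "linear_form \<epsilon>"
  using counit_hom by (intro semilinearI) (auto simp: ring_hom_def counit_linear)

lemma counit_mult: "a \<in> carrier A \<Longrightarrow> b \<in> carrier A \<Longrightarrow> \<epsilon> (a \<otimes>\<^bsub>A\<^esub> b) = \<epsilon> a \<otimes> \<epsilon> b"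
  using counit_hom by (auto simp: ring_hom_def)

lemma balanced_counit_left: "balanced_map R A A A (\<lambda>x y. \<epsilon> x \<odot>\<^bsub>A\<^esub> y)"
  by (simp add: balanced_map_def semilinearD[OF counit_linear_form] counit_closed smult_l_distr
      smult_r_distr smult_assoc1[symmetric] R.m_comm)

lemma balanced_counit_right: "balanced_map R A A A (\<lambda>x y. \<epsilon> y \<odot>\<^bsub>A\<^esub> x)"
  by (simp add: balanced_map_def semilinearD[OF counit_linear_form] counit_closed smult_l_distr
      smult_r_distr smult_assoc1[symmetric] R.m_comm)

text \<open>This is the counit law with \<open>f\<close> applied to it: linearity of
  \<open>f\<close> pulls the scalar \<open>\<epsilon> x\<close> inside.\<close>

lemma bilift_counit_left:
  assumes f: "linear_form f" and a: "a \<in> carrier A"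
  shows "bilift \<epsilon> f (\<Delta> a) = f a"
proof -
  have "bilift \<epsilon> f X = f (tensor_lift A (\<lambda>x y. \<epsilon> x \<odot>\<^bsub>A\<^esub> y) X)" if "X \<in> carrier AA" for X
    using that
  proof (induction rule: AA.tensor_induct)
    case (pure m n)
    then show ?case
      by (simp add: bilift_pure[OF counit_linear_form f] AA.lift_pure[OF M.abelian_group_axioms balanced_counit_left]
          semilinearD[OF f] counit_closed)
  next
    case (add X Y)
    then show ?case
      by (simp add: bilift_add[OF counit_linear_form f] AA.lift_add[OF M.abelian_group_axioms balanced_counit_left]
          AA.lift_closed[OF M.abelian_group_axioms balanced_counit_left] semilinearD[OF f])
  qed
  then show ?thesis using a by (simp add: counit_left comult_closed)
qed

lemma bilift_counit_right:
  assumes f: "linear_form f" and a: "a \<in> carrier A"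
  shows "bilift f \<epsilon> (\<Delta> a) = f a"
proof -
  have "bilift f \<epsilon> X = f (tensor_lift A (\<lambda>x y. \<epsilon> y \<odot>\<^bsub>A\<^esub> x) X)" if "X \<in> carrier AA" for X
    using that
  proof (induction rule: AA.tensor_induct)
    case (pure m n)
    then show ?case
      by (simp add: bilift_pure[OF f counit_linear_form] AA.lift_pure[OF M.abelian_group_axioms balanced_counit_right]
          semilinearD[OF f] counit_closed R.m_comm)
  next
    case (add X Y)
    then show ?case
      by (simp add: bilift_add[OF f counit_linear_form] AA.lift_add[OF M.abelian_group_axioms balanced_counit_right]
          AA.lift_closed[OF M.abelian_group_axioms balanced_counit_right] semilinearD[OF f])
  qed
  then show ?thesis using a by (simp add: counit_right comult_closed)
qed

text \<open>On pure tensors the value is a product of two Leibniz expansions, one for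
  \<open>x\<close> and one for \<open>y\<close>, which gives the four terms. Both sides are additive
  in \<open>X\<close> and in \<open>Y\<close>.\<close>

lemma bilift_mult:
  assumes x: "x \<in> carrier \<g>" and y: "y \<in> carrier \<g>" and X: "X \<in> carrier AA" and Y: "Y \<in> carrier AA"
  shows "bilift x y (X \<otimes>\<^bsub>AA\<^esub> Y) =
    (bilift \<epsilon> \<epsilon> X \<otimes> bilift x y Y \<oplus> bilift \<epsilon> y X \<otimes> bilift x \<epsilon> Y) \<oplus>
    (bilift x \<epsilon> X \<otimes> bilift \<epsilon> y Y \<oplus> bilift x y X \<otimes> bilift \<epsilon> \<epsilon> Y)"
proof -
  note l = der_linear_form[OF x] der_linear_form[OF y] counit_linear_form
  note s = bilift_pure bilift_add bilift_closed l
  show ?thesis using X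
  proof (induction rule: AA.tensor_induct)
    case (pure m n)
    note mn = pure
    show ?case using Y
    proof (induction rule: AA.tensor_induct)
      case (pure m' n')
      then show ?case using mn
        by (simp add: AA.mult_pure s der_mult[OF x] der_mult[OF y] der_closed[OF x] der_closed[OF y]
            counit_closed R.l_distr R.r_distr R.m_ac R.add.m_ac)
    next
      case (add Y Y')
      then show ?case using mn
        by (simp add: AA.mult_add_right AA.mult_closed s der_closed[OF x] der_closed[OF y]
            counit_closed R.r_distr R.l_distr R.add.m_ac)
    qed
  next
    case (add X X')
    then show ?case using Y
      by (simp add: AA.mult_add_left AA.mult_closed s R.r_distr R.l_distr R.add.m_ac)
  qed
qed

lemma bracket_closed:
  assumes x: "x \<in> carrier \<g>" and y: "y \<in> carrier \<g>"
  shows "bracket \<g> x y \<in> carrier \<g>"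
proof (rule derivationI)
  note l = der_linear_form[OF x] der_linear_form[OF y] counit_linear_form
  note s = bilift_add bilift_closed bilift_smult l comult_closed
  show "bracket \<g> x y a \<in> carrier R" if "a \<in> carrier A" for a
    using that by (simp add: lie_simps s)
  show "bracket \<g> x y a = undefined" if "a \<notin> carrier A" for a
    using that by (simp add: lie_simps)
  show "bracket \<g> x y (a \<oplus>\<^bsub>A\<^esub> b) = bracket \<g> x y a \<oplus> bracket \<g> x y b"
    if "a \<in> carrier A" "b \<in> carrier A" for a b
    using that by (simp add: lie_simps s comult_add a_minus_def R.minus_add R.add.m_ac)
  show "bracket \<g> x y (r \<odot>\<^bsub>A\<^esub> a) = r \<otimes> bracket \<g> x y a"
    if "r \<in> carrier R" "a \<in> carrier A" for r a
    using that by (simp add: lie_simps s comult_smult a_minus_def R.r_distr R.r_minus)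
  show "bracket \<g> x y (a \<otimes>\<^bsub>A\<^esub> b) = \<epsilon> a \<otimes> bracket \<g> x y b \<oplus> bracket \<g> x y a \<otimes> \<epsilon> b"
    if ab: "a \<in> carrier A" "b \<in> carrier A" for a b
  proof -
    note c = der_closed[OF x] der_closed[OF y] counit_closed
    \<comment> \<open>The counit laws collapse the factors with an \<open>\<epsilon>\<close> in one
      slot to plain values of \<open>u\<close> and \<open>v\<close>.\<close>
    have e: "bilift u v (\<Delta> (a \<otimes>\<^bsub>A\<^esub> b)) =
      (\<epsilon> a \<otimes> bilift u v (\<Delta> b) \<oplus> v a \<otimes> u b) \<oplus> (u a \<otimes> v b \<oplus> bilift u v (\<Delta> a) \<otimes> \<epsilon> b)"
      if "u \<in> carrier \<g>" "v \<in> carrier \<g>" for u v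
      using that ab
      by (simp add: comult_mult bilift_mult comult_closed bilift_counit_left bilift_counit_right
          der_linear_form counit_linear_form)
    have cl: "bilift x y (\<Delta> a) \<in> carrier R" "bilift y x (\<Delta> a) \<in> carrier R"
      "bilift x y (\<Delta> b) \<in> carrier R" "bilift y x (\<Delta> b) \<in> carrier R"
      using ab by (simp_all add: s)
    \<comment> \<open>Exchanging the two derivations exchanges the mixed terms \<open>q\<close> and
      \<open>q'\<close>, so these cancel in the commutator and only the Leibniz terms
      remain.\<close>
    have cancel: "((p \<oplus> q) \<oplus> (q' \<oplus> w)) \<ominus> ((p' \<oplus> q') \<oplus> (q \<oplus> w'))
       = (p \<ominus> p') \<oplus> (w \<ominus> w')"
      if "p \<in> carrier R" "q \<in> carrier R" "q' \<in> carrier R" "w \<in> carrier R" "p' \<in> carrier R" "w' \<in> carrier R"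
      for p q q' w p' w'
    proof -
      have "(p \<oplus> q) \<oplus> (q' \<oplus> w) = (p \<oplus> w) \<oplus> (q \<oplus> q')"
        "(p' \<oplus> q') \<oplus> (q \<oplus> w') = (p' \<oplus> w') \<oplus> (q \<oplus> q')"
        using that by (simp_all add: R.add.m_ac)
      moreover have "(u \<oplus> z) \<ominus> (v \<oplus> z) = u \<ominus> v"
        if "u \<in> carrier R" "v \<in> carrier R" "z \<in> carrier R" for u v z
      proof -
        have "(u \<oplus> z) \<ominus> (v \<oplus> z) = u \<oplus> (\<ominus> v \<oplus> (z \<oplus> \<ominus> z))"
          using that by (simp add: a_minus_def R.minus_add R.add.m_ac del: R.r_neg)
        then show ?thesis using that by (simp add: a_minus_def R.r_neg)
      qed
      ultimately have "((p \<oplus> q) \<oplus> (q' \<oplus> w)) \<ominus> ((p' \<oplus> q') \<oplus> (q \<oplus> w'))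
        = (p \<oplus> w) \<ominus> (p' \<oplus> w')" using that by simp
      then show ?thesis using that by (simp add: a_minus_def R.minus_add R.add.m_ac)
    qed
    have "bracket \<g> x y (a \<otimes>\<^bsub>A\<^esub> b) =
      (\<epsilon> a \<otimes> bilift x y (\<Delta> b) \<ominus> \<epsilon> a \<otimes> bilift y x (\<Delta> b)) \<oplus>
      (bilift x y (\<Delta> a) \<otimes> \<epsilon> b \<ominus> bilift y x (\<Delta> a) \<otimes> \<epsilon> b)"
      using ab x y cl by (simp add: lie_simps(4) e R.m_comm[of "x b" "y a"] R.m_comm[of "y b" "x a"] c cancel)
    then show ?thesis using ab cl
      by (simp add: lie_simps(4) a_minus_def R.r_distr R.l_distr R.r_minus R.l_minus c)
  qed
qed

end

section \<open>The grading of the contraction algebra\<close>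

lemma semilinear_zero:
  assumes "semilinear R M N act f" "abelian_group M" "abelian_group N"
  shows "f \<zero>\<^bsub>M\<^esub> = \<zero>\<^bsub>N\<^esub>"
proof -
  interpret M: abelian_group M by fact
  interpret N: abelian_group N by fact
  have "f \<zero>\<^bsub>M\<^esub> \<oplus>\<^bsub>N\<^esub> f \<zero>\<^bsub>M\<^esub> = f \<zero>\<^bsub>M\<^esub>"
    using semilinearD(2)[OF assms(1), of "\<zero>\<^bsub>M\<^esub>" "\<zero>\<^bsub>M\<^esub>"] by simp
  then show ?thesis
    using semilinearD(1)[OF assms(1) M.zero_closed] by (simp add: N.add.l_cancel_one')
qed

context comult_algebra
begin

text \<open>The linear extension of \<open>x\<close> to Laurent polynomials, multiplied by \<open>s\<^sup>p\<close>.\<close>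

definition hat :: "int \<Rightarrow> ('c \<Rightarrow> 'a) \<Rightarrow> (int \<Rightarrow> 'c) \<Rightarrow> int \<Rightarrow> 'a" where
  "hat p x u = (\<lambda>i. x (u (i - p)))"

lemma linear_form_zero: "linear_form x \<Longrightarrow> x \<zero>\<^bsub>A\<^esub> = \<zero>"
  by (rule semilinear_zero[OF _ M.abelian_group_axioms R.abelian_group_axioms])

context
  fixes x assumes x: "linear_form x"
begin

lemma hat_closed:
  assumes u: "u \<in> carrier L" shows "hat p x u \<in> carrier K"
proof -
  have "{i. x (u (i - p)) \<noteq> \<zero>} \<subseteq> (\<lambda>i. i + p) ` {i. u i \<noteq> \<zero>\<^bsub>A\<^esub>}"
  proof
    fix i assume "i \<in> {i. x (u (i - p)) \<noteq> \<zero>}"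
    then have "u (i - p) \<noteq> \<zero>\<^bsub>A\<^esub>" using linear_form_zero[OF x] by auto
    then have "i - p \<in> {i. u i \<noteq> \<zero>\<^bsub>A\<^esub>}" by simp
    then have "i - p + p \<in> (\<lambda>i. i + p) ` {i. u i \<noteq> \<zero>\<^bsub>A\<^esub>}" by (rule imageI)
    then show "i \<in> (\<lambda>i. i + p) ` {i. u i \<noteq> \<zero>\<^bsub>A\<^esub>}" by simp
  qed
  then have "finite {i. x (u (i - p)) \<noteq> \<zero>}"
    by (rule finite_subset) (use u in \<open>simp add: MR_finite\<close>)
  then show ?thesis using u by (simp add: R.MR_carrier hat_def MR_closed semilinearD[OF x])
qed

lemma hat_monomial:
  "a \<in> carrier A \<Longrightarrow> hat p x (monomial A a i) = monomial R (x a) (i + p)"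
  by (auto simp: hat_def monomial_def fun_eq_iff linear_form_zero[OF x])

lemma hat_add:
  "u \<in> carrier L \<Longrightarrow> v \<in> carrier L \<Longrightarrow> hat p x (u \<oplus>\<^bsub>L\<^esub> v) = hat p x u \<oplus>\<^bsub>K\<^esub> hat p x v"
  by (auto simp: hat_def fun_eq_iff MR_add R.MR_add MR_closed semilinearD[OF x])

lemma hat_smult:
  assumes f: "f \<in> carrier K" and u: "u \<in> carrier L"
  shows "hat p x (f \<odot>\<^bsub>L\<^esub> u) = f \<otimes>\<^bsub>K\<^esub> hat p x u"
proof -
  interpret K: cring K by (rule R.MR_cring)
  interpret L: algebra K L by (rule L_algebra)
  show ?thesis using f
  proof (induction rule: R.MR_induct)
    case (monomial c i)
    show ?case using u[simplified]
    proof (induction rule: MR_induct)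
      case (monomial a j)
      then show ?case using \<open>c \<in> carrier R\<close>
        by (simp add: L_smult_monomial hat_monomial semilinearD[OF x] R.monomial_mult add.assoc)
    next
      case (add u v)
      then show ?case using monomial L.smult_r_distr[of "monomial R c i" u v]
        L.smult_closed[of "monomial R c i" u] L.smult_closed[of "monomial R c i" v]
        hat_add[of u v] hat_add[of "monomial R c i \<odot>\<^bsub>L\<^esub> u" "monomial R c i \<odot>\<^bsub>L\<^esub> v"]
        hat_closed[of u] hat_closed[of v]
        by (simp add: R.monomial_closed K.r_distr)
    qed
  next
    case (add f g)
    then show ?case using u L.smult_l_distr[of f g u] L.smult_closed[of f u] L.smult_closed[of g u]
        hat_add[of "f \<odot>\<^bsub>L\<^esub> u" "g \<odot>\<^bsub>L\<^esub> u"] hat_closed[of u]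
      by (simp add: K.l_distr)
  qed
qed

lemma hat_semilinear: "semilinear K L K (\<lambda>f. monoid.mult K f) (hat p x)"
  by (rule semilinearI) (simp_all only: hat_closed hat_add hat_smult)

end

text \<open>In each summand exactly one factor carries the shift \<open>p\<close>, so the degrees
  agree and the claim on monomials is the Leibniz rule for \<open>x\<close>.\<close>

lemma hat_mult:
  assumes e: "linear_form \<epsilon>" and x: "x \<in> carrier \<g>" and u: "u \<in> carrier L" and v: "v \<in> carrier L"
  shows "hat p x (u \<otimes>\<^bsub>L\<^esub> v) = hat 0 \<epsilon> u \<otimes>\<^bsub>K\<^esub> hat p x v \<oplus>\<^bsub>K\<^esub> hat p x u \<otimes>\<^bsub>K\<^esub> hat 0 \<epsilon> v"
proof -
  interpret K: cring K by (rule R.MR_cring)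
  interpret L: algebra K L by (rule L_algebra)
  note lx = der_linear_form[OF x]
  note cl = hat_closed[OF lx] hat_closed[OF e]
  show ?thesis using u[simplified]
  proof (induction rule: MR_induct)
    case (monomial a i)
    show ?case using v[simplified]
    proof (induction rule: MR_induct)
      case (monomial b j)
      then show ?case using \<open>a \<in> carrier A\<close>
        by (simp add: monomial_mult hat_monomial[OF lx] hat_monomial[OF e] R.monomial_mult counit_closed
            der_closed[OF x] der_mult[OF x] R.monomial_add add.assoc)
          (simp add: add.commute add.left_commute)
    next
      case (add w z)
      have m: "monomial A a i \<in> carrier L" using monomial by (simp add: monomial_closed)
      then show ?case using add hat_add[OF lx] hat_add[OF e] L.r_distr[of w z "monomial A a i"] cl
        L.m_closed[of "monomial A a i" w] L.m_closed[of "monomial A a i" z]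
        by (simp add: K.r_distr K.add.m_ac)
    qed
  next
    case (add w z)
    then show ?case using v hat_add[OF lx] hat_add[OF e] L.l_distr[of w z v] cl
      L.m_closed[of w v] L.m_closed[of z v]
      by (simp add: K.l_distr K.add.m_ac)
  qed
qed

end

section \<open>Eigenspaces of the involution and degrees in the contraction algebra\<close>

locale contraction = hopf_involution +
  assumes two_unit: "\<one> \<oplus> \<one> \<in> Units R"
    and flat: "flat_module (UP R) (contraction_algebra R A \<theta>)"
begin

abbreviation "C \<equiv> contraction_algebra R A \<theta>"
abbreviation "Ap \<equiv> plus_part A \<theta>"
abbreviation "Am \<equiv> minus_part A \<theta>"
abbreviation "\<iota> \<equiv> poly_to_laurent R"

definition half :: 'a where "half = inv\<^bsub>R\<^esub> (\<one> \<oplus> \<one>)"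

lemma half_closed [simp]: "half \<in> carrier R"
  using two_unit by (simp add: half_def)

lemma half_add_half: "half \<oplus> half = \<one>"
proof -
  have "half \<otimes> (\<one> \<oplus> \<one>) = \<one>" using two_unit by (simp add: half_def)
  then show ?thesis by (simp add: R.r_distr)
qed

text \<open>The use of the unit 2 for values in \<open>R\<close>: what is both fixed and negated
  vanishes.\<close>

lemma eq_minus_self:
  assumes "r \<in> carrier R" "r = \<ominus> r" shows "r = \<zero>"
proof -
  have "r \<oplus> r = \<zero>" using assms R.r_neg by metis
  then have "half \<otimes> (r \<oplus> r) = \<zero>" by simp
  then have "(half \<oplus> half) \<otimes> r = \<zero>" using assms(1) by (simp add: R.r_distr R.l_distr)
  then show ?thesis using assms(1) by (simp add: half_add_half)
qed

lemma theta_closed [simp]: "a \<in> carrier A \<Longrightarrow> \<theta> a \<in> carrier A"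
  using involution_hom by (auto simp: ring_hom_def)

lemma theta_add: "a \<in> carrier A \<Longrightarrow> b \<in> carrier A \<Longrightarrow> \<theta> (a \<oplus>\<^bsub>A\<^esub> b) = \<theta> a \<oplus>\<^bsub>A\<^esub> \<theta> b"
  using involution_hom by (auto simp: ring_hom_def)

lemma theta_mult: "a \<in> carrier A \<Longrightarrow> b \<in> carrier A \<Longrightarrow> \<theta> (a \<otimes>\<^bsub>A\<^esub> b) = \<theta> a \<otimes>\<^bsub>A\<^esub> \<theta> b"
  using involution_hom by (auto simp: ring_hom_def)

lemma theta_one: "\<theta> \<one>\<^bsub>A\<^esub> = \<one>\<^bsub>A\<^esub>"
  using involution_hom by (auto simp: ring_hom_def)

lemma theta_smult: "r \<in> carrier R \<Longrightarrow> a \<in> carrier A \<Longrightarrow> \<theta> (r \<odot>\<^bsub>A\<^esub> a) = r \<odot>\<^bsub>A\<^esub> \<theta> a"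
  using involution_linear by (auto simp: module_homs_def)

lemma theta_minus: "a \<in> carrier A \<Longrightarrow> \<theta> (\<ominus>\<^bsub>A\<^esub> a) = \<ominus>\<^bsub>A\<^esub> \<theta> a"
  using theta_smult[of "\<ominus> \<one>" a] by (simp add: smult_l_minus)

lemma theta_zero: "\<theta> \<zero>\<^bsub>A\<^esub> = \<zero>\<^bsub>A\<^esub>"
  using theta_smult[of "\<zero>" "\<zero>\<^bsub>A\<^esub>"] by simp

lemma plus_iff: "a \<in> Ap \<longleftrightarrow> a \<in> carrier A \<and> \<theta> a = a"
  by (simp add: plus_part_def)

lemma minus_iff: "a \<in> Am \<longleftrightarrow> a \<in> carrier A \<and> \<theta> a = \<ominus>\<^bsub>A\<^esub> a"
  by (simp add: minus_part_def)

definition sym :: "'c \<Rightarrow> 'c" where "sym a = half \<odot>\<^bsub>A\<^esub> (a \<oplus>\<^bsub>A\<^esub> \<theta> a)"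
definition alt :: "'c \<Rightarrow> 'c" where "alt a = half \<odot>\<^bsub>A\<^esub> (a \<ominus>\<^bsub>A\<^esub> \<theta> a)"

lemma sym_plus: "a \<in> carrier A \<Longrightarrow> sym a \<in> Ap"
  by (simp add: plus_iff sym_def theta_smult theta_add involution_square M.add.m_comm)

lemma alt_minus: "a \<in> carrier A \<Longrightarrow> alt a \<in> Am"
  by (simp add: minus_iff alt_def theta_smult theta_add theta_minus involution_square a_minus_def
      smult_r_minus[symmetric] M.minus_add M.add.m_comm)

lemma sym_closed [simp]: "a \<in> carrier A \<Longrightarrow> sym a \<in> carrier A"
  by (simp add: sym_def)

lemma alt_closed [simp]: "a \<in> carrier A \<Longrightarrow> alt a \<in> carrier A"
  by (simp add: alt_def)

lemma half_add_self:
  assumes "a \<in> carrier A" shows "half \<odot>\<^bsub>A\<^esub> a \<oplus>\<^bsub>A\<^esub> half \<odot>\<^bsub>A\<^esub> a = a"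
  using assms smult_l_distr[of half half a] by (simp add: half_add_half)

lemma sym_add_alt:
  assumes "a \<in> carrier A" shows "sym a \<oplus>\<^bsub>A\<^esub> alt a = a"
proof -
  have "sym a \<oplus>\<^bsub>A\<^esub> alt a = half \<odot>\<^bsub>A\<^esub> ((a \<oplus>\<^bsub>A\<^esub> \<theta> a) \<oplus>\<^bsub>A\<^esub> (a \<ominus>\<^bsub>A\<^esub> \<theta> a))"
    using assms by (simp add: sym_def alt_def smult_r_distr)
  also have "(a \<oplus>\<^bsub>A\<^esub> \<theta> a) \<oplus>\<^bsub>A\<^esub> (a \<ominus>\<^bsub>A\<^esub> \<theta> a) = a \<oplus>\<^bsub>A\<^esub> a"
  proof -
    have "(a \<oplus>\<^bsub>A\<^esub> \<theta> a) \<oplus>\<^bsub>A\<^esub> (a \<ominus>\<^bsub>A\<^esub> \<theta> a) = (a \<oplus>\<^bsub>A\<^esub> a) \<oplus>\<^bsub>A\<^esub> (\<theta> a \<oplus>\<^bsub>A\<^esub> \<ominus>\<^bsub>A\<^esub> \<theta> a)"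
      using assms by (simp only: a_minus_def M.add.m_ac theta_closed M.add.m_closed M.a_inv_closed)
    then show ?thesis using assms by (simp add: M.r_neg)
  qed
  finally show ?thesis using assms by (simp add: smult_r_distr half_add_self)
qed

text \<open>\<open>\<epsilon>\<close> is invariant under \<open>\<theta>\<close>, so on the odd part
  it equals its own negative.\<close>

lemma counit_minus_zero: "a \<in> Am \<Longrightarrow> \<epsilon> a = \<zero>"
proof -
  assume a: "a \<in> Am"
  then have c: "a \<in> carrier A" by (simp add: minus_iff)
  have "\<epsilon> (\<ominus>\<^bsub>A\<^esub> a) = \<ominus> \<epsilon> a"
    using semilinearD(3)[OF counit_linear_form, of "\<ominus> \<one>" a] c
    by (simp add: smult_l_minus counit_closed R.l_minus)
  moreover have "\<epsilon> (\<theta> a) = \<epsilon> a" using c by (rule involution_counit)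
  ultimately show ?thesis using a c by (intro eq_minus_self) (simp_all add: counit_closed minus_iff)
qed

text \<open>\<open>graded i\<close> is the set of \<open>a\<close> such that \<open>a s\<^sup>i\<close> lies in the contraction algebra.  Only one
  inclusion is needed.\<close>

inductive graded :: "int \<Rightarrow> 'c \<Rightarrow> bool" where
  zero: "graded i \<zero>\<^bsub>A\<^esub>"
| plus: "a \<in> Ap \<Longrightarrow> graded 0 a"
| minus: "a \<in> Am \<Longrightarrow> graded (- 1) a"
| add: "graded i a \<Longrightarrow> graded i b \<Longrightarrow> graded i (a \<oplus>\<^bsub>A\<^esub> b)"
| mult: "graded i a \<Longrightarrow> graded j b \<Longrightarrow> graded (i + j) (a \<otimes>\<^bsub>A\<^esub> b)"
| shift: "graded i a \<Longrightarrow> graded (i + 2) a"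

lemma graded_closed: "graded i a \<Longrightarrow> a \<in> carrier A"
  by (induction rule: graded.induct) (auto simp: plus_iff minus_iff)

text \<open>\<open>\<theta>\<close> is multiplicative, has the sign of the degree on the generators,
  and a shift by \<open>t\<close> preserves parity. Hence the degree determines the
  eigenvalue.\<close>

lemma graded_theta: "graded i a \<Longrightarrow> \<theta> a = (if even i then a else \<ominus>\<^bsub>A\<^esub> a)"
proof (induction rule: graded.induct)
  case (add i a b)
  then show ?case by (auto simp: theta_add graded_closed M.minus_add)
next
  case (mult i a j b)
  then show ?case by (auto simp: theta_mult graded_closed l_minus r_minus)
qed (auto simp: plus_iff minus_iff theta_zero)

lemma graded_even: "graded i a \<Longrightarrow> even i \<Longrightarrow> a \<in> Ap"
  by (simp add: graded_theta plus_iff graded_closed)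

lemma graded_odd: "graded i a \<Longrightarrow> odd i \<Longrightarrow> a \<in> Am"
  by (simp add: graded_theta minus_iff graded_closed)

text \<open>A product of negative degree has a factor of negative degree, and
  \<open>\<epsilon>\<close> is multiplicative. The only generators of negative degree are odd, where
  \<open>\<epsilon>\<close> vanishes.\<close>

lemma graded_counit: "graded i a \<Longrightarrow> i < 0 \<Longrightarrow> \<epsilon> a = \<zero>"
proof (induction rule: graded.induct)
  case (zero i)
  show ?case by (rule linear_form_zero[OF counit_linear_form])
next
  case (add i a b)
  then show ?case by (simp add: semilinearD[OF counit_linear_form] graded_closed)
next
  case (mult i a j b)
  then have "i < 0 \<or> j < 0" by auto
  then show ?case using mult by (auto simp: counit_mult graded_closed counit_closed)
qed (auto simp: counit_minus_zero)

text \<open>Consider the Leibniz term \<open>\<epsilon> a \<otimes> x b\<close> of a product of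
  degree at most -2. If \<open>a\<close> has negative degree, \<open>\<epsilon> a\<close> vanishes;
  otherwise \<open>b\<close> has degree at most -2 and the induction hypothesis applies. The other
  term is symmetric.\<close>

lemma graded_der:
  assumes x: "x \<in> carrier \<g>"
  shows "graded i a \<Longrightarrow> i \<le> - 2 \<Longrightarrow> x a = \<zero>"
proof (induction rule: graded.induct)
  case (zero i)
  show ?case by (rule der_zero[OF x])
next
  case (add i a b)
  then show ?case by (simp add: der_add[OF x] graded_closed)
next
  case (mult i a j b)
  note c = graded_closed[OF mult(1)] graded_closed[OF mult(2)]
  have "i < 0 \<and> j < 0 \<or> i \<le> - 2 \<or> j \<le> - 2" using mult by auto
  moreover have "i < 0 \<Longrightarrow> \<epsilon> a = \<zero>" "j < 0 \<Longrightarrow> \<epsilon> b = \<zero>"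
    using mult by (auto intro: graded_counit)
  moreover have "i < 0 \<or> j \<le> -2" "j < 0 \<or> i \<le> - 2" using mult by auto
  ultimately have "(\<epsilon> a = \<zero> \<or> x b = \<zero>) \<and> (\<epsilon> b = \<zero> \<or> x a = \<zero>)"
    using mult by auto
  then show ?case using c by (auto simp: der_mult[OF x] counit_closed der_closed[OF x])
qed auto

lemma graded_even_scalar: "a \<in> Ap \<Longrightarrow> graded (2 * int n) a"
proof (induction n)
  case 0
  then show ?case by (simp add: graded.plus)
next
  case (Suc n)
  then show ?case using graded.shift[of "2 * int n" a] by (simp add: algebra_simps)
qed

lemma graded_mult:
  assumes u: "u \<in> carrier L" "\<And>i. graded i (u i)" and v: "v \<in> carrier L" "\<And>i. graded i (v i)"
  shows "graded n ((u \<otimes>\<^bsub>L\<^esub> v) n)"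
proof -
  have "(u \<otimes>\<^bsub>L\<^esub> v) n = (\<Oplus>\<^bsub>A\<^esub>x\<in>{i. u i \<noteq> \<zero>\<^bsub>A\<^esub>} \<times> {i. v i \<noteq> \<zero>\<^bsub>A\<^esub>}.
      if fst x + snd x = n then u (fst x) \<otimes>\<^bsub>A\<^esub> v (snd x) else \<zero>\<^bsub>A\<^esub>)"
    using u v by (simp add: MR_mult MR_finite)
  also have "graded n \<dots>"
    by (rule M.finsum_closed_under)
      (use u v in \<open>auto simp: MR_finite MR_closed intro: graded.intros\<close>)
  finally show ?thesis .
qed

lemma C_simps [simp]:
  "monoid.mult C = monoid.mult L" "monoid.one C = monoid.one L"
  "ring.zero C = ring.zero L" "ring.add C = ring.add L" "p \<odot>\<^bsub>C\<^esub> u = \<iota> p \<odot>\<^bsub>L\<^esub> u"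
  by (simp_all add: contraction_algebra_def restrict_scalars_def Let_def)

lemma carrier_C:
  "carrier C = generated_subalgebra (UP R) (restrict_scalars \<iota> L)
     ((\<lambda>a. monomial A a 0) ` Ap \<union> (\<lambda>a. monomial A a (- 1)) ` Am)"
  by (simp add: contraction_algebra_def Let_def)

lemma restrict_simps [simp]:
  "monoid.mult (restrict_scalars h B) = monoid.mult B" "monoid.one (restrict_scalars h B) = monoid.one B"
  "ring.add (restrict_scalars h B) = ring.add B" "smult (restrict_scalars h B) r = smult B (h r)"
  by (simp_all add: restrict_scalars_def)

text \<open>The module axioms, among them closure of the generated subalgebra under negatives, are
  contained in \<open>flat_module\<close>.\<close>

sublocale C: module "UP R" C
  using flat by (simp add: flat_module_def)

sublocale L: algebra K L by (rule L_algebra)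

lemma one_plus: "\<one>\<^bsub>A\<^esub> \<in> Ap" by (simp add: plus_iff theta_one)

lemma smult_one_plus: "r \<in> carrier R \<Longrightarrow> r \<odot>\<^bsub>A\<^esub> \<one>\<^bsub>A\<^esub> \<in> Ap" by (simp add: plus_iff theta_one theta_smult)

lemma C_graded:
  assumes "u \<in> carrier C"
  shows "u \<in> carrier L \<and> (\<forall>i. graded i (u i))"
  using assms unfolding carrier_C
proof (induction rule: generated_subalgebra.induct)
  case (incl x)
  then show ?case
    by (auto simp: monomial_closed plus_iff minus_iff) (auto simp: monomial_def plus_iff minus_iff intro: graded.intros)
next
  case one
  then show ?case using one_plus by (auto simp: MR_one monomial_closed) (auto simp: monomial_def intro: graded.intros)
next
  case (add x y)
  then have "graded i ((x \<oplus>\<^bsub>L\<^esub> y) i)" for i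
    by (simp add: MR_add graded.add)
  then show ?case using add MR_add_closed[of x y] by simp
next
  case (mult x y)
  then show ?case using L.m_closed[of x y] graded_mult[of x y] by auto
next
  case (smult r x)
  have r: "\<iota> r \<in> carrier K" using smult by (simp add: R.poly_to_laurent_closed)
  \<comment> \<open>A scalar from \<open>k[t]\<close> acts as multiplication by this element. Its
    coefficient in degree \<open>2 m\<close> is a multiple of the unit, which is graded there after
    \<open>m\<close> shifts from degree 0.\<close>
  let ?s = "\<lambda>i. \<iota> r i \<odot>\<^bsub>A\<^esub> \<one>\<^bsub>A\<^esub>"
  have s: "?s \<in> carrier L" using scalar_closed[OF r] by simp
  have "graded i (?s i)" for i
  proof (cases "0 \<le> i \<and> even i")
    case True
    then have "i = 2 * int (nat i div 2)" by auto
    then obtain m where "i = 2 * int m" ..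
    then show ?thesis using smult(1) graded_even_scalar[OF smult_one_plus, of "r m" m]
      by (simp add: R.poly_to_laurent_even R.UP_closed)
  next
    case False
    then show ?thesis by (auto simp: poly_to_laurent_def intro: graded.zero)
  qed
  then show ?case using smult graded_mult[OF s, of x] L.m_closed[OF s, of x] by (simp add: L_smult)
qed

lemma C_subset: "u \<in> carrier C \<Longrightarrow> u \<in> carrier L" using C_graded by blast
lemma C_graded_coeff: "u \<in> carrier C \<Longrightarrow> graded i (u i)" using C_graded by blast

lemma C_mult_closed: "u \<in> carrier C \<Longrightarrow> v \<in> carrier C \<Longrightarrow> u \<otimes>\<^bsub>L\<^esub> v \<in> carrier C"
  unfolding carrier_C using generated_subalgebra.mult[of u "UP R" "restrict_scalars \<iota> L" _ v] by simp

lemma C_one_closed: "\<one>\<^bsub>L\<^esub> \<in> carrier C"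
  unfolding carrier_C using generated_subalgebra.one[of "restrict_scalars \<iota> L" "UP R"] by simp

lemma C_add_closed: "u \<in> carrier C \<Longrightarrow> v \<in> carrier C \<Longrightarrow> u \<oplus>\<^bsub>L\<^esub> v \<in> carrier C"
  using C.M.add.m_closed by simp

lemma C_plus: "a \<in> Ap \<Longrightarrow> monomial A a 0 \<in> carrier C"
  unfolding carrier_C by (intro generated_subalgebra.incl) simp

lemma C_minus: "a \<in> Am \<Longrightarrow> monomial A a (- 1) \<in> carrier C"
  unfolding carrier_C by (intro generated_subalgebra.incl) simp

lemma C_algebra: "algebra (UP R) C"
proof (rule algebraI)
  show "cring (UP R)" by (rule R.UP_cring)
  show "cring C"
  proof (rule cringI)
    show "abelian_group C" by (rule C.M.abelian_group_axioms)
    show "comm_monoid C"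
      by (rule comm_monoidI)
        (use C_subset C_mult_closed C_one_closed L.m_assoc L.m_comm L.l_one in \<open>auto simp del: L_simps\<close>)
  qed (use C_subset L.l_distr in \<open>auto simp del: L_simps\<close>)
  show "(p \<odot>\<^bsub>C\<^esub> u) \<otimes>\<^bsub>C\<^esub> v = p \<odot>\<^bsub>C\<^esub> (u \<otimes>\<^bsub>C\<^esub> v)" if "p \<in> carrier (UP R)" "u \<in> carrier C" "v \<in> carrier C" for p u v
    using that L.smult_assoc2[of "\<iota> p" u v] by (simp add: C_subset R.poly_to_laurent_closed del: L_simps)
  show "(p \<oplus>\<^bsub>UP R\<^esub> q) \<odot>\<^bsub>C\<^esub> x = p \<odot>\<^bsub>C\<^esub> x \<oplus>\<^bsub>C\<^esub> q \<odot>\<^bsub>C\<^esub> x"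
    if "p \<in> carrier (UP R)" "q \<in> carrier (UP R)" "x \<in> carrier C" for p q x
    using that by (rule C.smult_l_distr)
  show "p \<odot>\<^bsub>C\<^esub> (x \<oplus>\<^bsub>C\<^esub> y) = p \<odot>\<^bsub>C\<^esub> x \<oplus>\<^bsub>C\<^esub> p \<odot>\<^bsub>C\<^esub> y"
    if "p \<in> carrier (UP R)" "x \<in> carrier C" "y \<in> carrier C" for p x y
    using that by (rule C.smult_r_distr)
  show "(p \<otimes>\<^bsub>UP R\<^esub> q) \<odot>\<^bsub>C\<^esub> x = p \<odot>\<^bsub>C\<^esub> (q \<odot>\<^bsub>C\<^esub> x)"
    if "p \<in> carrier (UP R)" "q \<in> carrier (UP R)" "x \<in> carrier C" for p q x
    using that by (rule C.smult_assoc1)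
  show "\<one>\<^bsub>UP R\<^esub> \<odot>\<^bsub>C\<^esub> x = x" if "x \<in> carrier C" for x
    using that by (rule C.smult_one)
  show "p \<odot>\<^bsub>C\<^esub> x \<in> carrier C" if "p \<in> carrier (UP R)" "x \<in> carrier C" for p x
    using that by (rule C.smult_closed)
qed

text \<open>Every second coefficient, read as a coefficient in \<open>t\<close>: the offset
  \<open>c\<close> is 0 for even coefficients and -1 for odd ones multiplied by \<open>s\<close>.
  Finiteness is inherited since \<open>n \<mapsto> 2 n + c\<close> is injective.\<close>

lemma coefficients_UP:
  assumes u: "u \<in> carrier L" and f: "linear_form f"
  shows "(\<lambda>n. f (u (2 * int n + c))) \<in> carrier (UP R)"
proof -
  have fin: "finite {n. u (2 * int n + c) \<noteq> \<zero>\<^bsub>A\<^esub>}"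
  proof (rule finite_imageD)
    show "finite ((\<lambda>n. 2 * int n + c) ` {n. u (2 * int n + c) \<noteq> \<zero>\<^bsub>A\<^esub>})"
      by (rule finite_subset[OF _ MR_finite[of u]]) (use u in auto)
  qed (simp add: inj_on_def)
  obtain N where N: "\<forall>n\<in>{n. u (2 * int n + c) \<noteq> \<zero>\<^bsub>A\<^esub>}. n \<le> N"
    using fin finite_nat_set_iff_bounded_le by blast
  have "u (2 * int n + c) = \<zero>\<^bsub>A\<^esub>" if "n > N" for n
    using N that by (metis (mono_tags, lifting) mem_Collect_eq not_le)
  then have "f (u (2 * int n + c)) = \<zero>" if "n > N" for n
    using that linear_form_zero[OF f] by simp
  then show ?thesis using u by (auto simp: R.UP_carrier MR_closed semilinearD[OF f])
qed

text \<open>\<open>\<epsilon>\<close> kills the coefficients of odd degree by parity and those of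
  negative degree by \<open>graded_counit\<close>, so only a polynomial in \<open>t\<close> is left.
  With injectivity of \<open>\<iota>\<close> this makes the description in
  \<open>contraction_counit\<close> a definite one.\<close>

lemma counit_C:
  assumes u: "u \<in> carrier C"
  shows "contraction_counit R \<epsilon> u \<in> carrier (UP R) \<and> \<iota> (contraction_counit R \<epsilon> u) = hat 0 \<epsilon> u"
proof -
  let ?p = "\<lambda>n. \<epsilon> (u (2 * int n + 0))"
  have p: "?p \<in> carrier (UP R)" by (rule coefficients_UP[OF C_subset[OF u] counit_linear_form])
  have "\<iota> ?p i = \<epsilon> (u i)" for i
  proof (cases "0 \<le> i \<and> even i")
    case True
    then have "2 * int (nat i div 2) = i" by auto
    then show ?thesis using True by (simp add: poly_to_laurent_def)
  next
    case False
    then have "\<epsilon> (u i) = \<zero>"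
      using graded_counit[OF C_graded_coeff[OF u], of i] counit_minus_zero[OF graded_odd[OF C_graded_coeff[OF u]], of i]
      by linarith
    then show ?thesis using False by (simp only: poly_to_laurent_def if_False)
  qed
  then have "\<iota> ?p = (\<lambda>i. \<epsilon> (u i))" by blast
  then have "contraction_counit R \<epsilon> u = ?p"
    unfolding contraction_counit_def using p
    by (intro the_equality) (auto intro: R.poly_to_laurent_inj)
  then show ?thesis using p \<open>\<iota> ?p = _\<close> by (simp add: hat_def)
qed

section \<open>Eigenspaces of the Lie algebra, and derivations extended to the contraction
  algebra\<close>

abbreviation "\<sigma> \<equiv> lie_involution A \<theta>"
abbreviation "gp \<equiv> plus_part \<g> \<sigma>"
abbreviation "gm \<equiv> minus_part \<g> \<sigma>"

lemma gp_apply: "x \<in> gp \<Longrightarrow> x \<in> carrier \<g>" "x \<in> gp \<Longrightarrow> a \<in> carrier A \<Longrightarrow> x (\<theta> a) = x a"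
  by (auto simp: plus_part_def lie_involution_def fun_eq_iff) metis

lemma gm_apply: "x \<in> gm \<Longrightarrow> x \<in> carrier \<g>" "x \<in> gm \<Longrightarrow> a \<in> carrier A \<Longrightarrow> x (\<theta> a) = \<ominus> x a"
proof -
  assume x: "x \<in> gm"
  then show "x \<in> carrier \<g>" by (simp add: minus_part_def)
  assume a: "a \<in> carrier A"
  have "\<sigma> x a = (\<ominus>\<^bsub>\<g>\<^esub> x) a" using x by (simp add: minus_part_def)
  then show "x (\<theta> a) = \<ominus> x a"
    using a lie_minus_apply[OF \<open>x \<in> carrier \<g>\<close> a] by (simp add: lie_involution_def)
qed

lemma gpI:
  assumes "x \<in> carrier \<g>" "\<And>a. a \<in> carrier A \<Longrightarrow> x (\<theta> a) = x a"
  shows "x \<in> gp"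
  using assms der_undefined[OF assms(1)] by (auto simp: plus_part_def lie_involution_def fun_eq_iff)

lemma gmI:
  assumes "x \<in> carrier \<g>" "\<And>a. a \<in> carrier A \<Longrightarrow> x (\<theta> a) = \<ominus> x a"
  shows "x \<in> gm"
  using assms der_undefined[OF G.a_inv_closed[OF assms(1)]] lie_minus_apply[OF assms(1)]
  by (auto simp: minus_part_def lie_involution_def fun_eq_iff)

lemma gp_minus: "x \<in> gp \<Longrightarrow> a \<in> Am \<Longrightarrow> x a = \<zero>"
  using gp_apply[of x] by (metis der_closed der_minus eq_minus_self minus_iff)

lemma gm_plus: "x \<in> gm \<Longrightarrow> a \<in> Ap \<Longrightarrow> x a = \<zero>"
  using gm_apply[of x] by (metis der_closed eq_minus_self plus_iff)

lemma sigma_closed: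
  assumes x: "x \<in> carrier \<g>" shows "\<sigma> x \<in> carrier \<g>"
  by (rule derivationI) (simp_all add: lie_involution_def theta_add theta_smult theta_mult
      der_closed[OF x] der_add[OF x] der_smult[OF x] der_mult[OF x] involution_counit)

definition gsym :: "('c \<Rightarrow> 'a) \<Rightarrow> 'c \<Rightarrow> 'a" where "gsym x = half \<odot>\<^bsub>\<g>\<^esub> (x \<oplus>\<^bsub>\<g>\<^esub> \<sigma> x)"
definition galt :: "('c \<Rightarrow> 'a) \<Rightarrow> 'c \<Rightarrow> 'a" where "galt x = half \<odot>\<^bsub>\<g>\<^esub> (x \<ominus>\<^bsub>\<g>\<^esub> \<sigma> x)"

lemma gsym_gp: "x \<in> carrier \<g> \<Longrightarrow> gsym x \<in> gp"
proof (rule gpI)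
  assume x: "x \<in> carrier \<g>"
  show "gsym x \<in> carrier \<g>" using x by (simp add: gsym_def sigma_closed)
  show "gsym x (\<theta> a) = gsym x a" if "a \<in> carrier A" for a
    using that x by (simp add: gsym_def lie_simps lie_involution_def involution_square der_closed R.add.m_comm)
qed

lemma galt_apply:
  assumes x: "x \<in> carrier \<g>" and a: "a \<in> carrier A"
  shows "galt x a = half \<otimes> (x a \<ominus> x (\<theta> a))"
  using a lie_minus_apply[OF sigma_closed[OF x] a]
  by (simp add: galt_def lie_simps a_minus_def lie_involution_def)

lemma galt_gm: "x \<in> carrier \<g> \<Longrightarrow> galt x \<in> gm"
proof (rule gmI)
  assume x: "x \<in> carrier \<g>"
  show "galt x \<in> carrier \<g>" using x by (simp add: galt_def sigma_closed)
  show "galt x (\<theta> a) = \<ominus> galt x a" if "a \<in> carrier A" for a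
    using that x
    by (simp add: galt_apply involution_square der_closed a_minus_def R.r_minus[symmetric] R.minus_add R.add.m_comm)
qed

lemma gsym_add_galt: "x \<in> carrier \<g> \<Longrightarrow> gsym x \<oplus>\<^bsub>\<g>\<^esub> galt x = x"
proof (rule der_eqI)
  assume x: "x \<in> carrier \<g>"
  show "gsym x \<oplus>\<^bsub>\<g>\<^esub> galt x \<in> carrier \<g>"
    using x gp_apply(1)[OF gsym_gp[OF x]] gm_apply(1)[OF galt_gm[OF x]] by simp
  show "(gsym x \<oplus>\<^bsub>\<g>\<^esub> galt x) a = x a" if a: "a \<in> carrier A" for a
  proof -
    have c: "x a \<in> carrier R" "x (\<theta> a) \<in> carrier R" using x a by (simp_all add: der_closed)
    have "(gsym x \<oplus>\<^bsub>\<g>\<^esub> galt x) a = half \<otimes> ((x a \<oplus> x (\<theta> a)) \<oplus> (x a \<ominus> x (\<theta> a)))"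
      using a x c by (simp add: lie_simps(2)[of "gsym x"] galt_apply R.r_distr)
        (simp add: gsym_def lie_simps lie_involution_def R.r_distr)
    also have "(x a \<oplus> x (\<theta> a)) \<oplus> (x a \<ominus> x (\<theta> a)) = (x a \<oplus> x a) \<oplus> (x (\<theta> a) \<oplus> \<ominus> x (\<theta> a))"
      using c by (simp only: a_minus_def R.add.m_ac R.add.m_closed R.a_inv_closed)
    also have "half \<otimes> \<dots> = (half \<oplus> half) \<otimes> x a"
      using c by (simp add: R.r_neg R.r_distr R.l_distr)
    finally show ?thesis using c by (simp add: half_add_half)
  qed
qed

text \<open>The derivation of the contraction algebra defined by \<open>x\<close>: the linear extension of \<open>x\<close> if
  \<open>x\<close> is fixed by the involution, and \<open>s\<close> times it if \<open>x\<close> is in the other eigenspace.  Even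
  coefficients of \<open>u\<close> lie in the first eigenspace of \<open>A\<close> and odd ones in the second, so one
  formula covers both cases.\<close>

definition cder :: "('c \<Rightarrow> 'a) \<Rightarrow> (int \<Rightarrow> 'c) \<Rightarrow> nat \<Rightarrow> 'a" where
  "cder x = (\<lambda>u\<in>carrier C. \<lambda>n. x (u (2 * int n)) \<oplus> x (u (2 * int n - 1)))"

lemma cder_closed:
  assumes x: "x \<in> carrier \<g>" and u: "u \<in> carrier C"
  shows "cder x u \<in> carrier (UP R)"
proof -
  have "(\<lambda>n. x (u (2 * int n + 0))) \<oplus>\<^bsub>UP R\<^esub> (\<lambda>n. x (u (2 * int n + - 1))) \<in> carrier (UP R)"
    by (intro cring.cring_simprules[OF R.UP_cring] coefficients_UP C_subset u der_linear_form x)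
  moreover have "(\<lambda>n. x (u (2 * int n + 0))) \<oplus>\<^bsub>UP R\<^esub> (\<lambda>n. x (u (2 * int n + - 1))) = cder x u"
    using u R.UP_add[OF coefficients_UP[OF C_subset[OF u] der_linear_form[OF x], of 0]
        coefficients_UP[OF C_subset[OF u] der_linear_form[OF x], of "- 1"]]
    by (simp add: cder_def fun_eq_iff)
  ultimately show ?thesis by simp
qed

text \<open>In even degree at least 0, the extra term in \<open>cder\<close> comes from an odd
  coefficient, which \<open>x\<close> kills. Odd degrees vanish by parity; even negative degrees are
  at most -2, where \<open>graded_der\<close> applies.\<close>

lemma cder_gp:
  assumes x: "x \<in> gp" and u: "u \<in> carrier C"
  shows "\<iota> (cder x u) = hat 0 x u"
proof
  fix i
  note g = C_graded_coeff[OF u]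
  note xg = gp_apply(1)[OF x]
  show "\<iota> (cder x u) i = hat 0 x u i"
  proof (cases "0 \<le> i \<and> even i")
    case True
    then have "2 * int (nat i div 2) = i" by auto
    moreover have "x (u (i - 1)) = \<zero>"
      using graded_odd[OF g, of "i - 1"] True gp_minus[OF x] by simp
    ultimately show ?thesis using True u xg C_subset[OF u]
      by (simp add: poly_to_laurent_def cder_def hat_def der_closed MR_closed)
  next
    case False
    then have "i \<le> -2 \<or> odd i" by presburger
    then have "x (u i) = \<zero>"
      using graded_odd[OF g, of i] gp_minus[OF x] graded_der[OF xg g, of i] by blast
    then show ?thesis using False by (simp only: poly_to_laurent_def hat_def if_False diff_0_right)
  qed
qed

text \<open>The value in degree \<open>i\<close> comes from the coefficient in degree
  \<open>i - 1\<close>. Degree -1, the lowest one not covered by \<open>graded_der\<close>, thus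
  feeds the constant term, and nothing lands in negative degree.\<close>

lemma cder_gm:
  assumes x: "x \<in> gm" and u: "u \<in> carrier C"
  shows "\<iota> (cder x u) = hat 1 x u"
proof
  fix i
  note g = C_graded_coeff[OF u]
  note xg = gm_apply(1)[OF x]
  show "\<iota> (cder x u) i = hat 1 x u i"
  proof (cases "0 \<le> i \<and> even i")
    case True
    then have "2 * int (nat i div 2) = i" by auto
    moreover have "x (u i) = \<zero>"
      using graded_even[OF g, of i] True gm_plus[OF x] by simp
    ultimately show ?thesis using True u xg C_subset[OF u]
      by (simp add: poly_to_laurent_def cder_def hat_def der_closed MR_closed)
  next
    case False
    then have "i - 1 \<le> -2 \<or> even (i - 1)" by presburger
    then have "x (u (i - 1)) = \<zero>"
      using graded_even[OF g, of "i - 1"] gm_plus[OF x] graded_der[OF xg g, of "i - 1"] by blast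
    then show ?thesis using False by (simp only: poly_to_laurent_def hat_def if_False)
  qed
qed

end

section \<open>Comultiplication of the contraction algebra\<close>

context tensor_pair
begin

lemma smult_pure_right:
  assumes "r \<in> carrier R" "m \<in> carrier M" "n \<in> carrier N"
  shows "r \<odot>\<^bsub>T\<^esub> pure_tensor R M N m n = pure_tensor R M N m (r \<odot>\<^bsub>N\<^esub> n)"
  using assms by (simp add: smult_pure pure_balanced)

lemma pure_minus_right:
  assumes "m \<in> carrier M" "n \<in> carrier N"
  shows "pure_tensor R M N m (\<ominus>\<^bsub>N\<^esub> n) = \<ominus>\<^bsub>T\<^esub> pure_tensor R M N m n"
  using assms smult_pure_right[of "\<ominus> \<one>" m n] T.smult_l_minus[of "\<one>" "pure_tensor R M N m n"]
    N.smult_l_minus[of "\<one>" n]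
  by simp

end

lemma (in tensor_algebras) tensor_map_mult:
  assumes T': "tensor_algebras R' M' N'"
    and b: "balanced_map R M N (tensor_product R' M' N') (\<lambda>m n. pure_tensor R' M' N' (f m) (g n))"
    and f: "\<And>x. x \<in> carrier M \<Longrightarrow> f x \<in> carrier M'" "\<And>x y. x \<in> carrier M \<Longrightarrow> y \<in> carrier M \<Longrightarrow> f (x \<otimes>\<^bsub>M\<^esub> y) = f x \<otimes>\<^bsub>M'\<^esub> f y"
    and g: "\<And>x. x \<in> carrier N \<Longrightarrow> g x \<in> carrier N'" "\<And>x y. x \<in> carrier N \<Longrightarrow> y \<in> carrier N \<Longrightarrow> g (x \<otimes>\<^bsub>N\<^esub> y) = g x \<otimes>\<^bsub>N'\<^esub> g y"
    and X: "X \<in> carrier T" and Y: "Y \<in> carrier T"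
  shows "tensor_map R' M' N' f g (X \<otimes>\<^bsub>T\<^esub> Y) =
    tensor_map R' M' N' f g X \<otimes>\<^bsub>tensor_product R' M' N'\<^esub> tensor_map R' M' N' f g Y"
proof -
  interpret T': tensor_algebras R' M' N' by fact
  note l = lift_pure[OF T'.T_abelian_group b] lift_add[OF T'.T_abelian_group b] lift_closed[OF T'.T_abelian_group b]
  show ?thesis unfolding tensor_map_def using X
  proof (induction rule: tensor_induct)
    case (pure m n)
    note mn = pure
    show ?case using Y
    proof (induction rule: tensor_induct)
      case (pure m' n')
      then show ?case using mn by (simp add: mult_pure T'.mult_pure f g l)
    next
      case (add Y Y')
      then show ?case using mn by (simp add: mult_add_right mult_closed T'.mult_add_right l f g)
    qed
  next
    case (add X X')
    then show ?case using Y by (simp add: mult_add_left mult_closed T'.mult_add_left l)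
  qed
qed

section \<open>Lifting the comultiplication to the tensor square over \<open>k[t]\<close>\<close>

context contraction
begin

sublocale CC: tensor_algebras "UP R" C C
  by (simp add: tensor_algebras_def C_algebra)

sublocale LL: tensor_algebras K L L
  by (simp add: tensor_algebras_def L_algebra)

abbreviation "CC \<equiv> tensor_product (UP R) C C"
abbreviation "LL \<equiv> tensor_product K L L"
abbreviation "incl \<equiv> tensor_map K L L (\<lambda>x. x) (\<lambda>x. x)"
abbreviation "const \<equiv> \<lambda>a. monomial A a (0::int)"
abbreviation "jj \<equiv> tensor_map K L L const const"
abbreviation "\<theta>\<theta> \<equiv> tensor_map R A A \<theta> \<theta>"
abbreviation "s i \<equiv> monomial R \<one> (i::int)"

lemma s_closed: "s i \<in> carrier K" by (simp add: R.monomial_closed)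

lemma s_smult: "a \<in> carrier A \<Longrightarrow> s i \<odot>\<^bsub>L\<^esub> monomial A a j = monomial A a (i + j)"
  by (simp add: L_smult_monomial)

lemmas C_subset' = C_subset[simplified]

lemma incl_balanced: "balanced_map (UP R) C C LL (\<lambda>m n. pure_tensor K L L m n)"
  by (rule CC.balanced_tensor_map[OF LL.tensor_pair_axioms, of \<iota>])
    (auto intro!: semilinearI simp: R.poly_to_laurent_closed C_subset')

lemma jj_balanced: "balanced_map R A A LL (\<lambda>m n. pure_tensor K L L (const m) (const n))"
  by (rule AA.balanced_tensor_map[OF LL.tensor_pair_axioms, of "\<lambda>r. monomial R r 0"])
    (auto intro!: semilinearI simp: R.monomial_closed monomial_closed monomial_add L_smult_monomial)

lemma tt_balanced: "balanced_map R A A AA (\<lambda>m n. pure_tensor R A A (\<theta> m) (\<theta> n))"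
  by (rule AA.balanced_tensor_map[OF AA.tensor_pair_axioms, of "\<lambda>r. r"])
    (auto intro!: semilinearI simp: theta_add theta_smult)

lemmas incl_pure = CC.lift_pure[OF LL.T_abelian_group incl_balanced, folded tensor_map_def]
lemmas incl_add = CC.lift_add[OF LL.T_abelian_group incl_balanced, folded tensor_map_def]
lemmas incl_closed = CC.lift_closed[OF LL.T_abelian_group incl_balanced, folded tensor_map_def]
lemmas incl_zero = CC.lift_zero[OF LL.T_abelian_group incl_balanced, folded tensor_map_def]
lemmas jj_pure = AA.lift_pure[OF LL.T_abelian_group jj_balanced, folded tensor_map_def]
lemmas jj_add = AA.lift_add[OF LL.T_abelian_group jj_balanced, folded tensor_map_def]
lemmas jj_closed = AA.lift_closed[OF LL.T_abelian_group jj_balanced, folded tensor_map_def]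
lemmas jj_zero = AA.lift_zero[OF LL.T_abelian_group jj_balanced, folded tensor_map_def]
lemmas tt_pure = AA.lift_pure[OF AA.T_abelian_group tt_balanced, folded tensor_map_def]
lemmas tt_add = AA.lift_add[OF AA.T_abelian_group tt_balanced, folded tensor_map_def]

lemma incl_mult: "X \<in> carrier CC \<Longrightarrow> Y \<in> carrier CC \<Longrightarrow> incl (X \<otimes>\<^bsub>CC\<^esub> Y) = incl X \<otimes>\<^bsub>LL\<^esub> incl Y"
  by (rule CC.tensor_map_mult[OF LL.tensor_algebras_axioms incl_balanced]) (simp_all add: C_subset')

lemma jj_mult: "X \<in> carrier AA \<Longrightarrow> Y \<in> carrier AA \<Longrightarrow> jj (X \<otimes>\<^bsub>AA\<^esub> Y) = jj X \<otimes>\<^bsub>LL\<^esub> jj Y"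
  by (rule AA.tensor_map_mult[OF LL.tensor_algebras_axioms jj_balanced])
    (simp_all add: monomial_closed monomial_mult)

lemma incl_smult:
  assumes "p \<in> carrier (UP R)" "X \<in> carrier CC"
  shows "incl (p \<odot>\<^bsub>CC\<^esub> X) = \<iota> p \<odot>\<^bsub>LL\<^esub> incl X"
proof -
  have "semilinear (UP R) CC LL (\<lambda>p. smult LL (\<iota> p)) incl"
    unfolding tensor_map_def
    by (rule CC.semilinear_tensor_lift[OF LL.T_abelian_group incl_balanced])
      (use C_subset in \<open>simp_all add: LL.smult_pure LL.T.smult_r_distr R.poly_to_laurent_closed del: L_simps\<close>)
  then show ?thesis using assms by (simp add: semilinearD)
qed

text \<open>The image of the tensor square over \<open>k[t]\<close> in the one over
  \<open>k[s^{+-1}]\<close>. Its closure under sums, products and scalars from \<open>k[t]\<close>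
  lets preimages be found by induction on \<open>graded\<close>.\<close>

definition lifts :: "(int \<Rightarrow> 'c, int \<Rightarrow> 'c) tensor \<Rightarrow> bool" where
  "lifts Z \<longleftrightarrow> (\<exists>X\<in>carrier CC. incl X = Z)"

lemma lifts_add: "lifts Z \<Longrightarrow> lifts W \<Longrightarrow> lifts (Z \<oplus>\<^bsub>LL\<^esub> W)"
  unfolding lifts_def by (metis incl_add CC.T.add.m_closed)

lemma lifts_zero: "lifts \<zero>\<^bsub>LL\<^esub>"
  unfolding lifts_def by (metis incl_zero CC.T.zero_closed)

lemma lifts_mult: "lifts Z \<Longrightarrow> lifts W \<Longrightarrow> lifts (Z \<otimes>\<^bsub>LL\<^esub> W)"
  unfolding lifts_def by (metis incl_mult CC.mult_closed)

lemma lifts_smult: "p \<in> carrier (UP R) \<Longrightarrow> lifts Z \<Longrightarrow> lifts (\<iota> p \<odot>\<^bsub>LL\<^esub> Z)"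
  unfolding lifts_def by (metis incl_smult CC.T.smult_closed)

lemma lifts_pure: "u \<in> carrier C \<Longrightarrow> v \<in> carrier C \<Longrightarrow> lifts (pure_tensor K L L u v)"
  unfolding lifts_def by (metis incl_pure CC.pure_closed)

lemma t_closed: "monom (UP R) \<one> 1 \<in> carrier (UP R)"
  by (rule R.monom_in_UP) simp

lemma iota_t: "\<iota> (monom (UP R) \<one> 1) = s 2"
  by (simp add: R.poly_to_laurent_monom)

lemma lifts_t: "lifts Z \<Longrightarrow> lifts (s 2 \<odot>\<^bsub>LL\<^esub> Z)"
  using lifts_smult[OF t_closed] by (simp only: iota_t)

lemma const_L: "a \<in> carrier A \<Longrightarrow> monomial A a i \<in> carrier L" by (simp add: monomial_closed)

text \<open>The element is \<open>t\<close> times the tensor of \<open>a s^-1\<close> and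
  \<open>b s^-1\<close>: as \<open>t = s s\<close>, one factor \<open>s\<close> goes to each side,
  which the tensor product over \<open>k[s^{+-1}]\<close> allows.\<close>

lemma lifts_minus_minus:
  assumes "a \<in> Am" "b \<in> Am"
  shows "lifts (pure_tensor K L L (const a) (const b))"
proof -
  have ab: "a \<in> carrier A" "b \<in> carrier A" using assms by (auto simp: minus_iff)
  note m = const_L[OF ab(1)] const_L[OF ab(2)]
  have "lifts (s 2 \<odot>\<^bsub>LL\<^esub> pure_tensor K L L (monomial A a (- 1)) (monomial A b (- 1)))"
    by (intro lifts_t lifts_pure C_minus assms)
  also have "s 2 \<odot>\<^bsub>LL\<^esub> pure_tensor K L L (monomial A a (- 1)) (monomial A b (- 1)) =
      pure_tensor K L L (monomial A a 1) (monomial A b (- 1))"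
    by (simp only: LL.smult_pure s_closed m s_smult ab) simp
  also have "\<dots> = pure_tensor K L L (s 1 \<odot>\<^bsub>L\<^esub> const a) (monomial A b (- 1))"
    by (simp only: s_smult ab) simp
  also have "\<dots> = pure_tensor K L L (const a) (s 1 \<odot>\<^bsub>L\<^esub> monomial A b (- 1))"
    by (simp only: LL.pure_balanced s_closed m)
  also have "\<dots> = pure_tensor K L L (const a) (const b)"
    by (simp only: s_smult ab) simp
  finally show ?thesis .
qed

text \<open>The single \<open>s^-1\<close> is absorbed by whichever tensor factor is odd.\<close>

lemma lifts_plus_minus:
  assumes "a \<in> Ap" "b \<in> Am"
  shows "lifts (s (- 1) \<odot>\<^bsub>LL\<^esub> pure_tensor K L L (const a) (const b))"
    "lifts (s (- 1) \<odot>\<^bsub>LL\<^esub> pure_tensor K L L (const b) (const a))"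
proof -
  have ab: "a \<in> carrier A" "b \<in> carrier A" using assms by (auto simp: minus_iff plus_iff)
  note m = const_L[OF ab(1)] const_L[OF ab(2)]
  have "s (- 1) \<odot>\<^bsub>LL\<^esub> pure_tensor K L L (const a) (const b) = pure_tensor K L L (const a) (monomial A b (- 1))"
    by (simp only: LL.smult_pure_right s_closed m s_smult ab) simp
  then show "lifts (s (- 1) \<odot>\<^bsub>LL\<^esub> pure_tensor K L L (const a) (const b))"
    using lifts_pure[OF C_plus[OF assms(1)] C_minus[OF assms(2)]] by simp
  have "s (- 1) \<odot>\<^bsub>LL\<^esub> pure_tensor K L L (const b) (const a) = pure_tensor K L L (monomial A b (- 1)) (const a)"
    by (simp only: LL.smult_pure s_closed m s_smult ab) simp
  then show "lifts (s (- 1) \<odot>\<^bsub>LL\<^esub> pure_tensor K L L (const b) (const a))"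
    using lifts_pure[OF C_minus[OF assms(2)] C_plus[OF assms(1)]] by simp
qed

lemma lifts_pure_plus: "a \<in> Ap \<Longrightarrow> b \<in> Ap \<Longrightarrow> lifts (pure_tensor K L L (const a) (const b))"
  by (intro lifts_pure C_plus)

text \<open>Splitting both factors of a pure tensor gives four terms. Equal parities are fixed by
  \<open>\<theta> \<otimes> \<theta>\<close> and lift as they stand; mixed parities are negated and
  lift after multiplication by \<open>s^-1\<close>.\<close>

lemma tensor_eigen_decomposition:
  assumes "Z \<in> carrier AA"
  shows "\<exists>Z0 \<in> carrier AA. \<exists>Z1 \<in> carrier AA. Z = Z0 \<oplus>\<^bsub>AA\<^esub> Z1 \<and> \<theta>\<theta> Z0 = Z0 \<and> \<theta>\<theta> Z1 = \<ominus>\<^bsub>AA\<^esub> Z1 \<and>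
    lifts (jj Z0) \<and> lifts (s (- 1) \<odot>\<^bsub>LL\<^esub> jj Z1)"
  using assms
proof (induction rule: AA.tensor_induct)
  case (pure m n)
  let ?p = "pure_tensor R A A"
  have sp: "sym m \<in> Ap" "sym n \<in> Ap" "alt m \<in> Am" "alt n \<in> Am"
    using pure by (simp_all add: sym_plus alt_minus)
  have c: "sym m \<in> carrier A" "sym n \<in> carrier A" "alt m \<in> carrier A" "alt n \<in> carrier A"
    using pure by simp_all
  have th: "\<theta> (sym m) = sym m" "\<theta> (sym n) = sym n" "\<theta> (alt m) = \<ominus>\<^bsub>A\<^esub> alt m" "\<theta> (alt n) = \<ominus>\<^bsub>A\<^esub> alt n"
    using sp by (simp_all add: plus_iff minus_iff)
  let ?Z0 = "?p (sym m) (sym n) \<oplus>\<^bsub>AA\<^esub> ?p (alt m) (alt n)"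
  let ?Z1 = "?p (sym m) (alt n) \<oplus>\<^bsub>AA\<^esub> ?p (alt m) (sym n)"
  have "?p m n = ?p (sym m \<oplus>\<^bsub>A\<^esub> alt m) (sym n \<oplus>\<^bsub>A\<^esub> alt n)"
    using pure by (simp add: sym_add_alt)
  also have "\<dots> = ?Z0 \<oplus>\<^bsub>AA\<^esub> ?Z1"
    using c by (simp add: AA.pure_add_left AA.pure_add_right AA.T.add.m_ac)
  finally have 1: "?p m n = ?Z0 \<oplus>\<^bsub>AA\<^esub> ?Z1" .
  have 2: "\<theta>\<theta> ?Z0 = ?Z0"
    using c by (simp add: tt_add tt_pure th AA.pure_minus_left AA.pure_minus_right)
  have 3: "\<theta>\<theta> ?Z1 = \<ominus>\<^bsub>AA\<^esub> ?Z1"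
    using c by (simp add: tt_add tt_pure th AA.pure_minus_left AA.pure_minus_right AA.T.minus_add)
  have 4: "lifts (jj ?Z0)"
    using c by (simp add: jj_add jj_pure lifts_add lifts_pure_plus lifts_minus_minus sp)
  have 5: "lifts (s (- 1) \<odot>\<^bsub>LL\<^esub> jj ?Z1)"
    using c const_L by (simp add: jj_add jj_pure LL.T.smult_r_distr s_closed lifts_add lifts_plus_minus sp del: L_simps)
  show ?case using 1 2 3 4 5 c by (intro bexI[of _ ?Z0] bexI[of _ ?Z1]) simp_all
next
  case (add Z W)
  then obtain Z0 Z1 W0 W1 where
    Z: "Z0 \<in> carrier AA" "Z1 \<in> carrier AA" "Z = Z0 \<oplus>\<^bsub>AA\<^esub> Z1" "\<theta>\<theta> Z0 = Z0" "\<theta>\<theta> Z1 = \<ominus>\<^bsub>AA\<^esub> Z1"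
      "lifts (jj Z0)" "lifts (s (- 1) \<odot>\<^bsub>LL\<^esub> jj Z1)" and
    W: "W0 \<in> carrier AA" "W1 \<in> carrier AA" "W = W0 \<oplus>\<^bsub>AA\<^esub> W1" "\<theta>\<theta> W0 = W0" "\<theta>\<theta> W1 = \<ominus>\<^bsub>AA\<^esub> W1"
      "lifts (jj W0)" "lifts (s (- 1) \<odot>\<^bsub>LL\<^esub> jj W1)" by blast
  have "Z \<oplus>\<^bsub>AA\<^esub> W = (Z0 \<oplus>\<^bsub>AA\<^esub> W0) \<oplus>\<^bsub>AA\<^esub> (Z1 \<oplus>\<^bsub>AA\<^esub> W1)"
    using Z W by (simp add: AA.T.add.m_ac)
  then show ?case using Z W
    by (intro bexI[of _ "Z0 \<oplus>\<^bsub>AA\<^esub> W0"] bexI[of _ "Z1 \<oplus>\<^bsub>AA\<^esub> W1"])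
      (simp_all add: tt_add jj_add lifts_add AA.T.minus_add LL.T.smult_r_distr s_closed jj_closed)
qed

lemma AA_eq_minus_self:
  assumes "X \<in> carrier AA" "X = \<ominus>\<^bsub>AA\<^esub> X" shows "X = \<zero>\<^bsub>AA\<^esub>"
proof -
  have "X \<oplus>\<^bsub>AA\<^esub> X = \<zero>\<^bsub>AA\<^esub>" using assms AA.T.r_neg by metis
  then have "half \<odot>\<^bsub>AA\<^esub> (X \<oplus>\<^bsub>AA\<^esub> X) = \<zero>\<^bsub>AA\<^esub>" by simp
  then have "(half \<oplus> half) \<odot>\<^bsub>AA\<^esub> X = \<zero>\<^bsub>AA\<^esub>"
    using assms(1) by (simp add: AA.T.smult_r_distr AA.T.smult_l_distr)
  then show ?thesis using assms(1) by (simp add: half_add_half)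
qed

lemma comult_zero: "\<Delta> \<zero>\<^bsub>A\<^esub> = \<zero>\<^bsub>AA\<^esub>"
  using comult_smult[of "\<zero>" "\<zero>\<^bsub>A\<^esub>"] by (simp add: comult_closed)

lemma comult_minus: "a \<in> carrier A \<Longrightarrow> \<Delta> (\<ominus>\<^bsub>A\<^esub> a) = \<ominus>\<^bsub>AA\<^esub> \<Delta> a"
  using comult_smult[of "\<ominus> \<one>" a] AA.T.smult_l_minus[of "\<one>" "\<Delta> a"]
  by (simp add: comult_closed smult_l_minus)

text \<open>\<open>\<Delta> a\<close> is fixed by \<open>\<theta> \<otimes> \<theta>\<close>, so its
  mixed component equals its own negative and vanishes.\<close>

lemma lifts_comult_plus:
  assumes a: "a \<in> Ap" shows "lifts (jj (\<Delta> a))"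
proof -
  have ac: "a \<in> carrier A" using a by (simp add: plus_iff)
  obtain Z0 Z1 where Z: "Z0 \<in> carrier AA" "Z1 \<in> carrier AA" "\<Delta> a = Z0 \<oplus>\<^bsub>AA\<^esub> Z1"
    "\<theta>\<theta> Z0 = Z0" "\<theta>\<theta> Z1 = \<ominus>\<^bsub>AA\<^esub> Z1" "lifts (jj Z0)"
    using tensor_eigen_decomposition[OF comult_closed[OF ac]] by blast
  have "\<theta>\<theta> (\<Delta> a) = \<Delta> a" using involution_comult[OF ac] a by (simp add: plus_iff)
  then have "Z0 \<oplus>\<^bsub>AA\<^esub> \<ominus>\<^bsub>AA\<^esub> Z1 = Z0 \<oplus>\<^bsub>AA\<^esub> Z1" using Z by (simp add: tt_add)
  then have "Z1 = \<zero>\<^bsub>AA\<^esub>" using Z AA_eq_minus_self[of Z1] by simp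
  then show ?thesis using Z by simp
qed

lemma lifts_comult_minus:
  assumes a: "a \<in> Am" shows "lifts (s (- 1) \<odot>\<^bsub>LL\<^esub> jj (\<Delta> a))"
proof -
  have ac: "a \<in> carrier A" using a by (simp add: minus_iff)
  obtain Z0 Z1 where Z: "Z0 \<in> carrier AA" "Z1 \<in> carrier AA" "\<Delta> a = Z0 \<oplus>\<^bsub>AA\<^esub> Z1"
    "\<theta>\<theta> Z0 = Z0" "\<theta>\<theta> Z1 = \<ominus>\<^bsub>AA\<^esub> Z1" "lifts (s (- 1) \<odot>\<^bsub>LL\<^esub> jj Z1)"
    using tensor_eigen_decomposition[OF comult_closed[OF ac]] by blast
  have "\<theta>\<theta> (\<Delta> a) = \<ominus>\<^bsub>AA\<^esub> \<Delta> a" using involution_comult[OF ac] a ac by (simp add: minus_iff comult_minus)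
  then have "Z0 \<oplus>\<^bsub>AA\<^esub> \<ominus>\<^bsub>AA\<^esub> Z1 = \<ominus>\<^bsub>AA\<^esub> Z0 \<oplus>\<^bsub>AA\<^esub> \<ominus>\<^bsub>AA\<^esub> Z1"
    using Z by (simp add: tt_add AA.T.minus_add)
  then have "Z0 = \<zero>\<^bsub>AA\<^esub>" using Z AA_eq_minus_self[of Z0] by simp
  then show ?thesis using Z by simp
qed

text \<open>\<open>a \<mapsto> s^i \<Delta> a\<close> turns products into products with degrees
  added, so lifting spreads from the generators to everything graded.\<close>

lemma graded_comult: "graded i a \<Longrightarrow> lifts (s i \<odot>\<^bsub>LL\<^esub> jj (\<Delta> a))"
proof (induction rule: graded.induct)
  case (zero i)
  then show ?case by (simp add: comult_zero jj_zero s_closed lifts_zero)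
next
  case (plus a)
  then show ?case using lifts_comult_plus[OF plus] jj_closed[OF comult_closed[of a]]
    by (simp add: plus_iff flip: R.MR_one)
next
  case (minus a)
  then show ?case by (rule lifts_comult_minus)
next
  case (add i a b)
  then show ?case
    by (simp add: comult_add graded_closed jj_add comult_closed LL.T.smult_r_distr s_closed jj_closed lifts_add)
next
  case (mult i a j b)
  note c = graded_closed[OF mult(1)] graded_closed[OF mult(2)]
  have "s (i + j) \<odot>\<^bsub>LL\<^esub> jj (\<Delta> (a \<otimes>\<^bsub>A\<^esub> b)) = (s i \<odot>\<^bsub>LL\<^esub> jj (\<Delta> a)) \<otimes>\<^bsub>LL\<^esub> (s j \<odot>\<^bsub>LL\<^esub> jj (\<Delta> b))"
    using c by (simp add: LL.smult_mult_smult s_closed jj_closed comult_closed comult_mult jj_mult R.monomial_mult)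
  then show ?case using mult lifts_mult by simp
next
  case (shift i a)
  have "s (i + 2) \<odot>\<^bsub>LL\<^esub> jj (\<Delta> a) = s 2 \<odot>\<^bsub>LL\<^esub> (s i \<odot>\<^bsub>LL\<^esub> jj (\<Delta> a))"
    using graded_closed[OF shift(1)]
    by (simp add: LL.T.smult_assoc1[symmetric] s_closed jj_closed comult_closed R.monomial_mult add.commute)
  then show ?case using shift lifts_t by simp
qed

lemma laurent_comult_eq:
  "laurent_comult R A \<Delta> u = (\<Oplus>\<^bsub>LL\<^esub>i \<in> {i. u i \<noteq> \<zero>\<^bsub>A\<^esub>}. s i \<odot>\<^bsub>LL\<^esub> jj (\<Delta> (u i)))"
  by (simp only: laurent_comult_def Let_def)

text \<open>The choice has a witness: each coefficient \<open>u i\<close> is graded in degree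
  \<open>i\<close>, so every term of the finite sum \<open>laurent_comult\<close> lifts.\<close>

lemma contraction_comult:
  assumes u: "u \<in> carrier C"
  shows "contraction_comult R A \<Delta> \<theta> u \<in> carrier CC"
    "incl (contraction_comult R A \<Delta> \<theta> u) = laurent_comult R A \<Delta> u"
proof -
  have uc: "u i \<in> carrier A" for i using graded_closed[OF C_graded_coeff[OF u]] .
  have "lifts (laurent_comult R A \<Delta> u)"
    unfolding laurent_comult_eq
    by (rule LL.T.finsum_closed_under)
      (use C_subset[OF u] C_graded_coeff[OF u] in \<open>auto simp: MR_finite s_closed jj_closed comult_closed uc
        graded_comult lifts_zero intro: lifts_add\<close>)
  then have "\<exists>X. X \<in> carrier CC \<and> incl X = laurent_comult R A \<Delta> u" by (auto simp: lifts_def)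
  from someI_ex[OF this] show "contraction_comult R A \<Delta> \<theta> u \<in> carrier CC"
    "incl (contraction_comult R A \<Delta> \<theta> u) = laurent_comult R A \<Delta> u"
    by (simp_all add: contraction_comult_def Let_def)
qed

sublocale LC: comult_algebra "UP R" C "contraction_comult R A \<Delta> \<theta>" "contraction_counit R \<epsilon>"
  by (intro comult_algebra.intro C_algebra comult_algebra_axioms.intro contraction_comult(1) conjunct1[OF counit_C])

text \<open>Linearity over \<open>k[s^{+-1}]\<close> takes out the power \<open>s^i\<close> of each
  term. On constants the two extensions give monomials of degrees \<open>p\<close> and
  \<open>q\<close>, so the shifts add.\<close>

lemma hat_laurent_comult:
  assumes x: "linear_form x" and y: "linear_form y" and u: "u \<in> carrier L"
  shows "tensor_lift K (\<lambda>v w. hat p x v \<otimes>\<^bsub>K\<^esub> hat q y w) (laurent_comult R A \<Delta> u) =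
    hat (p + q) (\<lambda>a. bilift x y (\<Delta> a)) u"
proof -
  have b: "balanced_map K L L K (\<lambda>v w. hat p x v \<otimes>\<^bsub>K\<^esub> hat q y w)"
    by (rule LL.balanced_mult_semilinear[of K "\<lambda>x. x"]) (simp_all add: R.MR_cring hat_semilinear x y)
  note l = LL.lift_pure[OF R.MR_abelian_group b] LL.lift_add[OF R.MR_abelian_group b]
    LL.lift_closed[OF R.MR_abelian_group b]
  have sl: "semilinear K LL K (\<lambda>f. monoid.mult K f) (tensor_lift K (\<lambda>v w. hat p x v \<otimes>\<^bsub>K\<^esub> hat q y w))"
    by (rule LL.semilinear_tensor_lift[OF R.MR_abelian_group b])
      (simp_all only: hat_smult x y L.R.m_assoc hat_closed L.R.r_distr)
  have jj: "tensor_lift K (\<lambda>v w. hat p x v \<otimes>\<^bsub>K\<^esub> hat q y w) (jj Z) = monomial R (bilift x y Z) (p + q)"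
    if "Z \<in> carrier AA" for Z
    using that
  proof (induction rule: AA.tensor_induct)
    case (pure m n)
    then show ?case using const_L[of m] const_L[of n]
      by (simp add: jj_pure l hat_monomial x y R.monomial_mult semilinearD(1)[OF x] semilinearD(1)[OF y] bilift_pure)
  next
    case (add X Y)
    then show ?case by (simp add: jj_add l jj_closed bilift_add bilift_closed x y R.monomial_add)
  qed
  have tm: "tensor_lift K (\<lambda>v w. hat p x v \<otimes>\<^bsub>K\<^esub> hat q y w) (s i \<odot>\<^bsub>LL\<^esub> jj Z) = monomial R (bilift x y Z) (i + (p + q))"
    if "Z \<in> carrier AA" for Z i
    using that by (simp add: semilinearD(3)[OF sl] s_closed jj_closed jj R.monomial_mult bilift_closed x y)
  let ?I = "{i. u i \<noteq> \<zero>\<^bsub>A\<^esub>}"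
  have fin: "finite ?I" using u by (simp add: MR_finite)
  have uc: "u i \<in> carrier A" for i using u by (simp add: MR_closed)
  have "tensor_lift K (\<lambda>v w. hat p x v \<otimes>\<^bsub>K\<^esub> hat q y w) (laurent_comult R A \<Delta> u) =
    (\<Oplus>\<^bsub>K\<^esub>i\<in>?I. tensor_lift K (\<lambda>v w. hat p x v \<otimes>\<^bsub>K\<^esub> hat q y w) (s i \<odot>\<^bsub>LL\<^esub> jj (\<Delta> (u i))))"
    unfolding laurent_comult_eq
    by (rule LL.lift_finsum[OF R.MR_abelian_group b fin]) (simp add: s_closed jj_closed comult_closed uc)
  also have "\<dots> = (\<Oplus>\<^bsub>K\<^esub>i\<in>?I. monomial R (bilift x y (\<Delta> (u i))) (i + (p + q)))"
    by (rule L.R.finsum_cong')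
      (simp_all add: tm comult_closed uc R.monomial_closed bilift_closed x y)
  also have "\<dots> = hat (p + q) (\<lambda>a. bilift x y (\<Delta> a)) u"
  proof
    fix n
    let ?b = "\<lambda>i. bilift x y (\<Delta> (u i))"
    have bc: "?b i \<in> carrier R" for i by (simp add: bilift_closed x y comult_closed uc)
    \<comment> \<open>Covers degrees whose index is outside the support of \<open>u\<close>: the sum
      on the left is empty there, while \<open>hat\<close> evaluates at 0.\<close>
    have z: "bilift x y (\<Delta> \<zero>\<^bsub>A\<^esub>) = \<zero>"
      by (simp add: comult_zero AA.lift_zero[OF R.is_abelian_group bilift_balanced[OF x y]])
    have "(\<Oplus>\<^bsub>K\<^esub>i\<in>?I. monomial R (?b i) (i + (p + q))) n = (\<Oplus>\<^bsub>R\<^esub>i\<in>?I. monomial R (?b i) (i + (p + q)) n)"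
      by (rule R.MR_finsum[OF fin]) (simp add: R.monomial_closed bc)
    \<comment> \<open>In degree \<open>n\<close> only the index \<open>n - (p + q)\<close>
      contributes. The test is turned into the form that \<open>finsum_singleton\<close>
      expects.\<close>
    also have "\<dots> = (\<Oplus>\<^bsub>R\<^esub>i\<in>?I. if n - (p + q) = i then ?b i else \<zero>)"
      by (rule R.finsum_cong') (auto simp: monomial_def bc)
    also have "\<dots> = hat (p + q) (\<lambda>a. bilift x y (\<Delta> a)) u n"
    proof (cases "n - (p + q) \<in> ?I")
      case True
      then show ?thesis using R.finsum_singleton[OF True fin, of ?b] bc by (simp add: hat_def)
    next
      case False
      then have "(\<Oplus>\<^bsub>R\<^esub>i\<in>?I. if n - (p + q) = i then ?b i else \<zero>) = (\<Oplus>\<^bsub>R\<^esub>i\<in>?I. \<zero>)"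
        by (intro R.finsum_cong') auto
      then show ?thesis using False by (simp add: hat_def z)
    qed
    finally show "(\<Oplus>\<^bsub>K\<^esub>i\<in>?I. monomial R (?b i) (i + (p + q))) n = hat (p + q) (\<lambda>a. bilift x y (\<Delta> a)) u n" .
  qed
  finally show ?thesis .
qed

text \<open>The value does not depend on the tensor chosen by \<^const>\<open>contraction_comult\<close>, since it can be
  computed after the inclusion into the tensor square of the Laurent algebra.\<close>

lemma iota_bilift:
  assumes D: "LC.linear_form D" "\<And>u. u \<in> carrier C \<Longrightarrow> \<iota> (D u) = hat p x u" "linear_form x"
    and E: "LC.linear_form E" "\<And>u. u \<in> carrier C \<Longrightarrow> \<iota> (E u) = hat q y u" "linear_form y"
    and u: "u \<in> carrier C"
  shows "\<iota> (LC.bilift D E (contraction_comult R A \<Delta> \<theta> u)) = hat (p + q) (\<lambda>a. bilift x y (\<Delta> a)) u"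
proof -
  have b: "balanced_map K L L K (\<lambda>v w. hat p x v \<otimes>\<^bsub>K\<^esub> hat q y w)"
    by (rule LL.balanced_mult_semilinear[of K "\<lambda>x. x"]) (simp_all add: R.MR_cring hat_semilinear D E)
  note l = LL.lift_pure[OF R.MR_abelian_group b] LL.lift_add[OF R.MR_abelian_group b]
  have "\<iota> (LC.bilift D E X) = tensor_lift K (\<lambda>v w. hat p x v \<otimes>\<^bsub>K\<^esub> hat q y w) (incl X)"
    if "X \<in> carrier CC" for X
    using that
  proof (induction rule: CC.tensor_induct)
    case (pure v w)
    then show ?case using C_subset[of v] C_subset[of w] D E
      by (simp add: LC.bilift_pure incl_pure l R.poly_to_laurent_mult semilinearD(1) del: L_simps)
  next
    case (add X Y)
    then show ?case
      by (simp add: LC.bilift_add D E LC.bilift_closed incl_add l incl_closed R.poly_to_laurent_add)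
  qed
  then show ?thesis
    using u D E by (simp add: contraction_comult hat_laurent_comult C_subset del: L_simps)
qed

end

section \<open>Brackets of extended derivations\<close>

context contraction
begin

abbreviation "\<h> \<equiv> lie_algebra_of (UP R) C (contraction_comult R A \<Delta> \<theta>) (contraction_counit R \<epsilon>)"
abbreviation "t \<equiv> monom (UP R) \<one> 1"

lemma iota_inj: "\<iota> p = \<iota> q \<Longrightarrow> p = q" by (rule R.poly_to_laurent_inj)

text \<open>The axioms are checked after \<open>\<iota>\<close>, where \<open>cder x\<close> becomes
  \<open>hat p x\<close>. This needs a single shift \<open>p\<close> and so covers eigenvectors of
  \<open>\<sigma>\<close> only, with \<open>p\<close> equal to 0 or 1.\<close>

lemma cder_lie_of_hat:
  assumes x: "x \<in> carrier \<g>" and h: "\<And>u. u \<in> carrier C \<Longrightarrow> \<iota> (cder x u) = hat p x u"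
  shows "cder x \<in> carrier \<h>"
proof (rule LC.derivationI)
  note lx = der_linear_form[OF x]
  show "cder x u \<in> carrier (UP R)" if "u \<in> carrier C" for u using x that by (rule cder_closed)
  show "cder x u = undefined" if "u \<notin> carrier C" for u using that by (simp add: cder_def)
  show "cder x (u \<oplus>\<^bsub>C\<^esub> v) = cder x u \<oplus>\<^bsub>UP R\<^esub> cder x v" if uv: "u \<in> carrier C" "v \<in> carrier C" for u v
    using uv C_add_closed[OF uv] hat_add[OF lx C_subset[OF uv(1)] C_subset[OF uv(2)]] h
    by (intro iota_inj) (simp add: R.poly_to_laurent_add cder_closed x)
  show "cder x (q \<odot>\<^bsub>C\<^esub> u) = q \<otimes>\<^bsub>UP R\<^esub> cder x u" if q: "q \<in> carrier (UP R)" "u \<in> carrier C" for q u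
    using q C.smult_closed[OF q] h hat_smult[OF lx R.poly_to_laurent_closed[OF q(1)] C_subset[OF q(2)]]
    by (intro iota_inj) (simp add: R.poly_to_laurent_mult cder_closed x)
  show "cder x (u \<otimes>\<^bsub>C\<^esub> v) = contraction_counit R \<epsilon> u \<otimes>\<^bsub>UP R\<^esub> cder x v \<oplus>\<^bsub>UP R\<^esub>
      cder x u \<otimes>\<^bsub>UP R\<^esub> contraction_counit R \<epsilon> v" if uv: "u \<in> carrier C" "v \<in> carrier C" for u v
  proof (rule iota_inj)
    have "\<iota> (cder x (u \<otimes>\<^bsub>C\<^esub> v)) = hat 0 \<epsilon> u \<otimes>\<^bsub>K\<^esub> hat p x v \<oplus>\<^bsub>K\<^esub> hat p x u \<otimes>\<^bsub>K\<^esub> hat 0 \<epsilon> v"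
      using h[OF C_mult_closed[OF uv]] hat_mult[OF counit_linear_form x C_subset[OF uv(1)] C_subset[OF uv(2)]]
      by simp
    also have "\<dots> = \<iota> (contraction_counit R \<epsilon> u \<otimes>\<^bsub>UP R\<^esub> cder x v \<oplus>\<^bsub>UP R\<^esub>
      cder x u \<otimes>\<^bsub>UP R\<^esub> contraction_counit R \<epsilon> v)"
      using uv x by (simp add: R.poly_to_laurent_add R.poly_to_laurent_mult cder_closed counit_C h)
    finally show "\<iota> (cder x (u \<otimes>\<^bsub>C\<^esub> v)) = \<dots>" .
  qed
qed

lemma cder_add:
  assumes "x \<in> carrier \<g>" "y \<in> carrier \<g>"
  shows "cder (x \<oplus>\<^bsub>\<g>\<^esub> y) = cder x \<oplus>\<^bsub>\<h>\<^esub> cder y"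
proof
  fix u
  show "cder (x \<oplus>\<^bsub>\<g>\<^esub> y) u = (cder x \<oplus>\<^bsub>\<h>\<^esub> cder y) u"
  proof (cases "u \<in> carrier C")
    case True
    have uc: "u i \<in> carrier A" for i using graded_closed[OF C_graded_coeff[OF True]] .
    show ?thesis
    proof
      fix n
      have "(cder x \<oplus>\<^bsub>\<h>\<^esub> cder y) u n = cder x u n \<oplus> cder y u n"
        using True assms by (simp add: LC.lie_simps R.UP_add cder_closed)
      then show "cder (x \<oplus>\<^bsub>\<g>\<^esub> y) u n = (cder x \<oplus>\<^bsub>\<h>\<^esub> cder y) u n"
        using assms True uc by (simp add: cder_def lie_simps der_closed R.add.m_ac)
    qed
  qed (simp add: LC.lie_simps cder_def)
qed

text \<open>A general \<open>x\<close> mixes the shifts 0 and 1, so it is split into its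
  eigencomponents.\<close>

lemma cder_closed_lie:
  assumes x: "x \<in> carrier \<g>" shows "cder x \<in> carrier \<h>"
proof -
  have "cder (gsym x) \<in> carrier \<h>" "cder (galt x) \<in> carrier \<h>"
    using cder_lie_of_hat[OF gp_apply(1) cder_gp] cder_lie_of_hat[OF gm_apply(1) cder_gm]
      gsym_gp[OF x] galt_gm[OF x] by blast+
  then have "cder (gsym x \<oplus>\<^bsub>\<g>\<^esub> galt x) \<in> carrier \<h>"
    using gp_apply(1)[OF gsym_gp[OF x]] gm_apply(1)[OF galt_gm[OF x]] by (simp add: cder_add)
  then show ?thesis using x by (simp add: gsym_add_galt)
qed

lemma cder_smult:
  assumes "r \<in> carrier R" "x \<in> carrier \<g>"
  shows "cder (r \<odot>\<^bsub>\<g>\<^esub> x) = monom (UP R) r 0 \<odot>\<^bsub>\<h>\<^esub> cder x"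
proof
  fix u
  show "cder (r \<odot>\<^bsub>\<g>\<^esub> x) u = (monom (UP R) r 0 \<odot>\<^bsub>\<h>\<^esub> cder x) u"
  proof (cases "u \<in> carrier C")
    case True
    have uc: "u i \<in> carrier A" for i using graded_closed[OF C_graded_coeff[OF True]] .
    show ?thesis
    proof
      fix n
      have "(monom (UP R) r 0 \<odot>\<^bsub>\<h>\<^esub> cder x) u n = r \<otimes> cder x u n"
        using True assms by (simp add: LC.lie_simps R.UP_mult_const cder_closed)
      then show "cder (r \<odot>\<^bsub>\<g>\<^esub> x) u n = (monom (UP R) r 0 \<odot>\<^bsub>\<h>\<^esub> cder x) u n"
        using assms True uc by (simp add: cder_def lie_simps der_closed R.r_distr)
    qed
  qed (simp add: LC.lie_simps cder_def)
qed

text \<open>\<open>e\<close> and \<open>e'\<close> stand for the eigenvalues 1 and -1. Keeping them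
  as scalars settles the three combinations of parities at once.\<close>

lemma bracket_theta:
  assumes x: "x \<in> carrier \<g>" and y: "y \<in> carrier \<g>" and e: "e \<in> carrier R" "e' \<in> carrier R"
    and xe: "\<And>a. a \<in> carrier A \<Longrightarrow> x (\<theta> a) = e \<otimes> x a"
    and ye: "\<And>a. a \<in> carrier A \<Longrightarrow> y (\<theta> a) = e' \<otimes> y a"
    and a: "a \<in> carrier A"
  shows "bracket \<g> x y (\<theta> a) = (e \<otimes> e') \<otimes> bracket \<g> x y a"
proof -
  \<comment> \<open>Stated for all pairs, because the commutator needs it in both orders.\<close>
  have *: "bilift x y (\<Delta> (\<theta> a)) = (e \<otimes> e') \<otimes> bilift x y (\<Delta> a)"
    if x: "x \<in> carrier \<g>" and y: "y \<in> carrier \<g>" and e: "e \<in> carrier R" "e' \<in> carrier R"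
    and xe: "\<And>a. a \<in> carrier A \<Longrightarrow> x (\<theta> a) = e \<otimes> x a"
    and ye: "\<And>a. a \<in> carrier A \<Longrightarrow> y (\<theta> a) = e' \<otimes> y a" for x y e e'
  proof -
    note l = der_linear_form[OF x] der_linear_form[OF y]
    have tc: "\<theta>\<theta> X \<in> carrier AA" if "X \<in> carrier AA" for X
      unfolding tensor_map_def using that by (rule AA.lift_closed[OF AA.T_abelian_group tt_balanced])
    have "bilift x y (\<theta>\<theta> X) = (e \<otimes> e') \<otimes> bilift x y X" if "X \<in> carrier AA" for X
      using that
    proof (induction rule: AA.tensor_induct)
      case (pure m n)
      then show ?case using e
        by (simp add: tt_pure bilift_pure l xe ye der_closed[OF x] der_closed[OF y] R.m_ac)
    next
      case (add X Y)
      then show ?case using e by (simp add: tt_add bilift_add bilift_closed tc l R.r_distr)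
    qed
    then show ?thesis using involution_comult[OF a] comult_closed[OF a] by simp
  qed
  have c: "bilift x y (\<Delta> a) \<in> carrier R" "bilift y x (\<Delta> a) \<in> carrier R"
    using x y a by (simp_all add: bilift_closed der_linear_form comult_closed)
  have "bracket \<g> x y (\<theta> a) = (e \<otimes> e') \<otimes> bilift x y (\<Delta> a) \<ominus> (e \<otimes> e') \<otimes> bilift y x (\<Delta> a)"
    using *[OF x y e xe ye] *[OF y x e(2) e(1) ye xe] a e by (simp add: lie_simps R.m_comm[of e' e])
  then show ?thesis using a c e by (simp add: lie_simps a_minus_def R.r_distr R.r_minus)
qed

lemma bracket_gp_gp:
  assumes "x \<in> gp" "y \<in> gp" shows "bracket \<g> x y \<in> gp"
proof (rule gpI)
  show c: "bracket \<g> x y \<in> carrier \<g>" using assms by (intro bracket_closed gp_apply)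
  show "bracket \<g> x y (\<theta> a) = bracket \<g> x y a" if a: "a \<in> carrier A" for a
    using bracket_theta[OF gp_apply(1)[OF assms(1)] gp_apply(1)[OF assms(2)] R.one_closed R.one_closed _ _ a]
      gp_apply assms der_closed[OF c a] by (simp add: der_closed)
qed

lemma bracket_gp_gm:
  assumes "x \<in> gp" "y \<in> gm" shows "bracket \<g> x y \<in> gm"
proof (rule gmI)
  show c: "bracket \<g> x y \<in> carrier \<g>" using assms by (intro bracket_closed gp_apply gm_apply)
  show "bracket \<g> x y (\<theta> a) = \<ominus> bracket \<g> x y a" if a: "a \<in> carrier A" for a
    using bracket_theta[OF gp_apply(1)[OF assms(1)] gm_apply(1)[OF assms(2)] R.one_closed
        R.a_inv_closed[OF R.one_closed] _ _ a]
      gp_apply gm_apply assms der_closed[OF c a] by (simp add: der_closed R.l_minus)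
qed

lemma bracket_gm_gm:
  assumes "x \<in> gm" "y \<in> gm" shows "bracket \<g> x y \<in> gp"
proof (rule gpI)
  show c: "bracket \<g> x y \<in> carrier \<g>" using assms by (intro bracket_closed gm_apply)
  show "bracket \<g> x y (\<theta> a) = bracket \<g> x y a" if a: "a \<in> carrier A" for a
    using bracket_theta[OF gm_apply(1)[OF assms(1)] gm_apply(1)[OF assms(2)] R.a_inv_closed[OF R.one_closed]
        R.a_inv_closed[OF R.one_closed] _ _ a]
      gm_apply assms der_closed[OF c a] by (simp add: der_closed R.l_minus R.r_minus)
qed

text \<open>The bracket adds shifts, as the forms in \<open>hat_laurent_comult\<close> do. Shifts 0
  and 1 are again those of extended derivations; shift 2 arises from two odd derivations, although
  their bracket is even.\<close>

lemma iota_bracket: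
  assumes x: "x \<in> carrier \<g>" "\<And>u. u \<in> carrier C \<Longrightarrow> \<iota> (cder x u) = hat p x u"
    and y: "y \<in> carrier \<g>" "\<And>u. u \<in> carrier C \<Longrightarrow> \<iota> (cder y u) = hat q y u"
    and u: "u \<in> carrier C"
  shows "\<iota> (bracket \<h> (cder x) (cder y) u) = hat (p + q) (bracket \<g> x y) u"
proof
  fix i
  let ?D = "contraction_comult R A \<Delta> \<theta> u"
  let ?b = "LC.bilift (cder x) (cder y) ?D" and ?b' = "LC.bilift (cder y) (cder x) ?D"
  note l = LC.der_linear_form[OF cder_closed_lie[OF x(1)]] LC.der_linear_form[OF cder_closed_lie[OF y(1)]]
  note lx = der_linear_form[OF x(1)] and ly = der_linear_form[OF y(1)]
  have c: "?b \<in> carrier (UP R)" "?b' \<in> carrier (UP R)"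
    using u by (simp_all add: LC.bilift_closed l contraction_comult)
  have "bracket \<h> (cder x) (cder y) u = ?b \<ominus>\<^bsub>UP R\<^esub> ?b'"
    using u by (simp add: LC.lie_simps)
  \<comment> \<open>The difference is restated as a sum, which \<open>poly_to_laurent_add\<close>
    handles; \<open>R.add.inv_solve_right\<close> turns it back at the end.\<close>
  then have cb: "bracket \<h> (cder x) (cder y) u \<in> carrier (UP R)"
    and "bracket \<h> (cder x) (cder y) u \<oplus>\<^bsub>UP R\<^esub> ?b' = ?b"
    using c by (simp_all add: a_minus_def C.R.a_assoc C.R.l_neg)
  then have "\<iota> (bracket \<h> (cder x) (cder y) u) i \<oplus> \<iota> ?b' i = \<iota> ?b i"
    using fun_cong[OF R.poly_to_laurent_add[OF cb c(2)], of i] by (simp add: R.MR_add)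
  moreover have "\<iota> ?b i = hat (p + q) (\<lambda>a. bilift x y (\<Delta> a)) u i"
    using iota_bilift[OF l(1) x(2) lx l(2) y(2) ly u] by simp
  moreover have "\<iota> ?b' i = hat (p + q) (\<lambda>a. bilift y x (\<Delta> a)) u i"
    using iota_bilift[OF l(2) y(2) ly l(1) x(2) lx u] by (simp add: add.commute)
  moreover have "\<iota> (bracket \<h> (cder x) (cder y) u) i \<in> carrier R"
    using R.poly_to_laurent_closed[OF cb] by (rule R.MR_closed)
  moreover have "u (i - (p + q)) \<in> carrier A" using graded_closed[OF C_graded_coeff[OF u]] .
  ultimately show "\<iota> (bracket \<h> (cder x) (cder y) u) i = hat (p + q) (bracket \<g> x y) u i"
    by (simp add: hat_def lie_simps bilift_closed lx ly comult_closed a_minus_def R.add.inv_solve_right)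
qed

lemma bracket_undefined: "u \<notin> carrier C \<Longrightarrow> bracket \<h> D E u = undefined"
  by (simp add: LC.lie_simps)

lemma bracket_cder_gp_gp:
  assumes x: "x \<in> gp" and y: "y \<in> gp"
  shows "bracket \<h> (cder x) (cder y) = cder (bracket \<g> x y)"
proof
  fix u show "bracket \<h> (cder x) (cder y) u = cder (bracket \<g> x y) u"
  proof (cases "u \<in> carrier C")
    case True
    then show ?thesis
      using iota_bracket[OF gp_apply(1)[OF x] cder_gp[OF x] gp_apply(1)[OF y] cder_gp[OF y] True]
        cder_gp[OF bracket_gp_gp[OF x y] True] by (intro iota_inj) simp
  qed (simp add: bracket_undefined cder_def)
qed

lemma bracket_cder_gp_gm:
  assumes x: "x \<in> gp" and y: "y \<in> gm"
  shows "bracket \<h> (cder x) (cder y) = cder (bracket \<g> x y)"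
proof
  fix u show "bracket \<h> (cder x) (cder y) u = cder (bracket \<g> x y) u"
  proof (cases "u \<in> carrier C")
    case True
    then show ?thesis
      using iota_bracket[OF gp_apply(1)[OF x] cder_gp[OF x] gm_apply(1)[OF y] cder_gm[OF y] True]
        cder_gm[OF bracket_gp_gm[OF x y] True] by (intro iota_inj) simp
  qed (simp add: bracket_undefined cder_def)
qed

lemma hat_two:
  assumes x: "linear_form x" and u: "u \<in> carrier L"
  shows "hat 2 x u = s 2 \<otimes>\<^bsub>K\<^esub> hat 0 x u"
  using u[simplified]
proof (induction rule: MR_induct)
  case (monomial a i)
  then show ?case
    by (simp add: hat_monomial[OF x] R.monomial_mult semilinearD[OF x] add.commute)
next
  case (add u v)
  then show ?case using hat_add[OF x, of u v] hat_closed[OF x]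
    by (simp add: L.R.r_distr s_closed)
qed

lemma bracket_cder_gm_gm:
  assumes x: "x \<in> gm" and y: "y \<in> gm"
  shows "bracket \<h> (cder x) (cder y) = t \<odot>\<^bsub>\<h>\<^esub> cder (bracket \<g> x y)"
proof
  fix u show "bracket \<h> (cder x) (cder y) u = (t \<odot>\<^bsub>\<h>\<^esub> cder (bracket \<g> x y)) u"
  proof (cases "u \<in> carrier C")
    case True
    note z = bracket_gm_gm[OF x y]
    note zl = der_linear_form[OF gp_apply(1)[OF z]]
    have "\<iota> (t \<otimes>\<^bsub>UP R\<^esub> cder (bracket \<g> x y) u) = hat 2 (bracket \<g> x y) u"
      using hat_two[OF zl C_subset[OF True]] cder_gp[OF z True] cder_closed[OF gp_apply(1)[OF z] True]
      by (simp add: R.poly_to_laurent_mult t_closed iota_t del: One_nat_def)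
    then show ?thesis
      using iota_bracket[OF gm_apply(1)[OF x] cder_gm[OF x] gm_apply(1)[OF y] cder_gm[OF y] True] True
      by (intro iota_inj) (simp add: LC.lie_simps(3))
  qed (simp add: bracket_undefined LC.lie_simps(3))
qed

lemma bracket_cder_gp:
  assumes x: "x \<in> gp" and y: "y \<in> carrier \<g>"
  shows "bracket \<h> (cder x) (cder y) = cder (bracket \<g> x y)"
proof -
  note p = gsym_gp[OF y] and m = galt_gm[OF y]
  note c = gp_apply(1)[OF p] gm_apply(1)[OF m] gp_apply(1)[OF x]
  have "bracket \<h> (cder x) (cder (gsym y \<oplus>\<^bsub>\<g>\<^esub> galt y)) = cder (bracket \<g> x (gsym y \<oplus>\<^bsub>\<g>\<^esub> galt y))"
    by (simp add: c cder_add LC.bracket_add_right cder_closed_lie bracket_cder_gp_gp[OF x p]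
        bracket_cder_gp_gm[OF x m] bracket_add_right bracket_closed)
  then show ?thesis using y by (simp add: gsym_add_galt)
qed

text \<open>\<open>bracket_closed\<close> uses the Hopf axioms, which are available for
  \<open>A\<close> only. Here membership is read off from the explicit brackets of extended
  eigenvectors and spread by additivity.\<close>

lemma bracket_cder_closed:
  assumes x: "x \<in> carrier \<g>" and y: "y \<in> carrier \<g>"
  shows "bracket \<h> (cder x) (cder y) \<in> carrier \<h>"
proof -
  have 1: "bracket \<h> (cder v) (cder w) \<in> carrier \<h>" if "v \<in> gp" "w \<in> carrier \<g>" for v w
    using that gp_apply(1)[OF that(1)] by (simp add: bracket_cder_gp cder_closed_lie bracket_closed)
  have 2: "bracket \<h> (cder v) (cder w) \<in> carrier \<h>" if "v \<in> gm" "w \<in> gm" for v w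
    using that gm_apply(1)[OF that(1)] gm_apply(1)[OF that(2)]
    by (simp add: bracket_cder_gm_gm cder_closed_lie bracket_closed t_closed del: One_nat_def)
  \<comment> \<open>\<open>bracket_swap\<close> asks that the opposite bracket be a derivation
    already, which is what fact \<open>1\<close> provides.\<close>
  have 3: "bracket \<h> (cder v) (cder w) \<in> carrier \<h>" if v: "v \<in> gm" and w: "w \<in> gp" for v w
    using LC.bracket_swap[OF cder_closed_lie[OF gm_apply(1)[OF v]] cder_closed_lie[OF gp_apply(1)[OF w]]
        1[OF w gm_apply(1)[OF v]]] 1[OF w gm_apply(1)[OF v]] by simp
  have 4: "bracket \<h> (cder v) (cder y) \<in> carrier \<h>" if v: "v \<in> gm" for v
  proof -
    note p = gsym_gp[OF y] and m = galt_gm[OF y]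
    note c = gp_apply(1)[OF p] gm_apply(1)[OF m] gm_apply(1)[OF v]
    have "bracket \<h> (cder v) (cder (gsym y \<oplus>\<^bsub>\<g>\<^esub> galt y)) \<in> carrier \<h>"
      by (simp add: c cder_add LC.bracket_add_right cder_closed_lie 2[OF v m] 3[OF v p])
    then show ?thesis using y by (simp add: gsym_add_galt)
  qed
  note p = gsym_gp[OF x] and m = galt_gm[OF x]
  note c = gp_apply(1)[OF p] gm_apply(1)[OF m] y
  have "bracket \<h> (cder (gsym x \<oplus>\<^bsub>\<g>\<^esub> galt x)) (cder y) \<in> carrier \<h>"
    by (simp add: c cder_add LC.bracket_add_left cder_closed_lie 1[OF p y] 4[OF m])
  then show ?thesis using x by (simp add: gsym_add_galt)
qed

end

section \<open>The isomorphism\<close>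

lemma (in hopf_algebra) counit_one: "\<epsilon> \<one>\<^bsub>A\<^esub> = \<one>"
  using counit_hom by (auto simp: ring_hom_def)

lemma (in hopf_algebra) der_one:
  assumes D: "D \<in> carrier \<g>" shows "D \<one>\<^bsub>A\<^esub> = \<zero>"
  using der_mult[OF D, of "\<one>\<^bsub>A\<^esub>" "\<one>\<^bsub>A\<^esub>"] der_closed[OF D, of "\<one>\<^bsub>A\<^esub>"] by (simp add: counit_one)

text \<open>The images of the \<open>n\<close> variables generate \<open>A\<close>. By the Leibniz
  rule a derivation that kills them kills all monomials, and it kills constants since it kills the
  unit.\<close>

lemma (in hopf_algebra) derivation_finitely_determined:
  assumes fp: "finitely_presented_algebra R A"
  shows "\<exists>X. finite X \<and> X \<subseteq> carrier A \<and>
    (\<forall>D\<in>carrier \<g>. (\<forall>x\<in>X. D x = \<zero>) \<longrightarrow> (\<forall>a\<in>carrier A. D a = \<zero>))"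
proof -
  obtain n f where hom: "f \<in> ring_hom (mpoly_ring R n) A"
    and fconst: "\<And>c. c \<in> carrier R \<Longrightarrow> f (monomial R c 0) = c \<odot>\<^bsub>A\<^esub> \<one>\<^bsub>A\<^esub>"
    and surj: "f ` carrier (mpoly_ring R n) = carrier A"
    using fp unfolding finitely_presented_algebra_def by (elim exE conjE) (rule that; simp)
  let ?P = "mpoly_ring R n"
  have ops: "p \<otimes>\<^bsub>?P\<^esub> q = p \<otimes>\<^bsub>monoid_ring R\<^esub> q" "p \<oplus>\<^bsub>?P\<^esub> q = p \<oplus>\<^bsub>monoid_ring R\<^esub> q" for p q
    by (simp_all add: mpoly_ring_def)
  have carr: "p \<in> carrier ?P \<longleftrightarrow> p \<in> carrier (monoid_ring R) \<and> {m. p m \<noteq> \<zero>} \<subseteq> {m. Poly_Mapping.keys m \<subseteq> {..<n}}" for p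
    by (auto simp: mpoly_ring_def)
  have mono: "monomial R c m \<in> carrier ?P" if "c \<in> carrier R" "Poly_Mapping.keys m \<subseteq> {..<n}" for c m
    using that by (auto simp: carr R.monomial_closed) (auto simp: monomial_def split: if_splits)
  have f_closed: "f p \<in> carrier A" if "p \<in> carrier ?P" for p using that hom by (auto simp: ring_hom_def)
  have f_mult: "f (p \<otimes>\<^bsub>monoid_ring R\<^esub> q) = f p \<otimes>\<^bsub>A\<^esub> f q" if "p \<in> carrier ?P" "q \<in> carrier ?P" for p q
    using that hom by (auto simp: ring_hom_def ops)
  have f_add: "f (p \<oplus>\<^bsub>monoid_ring R\<^esub> q) = f p \<oplus>\<^bsub>A\<^esub> f q" if "p \<in> carrier ?P" "q \<in> carrier ?P" for p q
    using that hom by (auto simp: ring_hom_def ops)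
  let ?x = "\<lambda>i. f (monomial R \<one> (Poly_Mapping.single i 1))"
  show ?thesis
  proof (intro exI conjI ballI impI)
    show "finite (?x ` {..<n})" by simp
    show "?x ` {..<n} \<subseteq> carrier A" by (auto intro!: f_closed mono)
    fix D a assume D: "D \<in> carrier \<g>" and z: "\<forall>x\<in>?x ` {..<n}. D x = \<zero>" and a: "a \<in> carrier A"
    have prod: "D (f (monomial R \<one> (m + m'))) = \<zero>"
      if "Poly_Mapping.keys m \<subseteq> {..<n}" "Poly_Mapping.keys m' \<subseteq> {..<n}"
        "D (f (monomial R \<one> m)) = \<zero>" "D (f (monomial R \<one> m')) = \<zero>" for m m'
    proof -
      have "f (monomial R \<one> (m + m')) = f (monomial R \<one> m) \<otimes>\<^bsub>A\<^esub> f (monomial R \<one> m')"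
        using that by (subst f_mult[symmetric]) (auto simp: R.monomial_mult mono)
      then show ?thesis using that by (simp add: der_mult[OF D] f_closed mono counit_closed)
    qed
    have single: "D (f (monomial R \<one> (Poly_Mapping.single i k))) = \<zero>" if i: "i < n" for i and k :: nat
    proof (induction k)
      case 0
      then show ?case using fconst[of "\<one>"] by (simp add: der_one[OF D])
    next
      case (Suc k)
      have "Poly_Mapping.single i (Suc k) = Poly_Mapping.single i 1 + Poly_Mapping.single i k"
        by (simp add: single_add[symmetric])
      then show ?case using Suc z i by (simp only:) (rule prod, auto)
    qed
    have monic: "Poly_Mapping.keys m \<subseteq> {..<n} \<longrightarrow> D (f (monomial R \<one> m)) = \<zero>" for m
    proof (induction m rule: update_induct)
      case const
      then show ?case using fconst[of "\<one>"] by (simp add: der_one[OF D])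
    next
      case (update m i k)
      \<comment> \<open>\<open>i\<close> does not yet occur in \<open>m\<close>, so updating is the
        same as adding exponents, that is, multiplying monomials.\<close>
      have "Poly_Mapping.update i k m = Poly_Mapping.single i k + m"
        using update(1) by (intro poly_mapping_eqI) (auto simp: lookup_update lookup_add lookup_single in_keys_iff when_def)
      moreover have "Poly_Mapping.keys (Poly_Mapping.update i k m) = insert i (Poly_Mapping.keys m)"
        using update by (simp add: keys_update)
      ultimately show ?case using update single[of i k] by (auto intro: prod)
    qed
    obtain p where p: "p \<in> carrier ?P" "a = f p" using surj a by blast
    then have p': "p \<in> carrier (monoid_ring R)" "{m. p m \<noteq> \<zero>} \<subseteq> {m. Poly_Mapping.keys m \<subseteq> {..<n}}"
      by (simp_all add: carr)
    \<comment> \<open>The hypotheses on \<open>f\<close> concern only polynomials in the first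
      \<open>n\<close> variables, so the summands must stay among these; hence the induction with
      restricted support.\<close>
    have "D (f p) = \<zero>"
      using p'
    proof (induction rule: R.MR_induct_support)
      case (monomial c m)
      then have m: "Poly_Mapping.keys m \<subseteq> {..<n}" by simp
      have "f (monomial R c m) = f (monomial R c 0) \<otimes>\<^bsub>A\<^esub> f (monomial R \<one> m)"
        using monomial m by (subst f_mult[symmetric]) (auto simp: R.monomial_mult mono)
      also have "\<dots> = c \<odot>\<^bsub>A\<^esub> f (monomial R \<one> m)"
        using monomial m by (simp add: fconst smult_assoc2 f_closed mono)
      finally show ?case using monomial m monic by (simp add: der_smult[OF D] f_closed mono)
    next
      case zero
      have "f \<zero>\<^bsub>monoid_ring R\<^esub> = \<zero> \<odot>\<^bsub>A\<^esub> \<one>\<^bsub>A\<^esub>"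
        using fconst[of "\<zero>"] by (simp add: R.monomial_zero)
      then show ?case by (simp add: der_zero[OF D])
    next
      case (add u v)
      then have "u \<in> carrier ?P" "v \<in> carrier ?P" by (simp_all add: carr)
      then show ?case using add by (simp add: f_add der_add[OF D] f_closed)
    qed
    then show "D a = \<zero>" using p by simp
  qed
qed

text \<open>Both claims share one induction because reading a coefficient off a sum by
  \<open>UP_add\<close> requires membership of the summands.\<close>

lemma (in cring) UP_finsum_monom:
  assumes c: "\<And>n. c n \<in> carrier R"
  shows "(\<Oplus>\<^bsub>UP R\<^esub>n\<in>{..N}. monom (UP R) (c n) n) \<in> carrier (UP R) \<and>
    (\<Oplus>\<^bsub>UP R\<^esub>n\<in>{..N}. monom (UP R) (c n) n) m = (if m \<le> N then c m else \<zero>)"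
proof -
  interpret U: cring "UP R" by (rule UP_cring)
  show ?thesis
  proof (induction N)
    case 0
    have "(\<Oplus>\<^bsub>UP R\<^esub>n\<in>{..0}. monom (UP R) (c n) n) = monom (UP R) (c 0) 0"
      using c by (subst U.finsum_0) (auto simp: monom_in_UP)
    then show ?case using c by (simp only:) (simp add: monom_in_UP, simp add: UP_monom)
  next
    case (Suc N)
    let ?s = "\<Oplus>\<^bsub>UP R\<^esub>n\<in>{..N}. monom (UP R) (c n) n" and ?m = "monom (UP R) (c (Suc N)) (Suc N)"
    have cl: "?s \<in> carrier (UP R)" "?m \<in> carrier (UP R)"
      using Suc c by (blast intro: monom_in_UP)+
    have "(\<Oplus>\<^bsub>UP R\<^esub>n\<in>{..Suc N}. monom (UP R) (c n) n) = ?m \<oplus>\<^bsub>UP R\<^esub> ?s"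
      using c by (intro U.finsum_Suc) (auto simp: monom_in_UP)
    moreover have "?m \<oplus>\<^bsub>UP R\<^esub> ?s \<in> carrier (UP R)" by (rule U.a_closed[OF cl(2,1)])
    moreover have "?m m = (if m = Suc N then c (Suc N) else \<zero>)"
      using c by (simp add: UP_monom)
    moreover have "(?m \<oplus>\<^bsub>UP R\<^esub> ?s) m = ?m m \<oplus> ?s m" by (rule UP_add[OF cl(2,1)])
    moreover have "?s m = (if m \<le> N then c m else \<zero>)" using Suc by blast
    ultimately show ?case using c by (simp only:) (auto simp: le_Suc_eq)
  qed
qed

section \<open>The map from \<open>\<g> \<otimes> k[t]\<close> to derivations, and its
  injectivity\<close>

context contraction
begin

text \<open>\<open>GT\<close> and \<open>G\<close> have the same elements and the same addition. The
  first is a module over \<open>k\<close>, where the results on tensor products apply; the second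
  carries the action of \<open>k[t]\<close>.\<close>

abbreviation "GT \<equiv> tensor_product R \<g> (UP R)"
abbreviation "G \<equiv> base_change R \<g> (UP R)"

sublocale UPm: algebra R "UP R" by (rule R.UP_algebra)

sublocale GT: tensor_pair R \<g> "UP R"
  by (simp add: tensor_pair_def lie_module UPm.module)

lemma G_simps [simp]:
  "carrier G = carrier GT" "ring.add G = ring.add GT" "ring.zero G = ring.zero GT"
  by (simp_all add: base_change_def Let_def)

lemma G_smult: "b \<odot>\<^bsub>G\<^esub> X = tensor_lift GT (\<lambda>x p. pure_tensor R \<g> (UP R) x (b \<otimes>\<^bsub>UP R\<^esub> p)) X"
  by (simp add: base_change_def Let_def)

lemma UP_mult_smult:
  assumes "b \<in> carrier (UP R)" "r \<in> carrier R" "p \<in> carrier (UP R)"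
  shows "b \<otimes>\<^bsub>UP R\<^esub> (r \<odot>\<^bsub>UP R\<^esub> p) = r \<odot>\<^bsub>UP R\<^esub> (b \<otimes>\<^bsub>UP R\<^esub> p)"
  using assms UPm.smult_assoc2[of r p b] by (simp add: C.R.m_comm)

lemma G_balanced:
  assumes b: "b \<in> carrier (UP R)"
  shows "balanced_map R \<g> (UP R) GT (\<lambda>x p. pure_tensor R \<g> (UP R) x (b \<otimes>\<^bsub>UP R\<^esub> p))"
  using b by (simp add: balanced_map_def GT.pure_add_left GT.pure_add_right C.R.r_distr GT.pure_balanced
      UP_mult_smult)

lemma G_smult_closed: "b \<in> carrier (UP R) \<Longrightarrow> X \<in> carrier GT \<Longrightarrow> b \<odot>\<^bsub>G\<^esub> X \<in> carrier GT"
  unfolding G_smult by (rule GT.lift_closed[OF GT.T_abelian_group G_balanced])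

lemma G_smult_add:
  "b \<in> carrier (UP R) \<Longrightarrow> X \<in> carrier GT \<Longrightarrow> Y \<in> carrier GT \<Longrightarrow>
    b \<odot>\<^bsub>G\<^esub> (X \<oplus>\<^bsub>GT\<^esub> Y) = b \<odot>\<^bsub>G\<^esub> X \<oplus>\<^bsub>GT\<^esub> b \<odot>\<^bsub>G\<^esub> Y"
  unfolding G_smult by (rule GT.lift_add[OF GT.T_abelian_group G_balanced])

lemma G_smult_pure:
  "b \<in> carrier (UP R) \<Longrightarrow> x \<in> carrier \<g> \<Longrightarrow> p \<in> carrier (UP R) \<Longrightarrow>
    b \<odot>\<^bsub>G\<^esub> pure_tensor R \<g> (UP R) x p = pure_tensor R \<g> (UP R) x (b \<otimes>\<^bsub>UP R\<^esub> p)"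
  unfolding G_smult by (rule GT.lift_pure[OF GT.T_abelian_group G_balanced])

lemma G_abelian_group: "abelian_group G"
  by (rule abelian_group_comm_group[OF GT.T.add.comm_group_axioms]) simp_all

definition F :: "('c \<Rightarrow> 'a, nat \<Rightarrow> 'a) tensor \<Rightarrow> (int \<Rightarrow> 'c) \<Rightarrow> nat \<Rightarrow> 'a" where
  "F = tensor_lift \<h> (\<lambda>x p. p \<odot>\<^bsub>\<h>\<^esub> cder x)"

lemma F_balanced: "balanced_map R \<g> (UP R) \<h> (\<lambda>x p. p \<odot>\<^bsub>\<h>\<^esub> cder x)"
proof -
  have "p \<odot>\<^bsub>\<h>\<^esub> cder (r \<odot>\<^bsub>\<g>\<^esub> x) = (r \<odot>\<^bsub>UP R\<^esub> p) \<odot>\<^bsub>\<h>\<^esub> cder x"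
    if "r \<in> carrier R" "x \<in> carrier \<g>" "p \<in> carrier (UP R)" for r x p
  proof -
    \<comment> \<open>A scalar of \<open>k\<close> acts on \<open>k[t]\<close> as the corresponding
      constant polynomial, which then acts on derivations.\<close>
    have "r \<odot>\<^bsub>UP R\<^esub> p = p \<otimes>\<^bsub>UP R\<^esub> monom (UP R) r 0"
    proof
      fix n
      have "(p \<otimes>\<^bsub>UP R\<^esub> monom (UP R) r 0) = (monom (UP R) r 0 \<otimes>\<^bsub>UP R\<^esub> p)"
        using that by (simp add: C.R.m_comm R.monom_in_UP)
      then show "(r \<odot>\<^bsub>UP R\<^esub> p) n = (p \<otimes>\<^bsub>UP R\<^esub> monom (UP R) r 0) n"
        using that by (simp add: R.UP_mult_const R.UP_smult)
    qed
    then show ?thesis using that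
      by (simp add: cder_smult LC.G.smult_assoc1 cder_closed_lie R.monom_in_UP)
  qed
  then show ?thesis
    by (simp add: balanced_map_def cder_closed_lie cder_add LC.G.smult_r_distr LC.G.smult_l_distr)
qed

lemmas F_pure = GT.lift_pure[OF LC.G.abelian_group_axioms F_balanced, folded F_def]
lemmas F_add = GT.lift_add[OF LC.G.abelian_group_axioms F_balanced, folded F_def]
lemmas F_closed = GT.lift_closed[OF LC.G.abelian_group_axioms F_balanced, folded F_def]
lemmas F_zero = GT.lift_zero[OF LC.G.abelian_group_axioms F_balanced, folded F_def]
lemmas F_minus = GT.lift_minus[OF LC.G.abelian_group_axioms F_balanced, folded F_def]
lemmas F_finsum = GT.lift_finsum[OF LC.G.abelian_group_axioms F_balanced, folded F_def]

lemma F_smult: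
  assumes "b \<in> carrier (UP R)" "X \<in> carrier GT"
  shows "F (b \<odot>\<^bsub>G\<^esub> X) = b \<odot>\<^bsub>\<h>\<^esub> F X"
  using assms(2)
proof (induction rule: GT.tensor_induct)
  case (pure x p)
  then show ?case using assms(1)
    by (simp add: G_smult_pure F_pure LC.G.smult_assoc1 cder_closed_lie)
next
  case (add X Y)
  then show ?case using assms(1)
    by (simp add: G_smult_add F_add G_smult_closed LC.G.smult_r_distr F_closed)
qed

lemma lie_finsum_apply:
  assumes "finite I" "\<And>i. i \<in> I \<Longrightarrow> D i \<in> carrier \<h>" and u: "u \<in> carrier C"
  shows "(finsum \<h> D I) u = (\<Oplus>\<^bsub>UP R\<^esub>i\<in>I. D i u)"
  using assms(1,2)
proof (induction I rule: finite_induct)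
  case empty
  then show ?case using u by (simp add: LC.G.finsum_empty) (simp add: LC.lie_simps)
next
  case (insert i I)
  then have "finsum \<h> D (insert i I) = D i \<oplus>\<^bsub>\<h>\<^esub> finsum \<h> D I"
    by (intro LC.G.finsum_insert) auto
  then show ?case using insert u
    by (subst C.R.finsum_insert) (auto simp: LC.lie_simps(2) LC.der_closed)
qed

text \<open>Together with \<open>cder_shift\<close> this recovers \<open>x\<close> from
  \<open>cder x\<close> on both eigenspaces. The values are constant polynomials, so multiplying by
  \<open>t^n\<close> puts them in degree \<open>n\<close> alone.\<close>

lemma cder_const: "x \<in> carrier \<g> \<Longrightarrow> a \<in> Ap \<Longrightarrow> cder x (monomial A a 0) = monom (UP R) (x a) 0"
  using C_plus[of a] der_closed[of x a] der_zero[of x]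
  by (auto simp: cder_def R.UP_monom plus_iff monomial_def fun_eq_iff)

lemma cder_shift: "x \<in> carrier \<g> \<Longrightarrow> a \<in> Am \<Longrightarrow> cder x (monomial A a (- 1)) = monom (UP R) (x a) 0"
  using C_minus[of a] der_closed[of x a] der_zero[of x]
  by (auto simp: cder_def R.UP_monom minus_iff monomial_def fun_eq_iff)

abbreviation "tpow n \<equiv> monom (UP R) \<one> n"
text \<open>Elements of \<open>\<g> \<otimes> k[t]\<close> seen as polynomials in \<open>t\<close>
  with coefficients in \<open>\<g>\<close>.\<close>

abbreviation "series N x \<equiv> (\<Oplus>\<^bsub>GT\<^esub>n\<in>{..N}. pure_tensor R \<g> (UP R) (x n) (tpow n))"

lemma F_series:
  assumes x: "\<And>n. x n \<in> carrier \<g>" and u: "u \<in> carrier C" and a: "a \<in> carrier A"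
    and v: "\<And>n. cder (x n) u = monom (UP R) (x n a) 0"
  shows "F (series N x) u m = (if m \<le> N then x m a else \<zero>)"
proof -
  have tc: "tpow n \<in> carrier (UP R)" for n by (simp add: R.monom_in_UP)
  have xa: "x n a \<in> carrier R" for n using der_closed[OF x a] .
  have "F (series N x) = (\<Oplus>\<^bsub>\<h>\<^esub>n\<in>{..N}. F (pure_tensor R \<g> (UP R) (x n) (tpow n)))"
    by (rule F_finsum) (simp_all add: x tc)
  also have "\<dots> = (\<Oplus>\<^bsub>\<h>\<^esub>n\<in>{..N}. tpow n \<odot>\<^bsub>\<h>\<^esub> cder (x n))"
    by (rule LC.G.finsum_cong') (simp_all add: F_pure x tc cder_closed_lie)
  finally have "F (series N x) u = (\<Oplus>\<^bsub>UP R\<^esub>n\<in>{..N}. (tpow n \<odot>\<^bsub>\<h>\<^esub> cder (x n)) u)"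
    using u by (simp add: lie_finsum_apply x tc cder_closed_lie)
  also have "\<dots> = (\<Oplus>\<^bsub>UP R\<^esub>n\<in>{..N}. monom (UP R) (x n a) n)"
    by (rule C.R.finsum_cong') (use u in \<open>simp_all add: LC.lie_simps(3) v R.UP_monom_mult_monom xa R.monom_in_UP\<close>)
  finally show ?thesis using R.UP_finsum_monom[of "\<lambda>n. x n a" N m] xa by simp
qed

text \<open>Allowing every length beyond \<open>N\<close> lets two representations be brought to a
  common length and added coefficientwise.\<close>

lemma series_rep:
  assumes "X \<in> carrier GT"
  shows "\<exists>N x. (\<forall>n. x n \<in> carrier \<g>) \<and> (\<forall>M\<ge>N. X = series M x)"
  using assms
proof (induction rule: GT.tensor_induct)
  case (pure x p)
  obtain N where N: "\<forall>n>N. p n = \<zero>" using pure by (auto simp: R.UP_carrier)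
  have pc: "p n \<in> carrier R" for n using pure by (simp add: R.UP_closed)
  have tc: "tpow n \<in> carrier (UP R)" for n by (simp add: R.monom_in_UP)
  have "pure_tensor R \<g> (UP R) x p = series M (\<lambda>n. p n \<odot>\<^bsub>\<g>\<^esub> x)" if M: "M \<ge> N" for M
  proof -
    have "p = (\<Oplus>\<^bsub>UP R\<^esub>n\<in>{..M}. monom (UP R) (p n) n)"
      using R.UP_finsum_monom[of p M] pc N M by (auto simp: fun_eq_iff)
    then have "pure_tensor R \<g> (UP R) x p = pure_tensor R \<g> (UP R) x (\<Oplus>\<^bsub>UP R\<^esub>n\<in>{..M}. monom (UP R) (p n) n)"
      by simp
    also have "\<dots> = (\<Oplus>\<^bsub>GT\<^esub>n\<in>{..M}. pure_tensor R \<g> (UP R) x (monom (UP R) (p n) n))"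
    proof (induction M)
      case 0
      then show ?case using pure pc by (simp add: R.monom_in_UP)
    next
      case (Suc M)
      then show ?case using pure pc conjunct1[OF R.UP_finsum_monom[of p M 0, OF pc]]
        by (simp add: R.monom_in_UP C.R.finsum_Suc GT.T.finsum_Suc GT.pure_add_right)
    qed
    also have "\<dots> = series M (\<lambda>n. p n \<odot>\<^bsub>\<g>\<^esub> x)"
    proof (rule GT.T.finsum_cong'[OF refl])
      show "pure_tensor R \<g> (UP R) x (monom (UP R) (p n) n) = pure_tensor R \<g> (UP R) (p n \<odot>\<^bsub>\<g>\<^esub> x) (tpow n)" for n
        using pure pc by (simp add: GT.pure_balanced tc R.UP_smult_monom)
    qed (use pure pc tc in auto)
    finally show ?thesis .
  qed
  then show ?case using pure pc by (intro exI[of _ N] exI[of _ "\<lambda>n. p n \<odot>\<^bsub>\<g>\<^esub> x"]) auto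
next
  case (add X Y)
  then obtain N x N' y where x: "\<forall>n. x n \<in> carrier \<g>" "\<forall>M\<ge>N. X = series M x"
    and y: "\<forall>n. y n \<in> carrier \<g>" "\<forall>M\<ge>N'. Y = series M y" by blast
  have tc: "tpow n \<in> carrier (UP R)" for n by (simp add: R.monom_in_UP)
  have "X \<oplus>\<^bsub>GT\<^esub> Y = series M (\<lambda>n. x n \<oplus>\<^bsub>\<g>\<^esub> y n)" if M: "M \<ge> max N N'" for M
  proof -
    have "series M (\<lambda>n. x n \<oplus>\<^bsub>\<g>\<^esub> y n) = (\<Oplus>\<^bsub>GT\<^esub>n\<in>{..M}. pure_tensor R \<g> (UP R) (x n) (tpow n) \<oplus>\<^bsub>GT\<^esub>
        pure_tensor R \<g> (UP R) (y n) (tpow n))"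
      by (rule GT.T.finsum_cong') (use x y tc in \<open>simp_all add: GT.pure_add_left\<close>)
    also have "\<dots> = series M x \<oplus>\<^bsub>GT\<^esub> series M y"
      by (rule GT.T.finsum_addf) (use x y tc in auto)
    also have "\<dots> = X \<oplus>\<^bsub>GT\<^esub> Y" using x(2)[rule_format, of M] y(2)[rule_format, of M] M by simp
    finally show ?thesis ..
  qed
  then show ?case using x y by (intro exI[of _ "max N N'"] exI[of _ "\<lambda>n. x n \<oplus>\<^bsub>\<g>\<^esub> y n"]) auto
qed

text \<open>At \<open>sym a\<close> in degree 0 and at \<open>alt a\<close> in degree -1, the image
  of a series takes the polynomial values with coefficients \<open>x m (sym a)\<close> and
  \<open>x m (alt a)\<close>. Their sum is \<open>x m a\<close>, so the image determines every
  coefficient.\<close>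

lemma F_inj: "inj_on F (carrier GT)"
proof (rule inj_onI)
  have ker: "X = \<zero>\<^bsub>GT\<^esub>" if X: "X \<in> carrier GT" and FX: "F X = \<zero>\<^bsub>\<h>\<^esub>" for X
  proof -
    obtain N x where x: "\<And>n. x n \<in> carrier \<g>" and XN: "X = series N x"
      using series_rep[OF X] by blast
    have "x m = \<zero>\<^bsub>\<g>\<^esub>" if m: "m \<le> N" for m
    proof (rule der_eqI[OF x G.zero_closed])
      fix a assume a: "a \<in> carrier A"
      have zero: "\<zero>\<^bsub>\<h>\<^esub> u m = \<zero>" if "u \<in> carrier C" for u
        using that by (simp add: LC.lie_simps R.UP_zero)
      have "x m (sym a) = F (series N x) (monomial A (sym a) 0) m"
        using F_series[of x "monomial A (sym a) 0" "sym a" N m] x a m C_plus[OF sym_plus[OF a]]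
        by (simp add: cder_const sym_plus)
      then have 1: "x m (sym a) = \<zero>" using FX XN zero C_plus[OF sym_plus[OF a]] by simp
      have "x m (alt a) = F (series N x) (monomial A (alt a) (- 1)) m"
        using F_series[of x "monomial A (alt a) (- 1)" "alt a" N m] x a m C_minus[OF alt_minus[OF a]]
        by (simp add: cder_shift alt_minus)
      then have 2: "x m (alt a) = \<zero>" using FX XN zero C_minus[OF alt_minus[OF a]] by simp
      have "x m (sym a \<oplus>\<^bsub>A\<^esub> alt a) = \<zero>" using a 1 2 der_add[OF x, of "sym a" "alt a" m] by simp
      then show "x m a = \<zero>\<^bsub>\<g>\<^esub> a" using a by (simp add: sym_add_alt lie_simps)
    qed
    then have "X = (\<Oplus>\<^bsub>GT\<^esub>n\<in>{..N}. \<zero>\<^bsub>GT\<^esub>)"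
      unfolding XN by (intro GT.T.finsum_cong') (auto simp: GT.pure_zero_left R.monom_in_UP)
    then show ?thesis by simp
  qed
  fix X Y assume XY: "X \<in> carrier GT" "Y \<in> carrier GT" "F X = F Y"
  have "F (X \<ominus>\<^bsub>GT\<^esub> Y) = \<zero>\<^bsub>\<h>\<^esub>"
    using XY by (simp add: a_minus_def F_add F_minus F_closed LC.G.r_neg)
  then have "X \<ominus>\<^bsub>GT\<^esub> Y = \<zero>\<^bsub>GT\<^esub>" using XY by (intro ker) auto
  then show "X = Y" using XY
    by (metis GT.T.minus_equality GT.T.minus_minus a_minus_def GT.T.a_inv_closed)
qed

section \<open>Surjectivity: coefficients of a derivation of the contraction algebra\<close>

lemma sym_alt_unique:
  assumes p: "p \<in> Ap" and m: "m \<in> Am"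
  shows "sym (p \<oplus>\<^bsub>A\<^esub> m) = p" "alt (p \<oplus>\<^bsub>A\<^esub> m) = m"
proof -
  have c: "p \<in> carrier A" "m \<in> carrier A" "\<theta> p = p" "\<theta> m = \<ominus>\<^bsub>A\<^esub> m"
    using p m by (auto simp: plus_iff minus_iff)
  have "(p \<oplus>\<^bsub>A\<^esub> m) \<oplus>\<^bsub>A\<^esub> (p \<oplus>\<^bsub>A\<^esub> \<ominus>\<^bsub>A\<^esub> m) = (p \<oplus>\<^bsub>A\<^esub> p) \<oplus>\<^bsub>A\<^esub> (m \<oplus>\<^bsub>A\<^esub> \<ominus>\<^bsub>A\<^esub> m)"
    using c by (simp only: M.add.m_ac M.add.m_closed M.a_inv_closed)
  then show "sym (p \<oplus>\<^bsub>A\<^esub> m) = p"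
    using c by (simp add: sym_def theta_add M.r_neg smult_r_distr half_add_self)
  have "(p \<oplus>\<^bsub>A\<^esub> m) \<oplus>\<^bsub>A\<^esub> (\<ominus>\<^bsub>A\<^esub> p \<oplus>\<^bsub>A\<^esub> m) = (m \<oplus>\<^bsub>A\<^esub> m) \<oplus>\<^bsub>A\<^esub> (p \<oplus>\<^bsub>A\<^esub> \<ominus>\<^bsub>A\<^esub> p)"
    using c by (simp only: M.add.m_ac M.add.m_closed M.a_inv_closed)
  then show "alt (p \<oplus>\<^bsub>A\<^esub> m) = m"
    using c by (simp add: alt_def theta_add M.r_neg smult_r_distr half_add_self a_minus_def M.minus_add)
qed

text \<open>The coefficients of \<open>t\<^sup>n\<close> in the preimage of \<open>D\<close> under \<open>F\<close>.\<close>

definition coef :: "((int \<Rightarrow> 'c) \<Rightarrow> nat \<Rightarrow> 'a) \<Rightarrow> nat \<Rightarrow> 'c \<Rightarrow> 'a" where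
  "coef D n = (\<lambda>a\<in>carrier A. D (monomial A (sym a) 0) n \<oplus> D (monomial A (alt a) (- 1)) n)"

context
  fixes D assumes D: "D \<in> carrier \<h>"
begin

lemma D_plus_closed: "a \<in> Ap \<Longrightarrow> D (monomial A a 0) \<in> carrier (UP R)"
  by (rule LC.der_closed[OF D C_plus])

lemma D_minus_closed: "a \<in> Am \<Longrightarrow> D (monomial A a (- 1)) \<in> carrier (UP R)"
  by (rule LC.der_closed[OF D C_minus])

lemma counit_plus: "a \<in> Ap \<Longrightarrow> contraction_counit R \<epsilon> (monomial A a 0) = monom (UP R) (\<epsilon> a) 0"
  using counit_C[OF C_plus[of a]]
  by (intro iota_inj) (simp add: hat_monomial[OF counit_linear_form] plus_iff R.poly_to_laurent_monom counit_closed)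

lemma counit_minus: "a \<in> Am \<Longrightarrow> contraction_counit R \<epsilon> (monomial A a (- 1)) = \<zero>\<^bsub>UP R\<^esub>"
proof -
  assume a: "a \<in> Am"
  have "monom (UP R) \<zero> 0 = \<zero>\<^bsub>UP R\<^esub>" by (simp add: R.UP_monom R.UP_zero)
  moreover have "contraction_counit R \<epsilon> (monomial A a (- 1)) = monom (UP R) \<zero> 0"
    using counit_C[OF C_minus[OF a]] a
    by (intro iota_inj) (simp add: hat_monomial[OF counit_linear_form] minus_iff R.poly_to_laurent_monom
        counit_minus_zero R.monomial_zero)
  ultimately show ?thesis by simp
qed

lemma D_plus_plus:
  assumes a: "a \<in> Ap" and b: "b \<in> Ap"
  shows "D (monomial A (a \<otimes>\<^bsub>A\<^esub> b) 0) n =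
    \<epsilon> a \<otimes> D (monomial A b 0) n \<oplus> D (monomial A a 0) n \<otimes> \<epsilon> b"
proof -
  have c: "a \<in> carrier A" "b \<in> carrier A" using a b by (auto simp: plus_iff)
  have e: "monom (UP R) (\<epsilon> b) 0 \<in> carrier (UP R)" using c by (simp add: R.monom_in_UP counit_closed)
  have "D (monomial A (a \<otimes>\<^bsub>A\<^esub> b) 0) = monom (UP R) (\<epsilon> a) 0 \<otimes>\<^bsub>UP R\<^esub> D (monomial A b 0) \<oplus>\<^bsub>UP R\<^esub>
      monom (UP R) (\<epsilon> b) 0 \<otimes>\<^bsub>UP R\<^esub> D (monomial A a 0)"
    using LC.der_mult[OF D C_plus[OF a] C_plus[OF b]] c e
    by (simp add: monomial_mult counit_plus a b C.R.m_comm[OF e] D_plus_closed)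
  then show ?thesis using c a b
    by (simp add: R.UP_add R.UP_mult_const D_plus_closed counit_closed R.monom_in_UP R.m_comm R.UP_closed)
qed

lemma D_plus_minus:
  assumes a: "a \<in> Ap" and b: "b \<in> Am"
  shows "D (monomial A (a \<otimes>\<^bsub>A\<^esub> b) (- 1)) n = \<epsilon> a \<otimes> D (monomial A b (- 1)) n"
proof -
  have c: "a \<in> carrier A" "b \<in> carrier A" using a b by (auto simp: plus_iff minus_iff)
  have "D (monomial A (a \<otimes>\<^bsub>A\<^esub> b) (- 1)) = monom (UP R) (\<epsilon> a) 0 \<otimes>\<^bsub>UP R\<^esub> D (monomial A b (- 1))"
    using LC.der_mult[OF D C_plus[OF a] C_minus[OF b]] c
    by (simp add: monomial_mult counit_plus counit_minus a b D_plus_closed D_minus_closed R.monom_in_UP counit_closed)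
  then show ?thesis using c b by (simp add: R.UP_mult_const D_minus_closed counit_closed)
qed

text \<open>\<open>a \<otimes> b\<close> in degree 0 is \<open>t\<close> times the product of
  \<open>a s^-1\<close> and \<open>b s^-1\<close>. Both factors have counit 0, so the Leibniz rule
  gives 0 for that product.\<close>

lemma D_minus_minus:
  assumes a: "a \<in> Am" and b: "b \<in> Am"
  shows "D (monomial A (a \<otimes>\<^bsub>A\<^esub> b) 0) = \<zero>\<^bsub>UP R\<^esub>"
proof -
  have c: "a \<in> carrier A" "b \<in> carrier A" using a b by (auto simp: minus_iff)
  let ?w = "monomial A a (- 1) \<otimes>\<^bsub>C\<^esub> monomial A b (- 1)"
  have w: "?w \<in> carrier C" using C_mult_closed[OF C_minus[OF a] C_minus[OF b]] by simp
  have "D ?w = \<zero>\<^bsub>UP R\<^esub>"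
    using LC.der_mult[OF D C_minus[OF a] C_minus[OF b]] a b
    by (simp add: counit_minus D_minus_closed)
  moreover have "monomial A (a \<otimes>\<^bsub>A\<^esub> b) 0 = t \<odot>\<^bsub>C\<^esub> ?w"
    using c by (simp add: monomial_mult iota_t s_smult del: One_nat_def)
  ultimately show ?thesis using LC.der_smult[OF D t_closed w] t_closed by simp
qed

lemma coef_closed: "coef D n \<in> carrier \<g>"
proof (rule derivationI)
  note pc = R.UP_closed[OF D_plus_closed] and mc = R.UP_closed[OF D_minus_closed]
  show "coef D n a \<in> carrier R" if "a \<in> carrier A" for a
    using that by (simp add: coef_def pc mc sym_plus alt_minus)
  show "coef D n a = undefined" if "a \<notin> carrier A" for a
    using that by (simp add: coef_def)
  show "coef D n (a \<oplus>\<^bsub>A\<^esub> b) = coef D n a \<oplus> coef D n b" if ab: "a \<in> carrier A" "b \<in> carrier A" for a b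
  proof -
    have 1: "sym (a \<oplus>\<^bsub>A\<^esub> b) = sym a \<oplus>\<^bsub>A\<^esub> sym b"
      using ab by (simp add: sym_def theta_add smult_r_distr M.add.m_ac)
    have 2: "alt (a \<oplus>\<^bsub>A\<^esub> b) = alt a \<oplus>\<^bsub>A\<^esub> alt b"
      using ab by (simp add: alt_def theta_add smult_r_distr M.add.m_ac a_minus_def M.minus_add)
    have 3: "D (monomial A (sym a \<oplus>\<^bsub>A\<^esub> sym b) 0) = D (monomial A (sym a) 0) \<oplus>\<^bsub>UP R\<^esub> D (monomial A (sym b) 0)"
      using LC.der_add[OF D C_plus[OF sym_plus[OF ab(1)]] C_plus[OF sym_plus[OF ab(2)]]] ab
      by (simp add: monomial_add)
    have 4: "D (monomial A (alt a \<oplus>\<^bsub>A\<^esub> alt b) (- 1)) = D (monomial A (alt a) (- 1)) \<oplus>\<^bsub>UP R\<^esub> D (monomial A (alt b) (- 1))"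
      using LC.der_add[OF D C_minus[OF alt_minus[OF ab(1)]] C_minus[OF alt_minus[OF ab(2)]]] ab
      by (simp add: monomial_add)
    show ?thesis using ab
      by (simp add: coef_def 1 2 3 4 R.UP_add D_plus_closed D_minus_closed sym_plus alt_minus pc mc R.add.m_ac)
  qed
  show "coef D n (r \<odot>\<^bsub>A\<^esub> a) = r \<otimes> coef D n a" if ra: "r \<in> carrier R" "a \<in> carrier A" for r a
  proof -
    let ?r = "monom (UP R) r 0"
    have r: "?r \<in> carrier (UP R)" using ra by (simp add: R.monom_in_UP)
    have hr: "half \<odot>\<^bsub>A\<^esub> (r \<odot>\<^bsub>A\<^esub> x) = r \<odot>\<^bsub>A\<^esub> (half \<odot>\<^bsub>A\<^esub> x)" if "x \<in> carrier A" for x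
      using that ra by (simp add: smult_assoc1[symmetric] R.m_comm)
    have 1: "sym (r \<odot>\<^bsub>A\<^esub> a) = r \<odot>\<^bsub>A\<^esub> sym a"
      using ra by (simp add: sym_def theta_smult smult_r_distr[symmetric] hr)
    have 2: "alt (r \<odot>\<^bsub>A\<^esub> a) = r \<odot>\<^bsub>A\<^esub> alt a"
      using ra by (simp add: alt_def theta_smult smult_r_distr[symmetric] hr a_minus_def smult_r_minus[symmetric])
    have m: "?r \<odot>\<^bsub>C\<^esub> monomial A b i = monomial A (r \<odot>\<^bsub>A\<^esub> b) i" if "b \<in> carrier A" for b i
      using that ra by (simp add: R.poly_to_laurent_monom L_smult_monomial)
    have 3: "D (monomial A (r \<odot>\<^bsub>A\<^esub> sym a) 0) = ?r \<otimes>\<^bsub>UP R\<^esub> D (monomial A (sym a) 0)"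
      using LC.der_smult[OF D r C_plus[OF sym_plus[OF ra(2)]]] ra by (simp only: m sym_closed)
    have 4: "D (monomial A (r \<odot>\<^bsub>A\<^esub> alt a) (- 1)) = ?r \<otimes>\<^bsub>UP R\<^esub> D (monomial A (alt a) (- 1))"
      using LC.der_smult[OF D r C_minus[OF alt_minus[OF ra(2)]]] ra by (simp only: m alt_closed)
    show ?thesis using ra
      by (simp add: coef_def 1 2 3 4 R.UP_mult_const D_plus_closed D_minus_closed sym_plus alt_minus pc mc R.r_distr)
  qed
  show "coef D n (a \<otimes>\<^bsub>A\<^esub> b) = \<epsilon> a \<otimes> coef D n b \<oplus> coef D n a \<otimes> \<epsilon> b"
    if ab: "a \<in> carrier A" "b \<in> carrier A" for a b
  proof -
    note s = sym_plus[OF ab(1)] sym_plus[OF ab(2)] alt_minus[OF ab(1)] alt_minus[OF ab(2)]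
    have c: "sym a \<in> carrier A" "sym b \<in> carrier A" "alt a \<in> carrier A" "alt b \<in> carrier A"
      using ab by simp_all
    let ?p = "sym a \<otimes>\<^bsub>A\<^esub> sym b \<oplus>\<^bsub>A\<^esub> alt a \<otimes>\<^bsub>A\<^esub> alt b"
    \<comment> \<open>The even factor stands first in both summands, as \<open>D_plus_minus\<close>
      requires.\<close>
    let ?m = "sym a \<otimes>\<^bsub>A\<^esub> alt b \<oplus>\<^bsub>A\<^esub> sym b \<otimes>\<^bsub>A\<^esub> alt a"
    have pp: "sym a \<otimes>\<^bsub>A\<^esub> sym b \<in> Ap" "alt a \<otimes>\<^bsub>A\<^esub> alt b \<in> Ap" "?p \<in> Ap"
      using s c by (auto simp: plus_iff minus_iff theta_add theta_mult l_minus r_minus)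
    have mm: "sym a \<otimes>\<^bsub>A\<^esub> alt b \<in> Am" "sym b \<otimes>\<^bsub>A\<^esub> alt a \<in> Am" "?m \<in> Am"
      using s c by (auto simp: plus_iff minus_iff theta_add theta_mult l_minus r_minus M.minus_add)
    have "a \<otimes>\<^bsub>A\<^esub> b = (sym a \<oplus>\<^bsub>A\<^esub> alt a) \<otimes>\<^bsub>A\<^esub> (sym b \<oplus>\<^bsub>A\<^esub> alt b)"
      using ab by (simp add: sym_add_alt)
    also have "\<dots> = ?p \<oplus>\<^bsub>A\<^esub> ?m"
      using c by (simp add: l_distr r_distr m_comm[of "alt a" "sym b"] M.add.m_ac)
    finally have "a \<otimes>\<^bsub>A\<^esub> b = ?p \<oplus>\<^bsub>A\<^esub> ?m" .
    then have 1: "sym (a \<otimes>\<^bsub>A\<^esub> b) = ?p" "alt (a \<otimes>\<^bsub>A\<^esub> b) = ?m"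
      using sym_alt_unique[OF pp(3) mm(3)] by simp_all
    \<comment> \<open>The product of the odd parts drops out by \<open>D_minus_minus\<close>. This
      matches the Leibniz rule to be shown, where odd parts have counit 0.\<close>
    have 2: "D (monomial A ?p 0) n = D (monomial A (sym a \<otimes>\<^bsub>A\<^esub> sym b) 0) n"
      using LC.der_add[OF D C_plus[OF pp(1)] C_plus[OF pp(2)]] c D_plus_closed[OF pp(1)]
      by (simp add: monomial_add D_minus_minus[OF s(3,4)])
    have 3: "D (monomial A ?m (- 1)) n =
        D (monomial A (sym a \<otimes>\<^bsub>A\<^esub> alt b) (- 1)) n \<oplus> D (monomial A (sym b \<otimes>\<^bsub>A\<^esub> alt a) (- 1)) n"
      using LC.der_add[OF D C_minus[OF mm(1)] C_minus[OF mm(2)]] c D_minus_closed[OF mm(1)] D_minus_closed[OF mm(2)]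
      by (simp add: monomial_add R.UP_add)
    have e: "\<epsilon> (sym x) = \<epsilon> x" if x: "x \<in> carrier A" for x
    proof -
      have "\<epsilon> (sym x \<oplus>\<^bsub>A\<^esub> alt x) = \<epsilon> (sym x)"
        using x semilinearD(2)[OF counit_linear_form, of "sym x" "alt x"] counit_minus_zero[OF alt_minus[OF x]]
        by (simp add: counit_closed)
      then show ?thesis using x by (simp add: sym_add_alt)
    qed
    have cl: "D (monomial A (sym a) 0) n \<in> carrier R" "D (monomial A (sym b) 0) n \<in> carrier R"
      "D (monomial A (alt a) (- 1)) n \<in> carrier R" "D (monomial A (alt b) (- 1)) n \<in> carrier R"
      using s by (simp_all add: pc mc)
    show ?thesis using ab cl
      by (simp add: coef_def 1 2 3 D_plus_plus[OF s(1,2)] D_plus_minus[OF s(1,4)] D_plus_minus[OF s(2,3)] e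
          counit_closed R.l_distr R.r_distr R.m_comm[of "\<epsilon> b"] R.add.m_ac)
  qed
qed

text \<open>For a single \<open>a\<close> the values are coefficients of a fixed polynomial, with a
  bound depending on \<open>a\<close>. As every \<open>coef D n\<close> is a derivation, a bound on
  a finite determining set holds for all \<open>a\<close>.\<close>

lemma coef_bound:
  assumes fp: "finitely_presented_algebra R A"
  shows "\<exists>N. \<forall>n>N. \<forall>a\<in>carrier A. coef D n a = \<zero>"
proof -
  obtain X where X: "finite X" "X \<subseteq> carrier A"
    and det: "\<And>E. E \<in> carrier \<g> \<Longrightarrow> (\<forall>x\<in>X. E x = \<zero>) \<Longrightarrow> \<forall>a\<in>carrier A. E a = \<zero>"
    using derivation_finitely_determined[OF fp] by blast
  have "\<exists>N. \<forall>n>N. coef D n x = \<zero>" if x: "x \<in> X" for x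
  proof -
    have xa: "x \<in> carrier A" using X x by blast
    obtain N1 where N1: "\<forall>n>N1. D (monomial A (sym x) 0) n = \<zero>"
      using D_plus_closed[OF sym_plus[OF xa]] by (auto simp: R.UP_carrier)
    obtain N2 where N2: "\<forall>n>N2. D (monomial A (alt x) (- 1)) n = \<zero>"
      using D_minus_closed[OF alt_minus[OF xa]] by (auto simp: R.UP_carrier)
    show ?thesis using N1 N2 xa by (intro exI[of _ "max N1 N2"]) (simp add: coef_def)
  qed
  then obtain B where B: "\<And>x n. x \<in> X \<Longrightarrow> n > B x \<Longrightarrow> coef D n x = \<zero>" by metis
  \<comment> \<open>Inserting 0 keeps the maximum meaningful when the determining set is
    empty.\<close>
  have "coef D n x = \<zero>" if "n > Max (insert 0 (B ` X))" "x \<in> X" for n x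
    using that X(1) by (intro B) (auto simp: Max_less_iff)
  then show ?thesis using det[OF coef_closed] by blast
qed

text \<open>Both derivations agree on the algebra generators of the contraction algebra, and a
  derivation is determined by its values there.\<close>

lemma F_surj:
  assumes fp: "finitely_presented_algebra R A"
  shows "\<exists>X\<in>carrier GT. F X = D"
proof -
  obtain N where N: "\<And>n a. n > N \<Longrightarrow> a \<in> carrier A \<Longrightarrow> coef D n a = \<zero>"
    using coef_bound[OF fp] by blast
  let ?X = "series N (coef D)"
  have X: "?X \<in> carrier GT" by (rule GT.T.finsum_closed) (simp add: coef_closed R.monom_in_UP)
  have FX: "F ?X \<in> carrier \<h>" using X by (rule F_closed)
  have zero: "monomial A \<zero>\<^bsub>A\<^esub> i = \<zero>\<^bsub>C\<^esub>" for i by (simp add: monomial_zero)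
  have plus: "F ?X (monomial A a 0) = D (monomial A a 0)" if a: "a \<in> Ap" for a
  proof
    fix n
    have ac: "a \<in> carrier A" using a by (simp add: plus_iff)
    \<comment> \<open>For even \<open>a\<close> the second summand of \<open>coef\<close> is the
      value of \<open>D\<close> at 0, which vanishes.\<close>
    have s: "sym a = a" "alt a = \<zero>\<^bsub>A\<^esub>"
      using sym_alt_unique[of a "\<zero>\<^bsub>A\<^esub>"] a ac by (simp_all add: minus_iff theta_zero)
    have "coef D n a = D (monomial A a 0) n"
      using a ac LC.der_zero[OF D] R.UP_closed[OF D_plus_closed[OF a]] by (simp add: coef_def s zero R.UP_zero del: C_simps)
    then show "F ?X (monomial A a 0) n = D (monomial A a 0) n"
      using F_series[of "coef D" "monomial A a 0" a N n] coef_closed C_plus[OF a] ac N[of n a]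
      by (auto simp: cder_const a)
  qed
  have minus: "F ?X (monomial A a (- 1)) = D (monomial A a (- 1))" if a: "a \<in> Am" for a
  proof
    fix n
    have ac: "a \<in> carrier A" using a by (simp add: minus_iff)
    have s: "sym a = \<zero>\<^bsub>A\<^esub>" "alt a = a"
      using sym_alt_unique[of "\<zero>\<^bsub>A\<^esub>" a] a ac by (simp_all add: plus_iff theta_zero)
    have "coef D n a = D (monomial A a (- 1)) n"
      using a ac LC.der_zero[OF D] R.UP_closed[OF D_minus_closed[OF a]] by (simp add: coef_def s zero R.UP_zero del: C_simps)
    then show "F ?X (monomial A a (- 1)) n = D (monomial A a (- 1)) n"
      using F_series[of "coef D" "monomial A a (- 1)" a N n] coef_closed C_minus[OF a] ac N[of n a]
      by (auto simp: cder_shift a)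
  qed
  have "F ?X = D"
  proof (rule LC.der_eqI[OF FX D])
    fix u assume "u \<in> carrier C"
    then show "F ?X u = D u" unfolding carrier_C
    proof (induction rule: generated_subalgebra.induct)
      case (incl x)
      then show ?case using plus minus by auto
    next
      case one
      then show ?case using plus[OF one_plus] by (simp add: MR_one)
    next
      case (add x y)
      then have "x \<in> carrier C" "y \<in> carrier C" by (simp_all add: carrier_C)
      then show ?case using add LC.der_add[OF FX, of x y] LC.der_add[OF D, of x y] by simp
    next
      case (mult x y)
      then have "x \<in> carrier C" "y \<in> carrier C" by (simp_all add: carrier_C)
      then show ?case using mult LC.der_mult[OF FX, of x y] LC.der_mult[OF D, of x y] by simp
    next
      case (smult r x)
      then have "x \<in> carrier C" by (simp_all add: carrier_C)
      then show ?case using smult LC.der_smult[OF FX, of r x] LC.der_smult[OF D, of r x] by simp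
    qed
  qed
  then show ?thesis using X by blast
qed

end

section \<open>The contraction bracket: uniqueness, and existence by transport\<close>

abbreviation "emb x \<equiv> pure_tensor R \<g> (UP R) x \<one>\<^bsub>UP R\<^esub>"

lemma contraction_bracketD:
  assumes "contraction_bracket R \<g> \<sigma> br"
  shows "X \<in> carrier GT \<Longrightarrow> br X \<in> module_homs (UP R) G G"
    and "Y \<in> carrier GT \<Longrightarrow> (\<lambda>X. br X Y) \<in> module_homs (UP R) G G"
    and "X \<in> carrier GT \<Longrightarrow> Y \<in> carrier GT \<Longrightarrow> br X Y = \<ominus>\<^bsub>G\<^esub> br Y X"
    and "x \<in> gp \<Longrightarrow> y \<in> carrier \<g> \<Longrightarrow> br (emb x) (emb y) = emb (bracket \<g> x y)"
    and "x \<in> gm \<Longrightarrow> y \<in> gm \<Longrightarrow> br (emb x) (emb y) = t \<odot>\<^bsub>G\<^esub> emb (bracket \<g> x y)"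
  using assms unfolding contraction_bracket_def Let_def G_simps by blast+

lemma emb_closed: "x \<in> carrier \<g> \<Longrightarrow> emb x \<in> carrier GT"
  by simp

lemma emb_decompose:
  assumes x: "x \<in> carrier \<g>" shows "emb x = emb (gsym x) \<oplus>\<^bsub>GT\<^esub> emb (galt x)"
  using GT.pure_add_left[OF gp_apply(1)[OF gsym_gp[OF x]] gm_apply(1)[OF galt_gm[OF x]] C.R.one_closed] x
  by (simp add: gsym_add_galt)

text \<open>The clauses for the bracket prescribe values on eigenvectors only. These generate over
  \<open>k[t]\<close>, because \<open>\<g>\<close> is the sum of its eigenspaces.\<close>

lemma emb_induct [consumes 1, case_names even odd smult add]:
  assumes X: "X \<in> carrier GT"
    and even: "\<And>x. x \<in> gp \<Longrightarrow> Q (emb x)"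
    and odd: "\<And>x. x \<in> gm \<Longrightarrow> Q (emb x)"
    and smult: "\<And>p X. p \<in> carrier (UP R) \<Longrightarrow> X \<in> carrier GT \<Longrightarrow> Q X \<Longrightarrow> Q (p \<odot>\<^bsub>G\<^esub> X)"
    and add: "\<And>X Y. X \<in> carrier GT \<Longrightarrow> Y \<in> carrier GT \<Longrightarrow> Q X \<Longrightarrow> Q Y \<Longrightarrow> Q (X \<oplus>\<^bsub>GT\<^esub> Y)"
  shows "Q X"
  using X
proof (induction rule: GT.tensor_induct)
  case (pure x p)
  have "Q (emb (gsym x) \<oplus>\<^bsub>GT\<^esub> emb (galt x))"
    using pure gsym_gp[of x] galt_gm[of x] gp_apply(1) gm_apply(1)
    by (intro add even odd emb_closed) auto
  then have "Q (emb x)" using pure by (simp only: emb_decompose)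
  then have "Q (p \<odot>\<^bsub>G\<^esub> emb x)" using pure by (intro smult emb_closed)
  then show ?case using pure by (simp add: G_smult_pure)
qed (rule add)

lemma module_homsD:
  assumes "f \<in> module_homs (UP R) G G"
  shows "X \<in> carrier GT \<Longrightarrow> f X \<in> carrier GT"
    and "X \<in> carrier GT \<Longrightarrow> Y \<in> carrier GT \<Longrightarrow> f (X \<oplus>\<^bsub>GT\<^esub> Y) = f X \<oplus>\<^bsub>GT\<^esub> f Y"
    and "p \<in> carrier (UP R) \<Longrightarrow> X \<in> carrier GT \<Longrightarrow> f (p \<odot>\<^bsub>G\<^esub> X) = p \<odot>\<^bsub>G\<^esub> f X"
  using assms by (auto simp: module_homs_def)

text \<open>Bilinearity over \<open>k[t]\<close> reduces the claim to pairs of eigenvectors, one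
  argument at a time. It lets an arbitrarily chosen bracket be replaced by the transported
  one.\<close>

lemma contraction_bracket_unique:
  assumes b: "contraction_bracket R \<g> \<sigma> br" and b': "contraction_bracket R \<g> \<sigma> br'"
    and X: "X \<in> carrier GT" and Y: "Y \<in> carrier GT"
  shows "br X Y = br' X Y"
proof -
  note B = contraction_bracketD[OF b] and B' = contraction_bracketD[OF b']
  have gen: "br (emb x) (emb y) = br' (emb x) (emb y)" if xy: "x \<in> gp \<or> x \<in> gm" "y \<in> gp \<or> y \<in> gm" for x y
  proof -
    have c: "x \<in> carrier \<g>" "y \<in> carrier \<g>" using xy gp_apply(1) gm_apply(1) by auto
    consider "x \<in> gp" | "x \<in> gm" "y \<in> gm" | "x \<in> gm" "y \<in> gp" using xy by blast
    then show ?thesis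
    proof cases
      case 1
      then show ?thesis using B(4) B'(4) c by simp
    next
      case 2
      then show ?thesis using B(5) B'(5) by simp
    next
      \<comment> \<open>No clause covers an odd first and an even second argument; antisymmetry
        brings it back to the first clause.\<close>
      case 3
      then have "br (emb y) (emb x) = br' (emb y) (emb x)" using B(4) B'(4) c by simp
      then show ?thesis using B(3)[OF emb_closed[OF c(1)] emb_closed[OF c(2)]]
          B'(3)[OF emb_closed[OF c(1)] emb_closed[OF c(2)]] by simp
    qed
  qed
  have right: "br (emb x) Y = br' (emb x) Y" if x: "x \<in> gp \<or> x \<in> gm" for x
  proof -
    have c: "emb x \<in> carrier GT" using that gp_apply(1) gm_apply(1) by auto
    note H = module_homsD[OF B(1)[OF c]] module_homsD[OF B'(1)[OF c]]
    show ?thesis using Y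
      by (induction rule: emb_induct) (use gen x in \<open>simp_all add: H\<close>)
  qed
  note H = module_homsD[OF B(2)[OF Y]] module_homsD[OF B'(2)[OF Y]]
  show ?thesis using X
    by (induction rule: emb_induct) (simp_all add: H right)
qed

lemma F_emb: "x \<in> carrier \<g> \<Longrightarrow> F (emb x) = cder x"
  by (simp add: F_pure cder_closed_lie)

context
  assumes fp: "finitely_presented_algebra R A"
begin

lemma F_bij: "bij_betw F (carrier GT) (carrier \<h>)"
  unfolding bij_betw_def using F_inj F_closed F_surj[OF _ fp] by blast

abbreviation "Finv \<equiv> inv_into (carrier GT) F"

lemma Finv_closed: "D \<in> carrier \<h> \<Longrightarrow> Finv D \<in> carrier GT"
  using bij_betw_inv_into[OF F_bij] by (auto simp: bij_betw_def)

lemma F_Finv: "D \<in> carrier \<h> \<Longrightarrow> F (Finv D) = D"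
  using F_bij by (simp add: bij_betw_inv_into_right)

lemma Finv_F: "X \<in> carrier GT \<Longrightarrow> Finv (F X) = X"
  using F_bij by (simp add: bij_betw_inv_into_left)

lemma Finv_add:
  assumes "D \<in> carrier \<h>" "E \<in> carrier \<h>"
  shows "Finv (D \<oplus>\<^bsub>\<h>\<^esub> E) = Finv D \<oplus>\<^bsub>GT\<^esub> Finv E"
proof -
  have "D \<oplus>\<^bsub>\<h>\<^esub> E = F (Finv D \<oplus>\<^bsub>GT\<^esub> Finv E)"
    using assms by (simp add: F_add Finv_closed F_Finv)
  then show ?thesis using assms by (simp add: Finv_F Finv_closed)
qed

lemma Finv_smult:
  assumes "p \<in> carrier (UP R)" "D \<in> carrier \<h>"
  shows "Finv (p \<odot>\<^bsub>\<h>\<^esub> D) = p \<odot>\<^bsub>G\<^esub> Finv D"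
proof -
  have "p \<odot>\<^bsub>\<h>\<^esub> D = F (p \<odot>\<^bsub>G\<^esub> Finv D)"
    using assms by (simp add: F_smult Finv_closed F_Finv)
  then show ?thesis using assms by (simp add: Finv_F Finv_closed G_smult_closed)
qed

lemma Finv_minus:
  assumes "D \<in> carrier \<h>" shows "Finv (\<ominus>\<^bsub>\<h>\<^esub> D) = \<ominus>\<^bsub>G\<^esub> Finv D"
proof -
  interpret G': abelian_group G by (rule G_abelian_group)
  have "Finv (\<ominus>\<^bsub>\<h>\<^esub> D) \<oplus>\<^bsub>G\<^esub> Finv D = Finv (\<ominus>\<^bsub>\<h>\<^esub> D \<oplus>\<^bsub>\<h>\<^esub> D)"
    using assms by (simp add: Finv_add)
  also have "\<dots> = Finv (F \<zero>\<^bsub>GT\<^esub>)" using assms by (simp add: LC.G.l_neg F_zero)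
  also have "\<dots> = \<zero>\<^bsub>G\<^esub>" by (simp add: Finv_F)
  finally show ?thesis using assms by (intro G'.minus_equality[symmetric]) (simp_all add: Finv_closed)
qed

lemma Finv_cder: "x \<in> carrier \<g> \<Longrightarrow> Finv (cder x) = emb x"
  using Finv_F[OF emb_closed[of x]] by (simp add: F_emb)

text \<open>By bilinearity over \<open>k[t]\<close> it is enough to treat pure tensors, where
  \<open>bracket_cder_closed\<close> applies. Since \<open>F\<close> is onto, this gives closure for
  all derivations.\<close>

lemma bracket_F_closed:
  assumes X: "X \<in> carrier GT" and Y: "Y \<in> carrier GT"
  shows "bracket \<h> (F X) (F Y) \<in> carrier \<h>"
  using X
proof (induction rule: GT.tensor_induct)
  case (pure x p)
  note xp = pure
  show ?case using Y
  proof (induction rule: GT.tensor_induct)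
    case (pure y q)
    then show ?case using xp
      by (simp add: F_pure LC.bracket_smult_left LC.bracket_smult_right cder_closed_lie bracket_cder_closed)
  next
    case (add Y Y')
    then show ?case using xp by (simp add: F_add LC.bracket_add_right F_closed)
  qed
next
  case (add X X')
  then show ?case using Y by (simp add: F_add LC.bracket_add_left F_closed)
qed

lemma bracket_h_closed: "D \<in> carrier \<h> \<Longrightarrow> E \<in> carrier \<h> \<Longrightarrow> bracket \<h> D E \<in> carrier \<h>"
  using bracket_F_closed[OF Finv_closed Finv_closed] by (simp add: F_Finv)

definition transported :: "('c \<Rightarrow> 'a, nat \<Rightarrow> 'a) tensor \<Rightarrow> ('c \<Rightarrow> 'a, nat \<Rightarrow> 'a) tensor \<Rightarrow> ('c \<Rightarrow> 'a, nat \<Rightarrow> 'a) tensor" where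
  "transported X Y = Finv (bracket \<h> (F X) (F Y))"

text \<open>Linearity and antisymmetry are those of the bracket of derivations, and the prescribed
  values are the brackets of extended eigenvectors. This is the witness behind the choice in
  \<open>contraction_lie_algebra\<close>.\<close>

lemma transported_contraction_bracket: "contraction_bracket R \<g> \<sigma> transported"
  unfolding contraction_bracket_def Let_def G_simps
proof (intro conjI ballI)
  show "transported X \<in> module_homs (UP R) G G" if "X \<in> carrier GT" for X
    using that by (simp add: module_homs_def transported_def F_add F_smult F_closed LC.bracket_add_right
        LC.bracket_smult_right bracket_h_closed Finv_add Finv_smult Finv_closed)
  show "(\<lambda>X. transported X Y) \<in> module_homs (UP R) G G" if "Y \<in> carrier GT" for Y
    using that by (simp add: module_homs_def transported_def F_add F_smult F_closed LC.bracket_add_left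
        LC.bracket_smult_left bracket_h_closed Finv_add Finv_smult Finv_closed)
  show "transported X Y = \<ominus>\<^bsub>G\<^esub> transported Y X" if "X \<in> carrier GT" "Y \<in> carrier GT" for X Y
    using that LC.bracket_swap[of "F X" "F Y"]
    by (simp add: transported_def F_closed bracket_h_closed Finv_minus)
  show "transported (emb x) (emb y) = emb (bracket \<g> x y)" if "x \<in> gp" "y \<in> carrier \<g>" for x y
    using that gp_apply(1)[OF that(1)]
    by (simp add: transported_def F_emb bracket_cder_gp Finv_cder bracket_closed)
  show "transported (emb x) (emb y) = t \<odot>\<^bsub>G\<^esub> emb (bracket \<g> x y)" if "x \<in> gm" "y \<in> gm" for x y
    using that gm_apply(1)[OF that(1)] gm_apply(1)[OF that(2)]
    by (simp add: transported_def F_emb bracket_cder_gm_gm Finv_smult Finv_cder bracket_closed cder_closed_lie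
        t_closed del: One_nat_def)
qed

lemma contraction_lie_isomorphic:
  "lie_algebra_isomorphic (UP R) \<h> (contraction_lie_algebra R \<g> \<sigma>)"
proof -
  let ?br = "SOME br. contraction_bracket R \<g> \<sigma> br"
  let ?G = "contraction_lie_algebra R \<g> \<sigma>"
  have br: "contraction_bracket R \<g> \<sigma> ?br"
    by (rule someI[of _ transported]) (rule transported_contraction_bracket)
  have [simp]: "carrier ?G = carrier GT" "ring.add ?G = ring.add GT" "smult ?G = smult G" "bracket ?G = ?br"
    by (simp_all add: contraction_lie_algebra_def module.defs lie_algebra.defs)
  have "Finv (bracket \<h> D E) = ?br (Finv D) (Finv E)" if "D \<in> carrier \<h>" "E \<in> carrier \<h>" for D E
  proof -
    \<comment> \<open>The chosen bracket may differ from the transported one outside the carrier; on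
      the carrier uniqueness identifies them.\<close>
    have "?br (Finv D) (Finv E) = transported (Finv D) (Finv E)"
      using that by (intro contraction_bracket_unique[OF br transported_contraction_bracket] Finv_closed)
    then show ?thesis using that by (simp add: transported_def F_Finv)
  qed
  then have "Finv \<in> lie_algebra_iso (UP R) \<h> ?G"
    using bij_betw_inv_into[OF F_bij]
    by (simp add: lie_algebra_iso_def module_homs_def Finv_closed Finv_add Finv_smult bracket_h_closed)
  then show ?thesis by (auto simp: lie_algebra_isomorphic_def)
qed

end

end

theorem proposition3p8:
  fixes k :: "'k ring" and A :: "('k, 'a) module"
    and \<Delta> :: "'a \<Rightarrow> ('a, 'a) tensor" and \<epsilon> :: "'a \<Rightarrow> 'k" and S :: "'a \<Rightarrow> 'a" and \<theta> :: "'a \<Rightarrow> 'a"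
  assumes "cring k"
    and "\<one>\<^bsub>k\<^esub> \<oplus>\<^bsub>k\<^esub> \<one>\<^bsub>k\<^esub> \<in> Units k"
    and "hopf_algebra k A \<Delta> \<epsilon> S"
    and "hopf_involution k A \<Delta> \<epsilon> S \<theta>"
    and "flat_module (UP k) (contraction_algebra k A \<theta>)"
    and "finitely_presented_algebra k A"
  shows "lie_algebra_isomorphic (UP k)
    (lie_algebra_of (UP k) (contraction_algebra k A \<theta>)
       (contraction_comult k A \<Delta> \<theta>) (contraction_counit k \<epsilon>))
    (contraction_lie_algebra k (lie_algebra_of k A \<Delta> \<epsilon>) (lie_involution A \<theta>))"
proof -
  interpret contraction k A \<Delta> \<epsilon> S \<theta>
    using assms(2,4,5) by (simp add: contraction_def contraction_axioms_def)
  show ?thesis by (rule contraction_lie_isomorphic[OF assms(6)])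
qed

end
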